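(* Let $\alpha\in(0,1)$, $C>0$, and for $x\ge0$ let $\mathbb{P}^\alpha_x$ be the law of the stable subordinator of index $\alpha$ started at $x$ (with Laplace exponent $q\mapsto Cq^\alpha$). Let $b>0$. Let $L=\sup\{t\ge0:X_t<b\}$ (which is finite $\mathbb{P}_0^\alpha$-almost surely), $g=X_{L-}$, and define $Y=(Y_t)_{t\ge0}$ by $$Y_t=\begin{cases}\dfrac bg\,X_{t(g/b)^\alpha},& \text{if } t(g/b)^\alpha<L,\\ \Delta,&\text{otherwise.}\end{cases}$$ Then the law of $Y$ under $\mathbb{P}^\alpha_0$ is $\mathbb{P}^{h_\alpha}_0$, the law of the stable subordinator started at $0$ and conditioned to die at $b$.
   Context: $X$ is the canonical process on Skorohod space. Under $\mathbb{P}_x^\alpha$, $X-x$ is a Lévy process with increasing paths and $\mathbb{E}^\alpha_x(e^{-q(X_t-x)})=e^{-tCq^\alpha}$, $q\ge0$. For $t>0$ let $f^\alpha_t$ be the continuous density of $X_t$ under $\mathbb{P}^\alpha_0$; the potential density is $$u_\alpha(a)=\int_0^\infty f^\alpha_t(a)\,dt=\frac{1}{C\,\Gamma(\alpha)\,a^{1-\alpha}}\mathbf 1_{a>0}.$$ For the given $b>0$ let $h_\alpha:[0,\infty)\to[0,\infty)$ be $h_\alpha(a)=u_\alpha(b-a)$ if $a\le b$, and $h_\alpha(a)=0$ otherwise. Let $\Delta$ be an additional isolated absorbing point (cemetery) and $\zeta=\inf\{t:X_t=\Delta\}$ the death time. For $a\in[0,b)$, $\mathbb{P}_a^{h_\alpha}$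 (the Doob $h_\alpha$-transform of $\mathbb{P}^\alpha_a$, called the law of the stable subordinator started at $a$ conditioned to die at $b$) is the unique probability measure on the Skorohod space of càdlàg paths in $[0,\infty)\cup\{\Delta\}$, concentrated on paths with values in $[0,b)\cup\{\Delta\}$ that are absorbed at $\Delta$, such that for all $s\ge0$ and $A\in\mathscr{F}_s=\sigma(X_r:r\le s)$, $$\mathbb{P}_a^{h_\alpha}(A\cap\{s<\zeta\})=\mathbb{E}^\alpha_a\left(\frac{h_\alpha(X_s)}{h_\alpha(a)}\mathbf 1_A\right).$$ *)

theory Defs
  imports "HOL-Probability.Probability"
begin

(* The state space is the topological sum of [0,oo) and the isolated cemetery point None;
   Some x stands for the point x of [0,oo). *)

definition state_topology :: "real option topology" where
  "state_topology = topology (\<lambda>U. U \<subseteq> insert None (Some ` {0..}) \<and>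
     openin (top_of_set {0..}) {x. Some x \<in> U})"

lemma openin_state_topology:
  "openin state_topology U \<longleftrightarrow>
     U \<subseteq> insert None (Some ` {0..}) \<and> openin (top_of_set {0..}) {x. Some x \<in> U}"
proof -
  let ?P = "\<lambda>U. U \<subseteq> insert None (Some ` {0..}) \<and>
    openin (top_of_set {0::real..}) {x. Some x \<in> U}"
  have "istopology ?P"
    unfolding istopology_def
  proof (intro conjI allI impI)
    fix S T assume "?P S" "?P T"
    moreover have "{x. Some x \<in> S \<inter> T} = {x. Some x \<in> S} \<inter> {x. Some x \<in> T}"
      by auto
    ultimately show "S \<inter> T \<subseteq> insert None (Some ` {0..})"
      "openin (top_of_set {0..}) {x. Some x \<in> S \<inter> T}"
      by (auto intro: openin_Int)
  next
    fix K assume K: "\<forall>S\<in>K. ?P S"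
    have "{x. Some x \<in> \<Union>K} = \<Union>((\<lambda>S. {x. Some x \<in> S}) ` K)"
      by auto
    with K show "\<Union>K \<subseteq> insert None (Some ` {0..})"
      "openin (top_of_set {0..}) {x. Some x \<in> \<Union>K}"
      by (blast, auto intro!: openin_Union)
  qed
  then show ?thesis
    by (simp add: state_topology_def topology_inverse')
qed

lemma topspace_state_topology: "topspace state_topology = insert None (Some ` {0..})"
proof
  show "topspace state_topology \<subseteq> insert None (Some ` {0..})"
    using openin_state_topology openin_topspace by blast
  have "{x. Some x \<in> insert None (Some ` {0::real..})} = {0..}"
    by auto
  then have "openin state_topology (insert None (Some ` {0..}))"
    by (simp add: openin_state_topology)
  then show "insert None (Some ` {0..}) \<subseteq> topspace state_topology"
    by (rule openin_subset)
qed

definition state_borel :: "real option measure" where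
  "state_borel = sigma (topspace state_topology) {U. openin state_topology U}"

(* Only the values of f on [0,oo) matter. *)
definition cadlag :: "'a topology \<Rightarrow> (real \<Rightarrow> 'a) \<Rightarrow> bool" where
  "cadlag T f \<longleftrightarrow> (\<forall>t\<ge>0. limitin T f (f t) (at_right t)) \<and>
     (\<forall>t>0. \<exists>l. limitin T f l (at_left t))"

type_synonym path = "real \<Rightarrow> real option"

(* Skorohod space with the sigma-algebra generated by the coordinates; the measure carried by
   this value is irrelevant.  Paths are functions on [0,oo), i.e. elements of extensional {0..}. *)
definition skorohod :: "path measure" where
  "skorohod = restrict_space (PiM {0..} (\<lambda>_. state_borel)) {w. cadlag state_topology w}"

definition past :: "real \<Rightarrow> path measure" where
  "past s = sigma (space skorohod)
     {(\<lambda>w. w r) -` B \<inter> space skorohod | r B. r \<in> {0..s} \<and> B \<in> sets state_borel}"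

definition death_time :: "path \<Rightarrow> ereal" where
  "death_time w = Inf (ereal ` {t. 0 \<le> t \<and> w t = None})"

definition levy_process :: "'a measure \<Rightarrow> (real \<Rightarrow> 'a \<Rightarrow> real) \<Rightarrow> bool" where
  "levy_process M Z \<longleftrightarrow>
     prob_space M \<and>
     (\<forall>t\<ge>0. Z t \<in> borel_measurable M) \<and>
     (AE w in M. Z 0 w = 0) \<and>
     (AE w in M. cadlag euclidean (\<lambda>t. Z t w)) \<and>
     (\<forall>(n::nat) \<tau>. 0 \<le> \<tau> 0 \<and> (\<forall>i<n. \<tau> i \<le> \<tau> (Suc i)) \<longrightarrow>
        prob_space.indep_vars M (\<lambda>_. borel) (\<lambda>i w. Z (\<tau> (Suc i)) w - Z (\<tau> i) w) {..<n}) \<and>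
     (\<forall>s\<ge>0. \<forall>t\<ge>0. distr M borel (\<lambda>w. Z (s + t) w - Z s w) = distr M borel (Z t))"

definition stable_subordinator_law :: "real \<Rightarrow> real \<Rightarrow> real \<Rightarrow> path measure \<Rightarrow> bool" where
  "stable_subordinator_law \<alpha> C x P \<longleftrightarrow>
     sets P = sets skorohod \<and>
     (AE w in P. \<forall>t\<ge>0. w t \<noteq> None) \<and>
     levy_process P (\<lambda>t w. the (w t) - x) \<and>
     (AE w in P. \<forall>s t. 0 \<le> s \<and> s \<le> t \<longrightarrow> the (w s) \<le> the (w t)) \<and>
     (\<forall>t\<ge>0. \<forall>q\<ge>0. (\<integral>w. exp (- q * (the (w t) - x)) \<partial>P) = exp (- t * C * q powr \<alpha>))"

(* f t is the continuous density of X_t under P, for each t > 0; values for t \<le> 0 are unused. *)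
definition continuous_densities :: "path measure \<Rightarrow> (real \<Rightarrow> real \<Rightarrow> real) \<Rightarrow> bool" where
  "continuous_densities P f \<longleftrightarrow>
     (\<forall>t>0. continuous_on UNIV (f t) \<and> (\<forall>a. 0 \<le> f t a) \<and>
        distributed P lborel (\<lambda>w. the (w t)) (\<lambda>a. ennreal (f t a)))"

definition potential_density :: "(real \<Rightarrow> real \<Rightarrow> real) \<Rightarrow> real \<Rightarrow> real" where
  "potential_density f a = (LINT t:{0<..}|lborel. f t a)"

definition h_fun :: "(real \<Rightarrow> real \<Rightarrow> real) \<Rightarrow> real \<Rightarrow> real \<Rightarrow> real" where
  "h_fun f b a = (if a \<le> b then potential_density f (b - a) else 0)"

(* Characterisation of the h-transform of P, the law of the process started at a.
   An extended nonnegative integral is used for the expectation of the nonnegative variable;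
   h is extended by 0 to the cemetery. *)
definition is_conditioned_law ::
  "(real \<Rightarrow> real) \<Rightarrow> real \<Rightarrow> real \<Rightarrow> path measure \<Rightarrow> path measure \<Rightarrow> bool" where
  "is_conditioned_law h b a P Q \<longleftrightarrow>
     sets Q = sets skorohod \<and> prob_space Q \<and>
     (AE w in Q. (\<forall>t\<ge>0. w t \<in> insert None (Some ` {0..<b})) \<and>
        (\<exists>t\<ge>0. w t = None) \<and>
        (\<forall>s t. 0 \<le> s \<and> s \<le> t \<and> w s = None \<longrightarrow> w t = None)) \<and>
     (\<forall>s\<ge>0. \<forall>A\<in>sets (past s).
        emeasure Q (A \<inter> {w \<in> space skorohod. ereal s < death_time w}) =
        (\<integral>\<^sup>+w. ennreal ((case w s of None \<Rightarrow> 0 | Some x \<Rightarrow> h x) / h a) * indicator A w \<partial>P))"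

definition conditioned_law ::
  "(real \<Rightarrow> path measure) \<Rightarrow> (real \<Rightarrow> real) \<Rightarrow> real \<Rightarrow> real \<Rightarrow> path measure" where
  "conditioned_law P h b a = (THE Q. is_conditioned_law h b a (P a) Q)"

definition last_time :: "real \<Rightarrow> path \<Rightarrow> ereal" where
  "last_time b w = Sup (ereal ` {t. 0 \<le> t \<and> (\<exists>x. w t = Some x \<and> x < b)})"

definition left_limit :: "path \<Rightarrow> real \<Rightarrow> real option" where
  "left_limit w t = (THE l. limitin state_topology w l (at_left t))"

definition pre_last_value :: "real \<Rightarrow> path \<Rightarrow> real" where
  "pre_last_value b w = the (left_limit w (real_of_ereal (last_time b w)))"

definition well_defined_at :: "real \<Rightarrow> path \<Rightarrow> bool" where
  "well_defined_at b w \<longleftrightarrow> \<bar>last_time b w\<bar> \<noteq> \<infinity> \<and> 0 < pre_last_value b w"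

(* Where the last passage time is not finite or g is not positive, the defining formula is
   meaningless; there the path is set to be constantly dead, so that the map takes values in
   Skorohod space everywhere. *)
definition rescaled_path :: "real \<Rightarrow> real \<Rightarrow> path \<Rightarrow> path" where
  "rescaled_path \<alpha> b w =
     (let L = last_time b w; g = pre_last_value b w in
      (\<lambda>t\<in>{0..}.
         if well_defined_at b w \<and> ereal (t * (g / b) powr \<alpha>) < L
         then map_option (\<lambda>x. b / g * x) (w (t * (g / b) powr \<alpha>))
         else None))"

end

(* The process Y of a level b depends only on the path before the last passage time L below b, and
  the rescaling map is scale invariant.  For t < L near L the path rescaled by b / X_t is close to Y,
  so the probability that Y satisfies given constraints up to time s is the limit, as d tends to 0,
  of (1/d) times the integral over t of the probability that the path rescaled by b / X_t satisfies
  them and that X jumps over b during (t, t + d].  The Markov property, the pointwise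
  Chapman-Kolmogorov equation and the scaling f_t(k a) = f_{t / k^alpha}(a) / k turn this integral
  into a product of a constant depending only on d and E[1_A u(b - X_s)].  Taking no constraints at
  all shows that the constant tends to 1 / u(b), so no Levy measure or bridge is needed.  The
  discontinuities of X at the rescaled times are handled by a sandwich: constraints of the form
  X_r < c at slightly perturbed times and levels, followed by Fatou's lemma. *)

theory Submission
  imports Defs
begin

text \<open>The scaling factor b / X_t is known only at time t, so the times at which the rescaled
  path is inspected are random and anticipate the future. The remedy is to integrate over the
  position a of X_t before anything else: for a fixed a these times are constants, and the
  constrained path carries the weight \<open>F (t - s * clock a) (a - X (s * clock a) w)\<close>.
  Integration over t leaves the potential density at level a, and self-similarity brings it back to
  level b, with the degree of homogeneity \<alpha> - 1 as the only trace of a. This is why the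
  constraints separate from the crossing of b. Homogeneity determines the potential density up to
  its value at b, and the positivity and finiteness of that value are read off from the limit of the
  constant. Constraints of the form X_r < c suit an increasing path: replacing the undershoot by a
  smaller position moves the inspected time to the left and the factor upwards, so the two effects
  can be bounded separately. Such constraints also force survival, and therefore determine the law
  of an absorbed path.\<close>

abbreviation recip :: "nat \<Rightarrow> real" where
  "recip n \<equiv> inverse (real (Suc n))"

section \<open>The state space and path space\<close>

text \<open>A homeomorphism of the state space onto the closed set \<open>{-1} \<union> [0, \<infinity>)\<close> of reals.\<close>

definition emb :: "real option \<Rightarrow> real" where
  "emb z = (case z of None \<Rightarrow> -1 | Some x \<Rightarrow> x)"

lemma emb_simps [simp]: "emb None = -1" "emb (Some x) = x"
  by (simp_all add: emb_def)

abbreviation states :: "real option set" where "states \<equiv> topspace state_topology"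

lemma Some_in_states [simp]: "Some x \<in> states \<longleftrightarrow> 0 \<le> x"
  by (auto simp: topspace_state_topology)

lemma None_in_states [simp]: "None \<in> states"
  by (simp add: topspace_state_topology)

lemma emb_neg_iff: "z \<in> states \<Longrightarrow> emb z < 0 \<longleftrightarrow> z = None"
  by (cases z) auto

lemma openin_emb_vimage:
  assumes "open S" shows "openin state_topology {z \<in> states. emb z \<in> S}"
proof -
  have "{x. Some x \<in> {z \<in> states. emb z \<in> S}} = {0..} \<inter> S"
    by auto
  with assms show ?thesis
    by (auto simp: openin_state_topology topspace_state_topology openin_open)
qed

text \<open>\<open>emb\<close> keeps the cemetery at distance 1 from all live values, so convergence
  can be read off from real numbers. That the values eventually lie in \<open>states\<close> has to
  be demanded separately: the type also contains \<open>Some x\<close> with x < 0, and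
  \<open>emb\<close> cannot tell \<open>Some (-1)\<close> from the cemetery.\<close>

lemma limitin_state_topology:
  "limitin state_topology w l F \<longleftrightarrow>
     l \<in> states \<and> (\<forall>\<^sub>F t in F. w t \<in> states) \<and> ((\<lambda>t. emb (w t)) \<longlongrightarrow> emb l) F"
    (is "?L \<longleftrightarrow> ?R")
proof
  assume L: ?L
  then have l: "l \<in> states"
    and ev: "\<And>U. openin state_topology U \<Longrightarrow> l \<in> U \<Longrightarrow> \<forall>\<^sub>F t in F. w t \<in> U"
    by (auto simp: limitin_def)
  have "((\<lambda>t. emb (w t)) \<longlongrightarrow> emb l) F"
  proof (rule topological_tendstoI)
    fix S :: "real set" assume "open S" "emb l \<in> S"
    with ev[OF openin_emb_vimage[OF \<open>open S\<close>]] l show "\<forall>\<^sub>F t in F. emb (w t) \<in> S"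
      by (auto elim: eventually_mono)
  qed
  with l ev[of states] show ?R by auto
next
  assume R: ?R
  show ?L
    unfolding limitin_def
  proof (intro conjI allI impI)
    show "l \<in> states" using R by auto
    fix U assume U: "openin state_topology U \<and> l \<in> U"
    show "\<forall>\<^sub>F t in F. w t \<in> U"
    proof (cases l)
      case None
      with R have "\<forall>\<^sub>F t in F. emb (w t) < 0"
        by (intro order_tendstoD(2)[of _ "-1"]) auto
      with R have "\<forall>\<^sub>F t in F. emb (w t) < 0 \<and> w t \<in> states"
        by (simp add: eventually_conj)
      then show ?thesis
        by (rule eventually_mono) (use U None in \<open>auto simp: emb_neg_iff\<close>)
    next
      case (Some x)
      from U obtain S where S: "open S" "{x. Some x \<in> U} = {0..} \<inter> S"
        by (auto simp: openin_state_topology openin_open)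
      with U Some have "x \<in> S" "0 \<le> x" by auto
      with R Some S have "\<forall>\<^sub>F t in F. emb (w t) \<in> S" "\<forall>\<^sub>F t in F. emb (w t) > -1"
        by (auto dest: topological_tendstoD intro!: order_tendstoD(1)[of _ x])
      with R have "\<forall>\<^sub>F t in F. emb (w t) \<in> S \<and> emb (w t) > -1 \<and> w t \<in> states"
        by (simp add: eventually_conj)
      then show ?thesis
      proof (rule eventually_mono)
        fix t assume t: "emb (w t) \<in> S \<and> emb (w t) > -1 \<and> w t \<in> states"
        then obtain y where "w t = Some y" by (cases "w t") auto
        with t S show "w t \<in> U" by auto
      qed
    qed
  qed
qed

text \<open>Upper bounds on a live state are the constraints for which an increasing path can be
  compared with its rescaling. Being false at the cemetery, they also record survival.\<close>

definition below :: "real \<Rightarrow> real option set" where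
  "below c = Some ` {0..<c}"

lemma in_below_iff: "z \<in> below c \<longleftrightarrow> (\<exists>x. z = Some x \<and> 0 \<le> x \<and> x < c)"
  by (auto simp: below_def)

lemma below_subset_states: "below c \<subseteq> states"
  by (auto simp: below_def)

lemma space_state_borel [simp]: "space state_borel = states"
  unfolding state_borel_def by (intro space_measure_of) (auto dest: openin_subset)

text \<open>The cemetery is the complement of the union of all \<open>below n\<close>, which makes
  \<open>emb\<close> measurable for the generated sigma-algebra; every open set is then the preimage
  under \<open>emb\<close> of an open set of reals.\<close>

lemma sets_state_borel: "sets state_borel = sigma_sets states (range below)"
proof
  let ?N = "sigma states (range below)"
  have pow: "range below \<subseteq> Pow states" using below_subset_states by auto
  have sN: "sets ?N = sigma_sets states (range below)" by (rule sets_measure_of[OF pow])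
  have spN: "space ?N = states" by (rule space_measure_of[OF pow])
  have B: "below c \<in> sets ?N" for c unfolding sN by auto
  have "states - (\<Union>n::nat. below (real n)) \<in> sets ?N"
    using sets.Diff[OF sets.top[of ?N], unfolded spN] B by (auto intro!: sets.countable_UN)
  also have "states - (\<Union>n::nat. below (real n)) = {None}"
  proof -
    have "\<exists>n. x < real n" for x by (rule reals_Archimedean2)
    then show ?thesis by (auto simp: in_below_iff topspace_state_topology)
  qed
  finally have N: "{None} \<in> sets ?N" .
  have m: "emb \<in> borel_measurable ?N"
  proof (rule borel_measurableI_less)
    fix c :: real
    have "{z \<in> space ?N. emb z < c} = below c \<union> (if -1 < c then {None} else {})"
      unfolding spN by (auto simp: in_below_iff topspace_state_topology)
    moreover have "below c \<union> (if -1 < c then {None} else {}) \<in> sets ?N"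
      using B N by (intro sets.Un) auto
    ultimately show "{z \<in> space ?N. emb z < c} \<in> sets ?N" by simp
  qed
  show "sets state_borel \<subseteq> sigma_sets states (range below)"
  proof -
    have "U \<in> sets ?N" if U: "openin state_topology U" for U
    proof -
      from U obtain S where S: "open S" "{x. Some x \<in> U} = {0..} \<inter> S"
        by (auto simp: openin_state_topology openin_open)
      \<comment> \<open>Cutting \<open>S\<close> at -1 drops the cemetery, whose image is -1. If the
        cemetery belongs to \<open>U\<close>, it is added back through a neighbourhood of -1 that
        contains no live value.\<close>
      define S' where "S' = (S \<inter> {-1<..}) \<union> (if None \<in> U then {..<0} \<inter> {..<-1/2} else {})"
      have U': "U = emb -` S' \<inter> space ?N"
      proof (rule set_eqI)
        fix z show "z \<in> U \<longleftrightarrow> z \<in> emb -` S' \<inter> space ?N"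
          using S(2) openin_subset[OF U] unfolding spN S'_def
          by (cases z) (auto simp: set_eq_iff)
      qed
      have "open S'" using S(1) by (auto simp: S'_def intro!: open_Un open_Int)
      then show ?thesis using m unfolding U' by (auto intro!: measurable_sets)
    qed
    then have "{U. openin state_topology U} \<subseteq> sets ?N" by auto
    from sets.sigma_sets_subset[OF this] show ?thesis
      unfolding state_borel_def spN sN by (subst sets_measure_of) (auto dest: openin_subset)
  qed
  have "openin state_topology (below c)" for c
  proof -
    have "{z \<in> states. emb z \<in> {-1<..<c}} = below c"
      by (auto simp: in_below_iff topspace_state_topology)
    with openin_emb_vimage[of "{-1<..<c}"] show ?thesis by auto
  qed
  then show "sigma_sets states (range below) \<subseteq> sets state_borel"
    unfolding state_borel_def
    by (subst sets_measure_of) (auto dest: openin_subset intro!: sigma_sets_mono' subsetD[OF sigma_sets_mono'])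
qed

lemma below_sets [measurable]: "below c \<in> sets state_borel"
  by (auto simp: sets_state_borel)

lemma measurable_emb [measurable]: "emb \<in> borel_measurable state_borel"
proof (rule borel_measurableI_less)
  fix c :: real
  have "openin state_topology {z \<in> states. emb z \<in> {..<c}}"
    by (rule openin_emb_vimage) auto
  then show "{z \<in> space state_borel. emb z < c} \<in> sets state_borel"
    unfolding space_state_borel unfolding state_borel_def
    by (subst sets_measure_of) (auto dest: openin_subset)
qed

text \<open>\<open>the None\<close> is an unspecified but fixed real number, so \<open>the\<close>
  is \<open>emb\<close> with one value replaced on a measurable set.\<close>

lemma measurable_the [measurable]: "the \<in> borel_measurable state_borel"
proof -
  have "(\<lambda>z. if emb z < 0 then the None else emb z) \<in> borel_measurable state_borel"
    by measurable
  also have "?this \<longleftrightarrow> ?thesis"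
    by (intro measurable_cong) (auto simp: topspace_state_topology emb_def)
  finally show ?thesis .
qed

lemma measurable_state_borelI:
  assumes "\<And>w. w \<in> space M \<Longrightarrow> f w \<in> states"
    and "\<And>c. {w \<in> space M. f w \<in> below c} \<in> sets M"
  shows "f \<in> M \<rightarrow>\<^sub>M state_borel"
proof (rule measurable_sigma_sets[OF sets_state_borel])
  show "range below \<subseteq> Pow states" using below_subset_states by auto
  show "f \<in> space M \<rightarrow> states" using assms by auto
  fix y assume "y \<in> range below"
  then obtain c where "y = below c" by auto
  with assms(2)[of c] show "f -` y \<inter> space M \<in> sets M"
    by (simp add: vimage_def Int_def conj_commute)
qed

lemma space_skorohod:
  "space skorohod = {w \<in> extensional {0..}. (\<forall>t\<ge>0. w t \<in> states) \<and> cadlag state_topology w}"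
  by (auto simp: skorohod_def space_restrict_space space_PiM PiE_iff extensional_def)

lemma measurable_coordinate [measurable]: "0 \<le> t \<Longrightarrow> (\<lambda>w. w t) \<in> skorohod \<rightarrow>\<^sub>M state_borel"
  unfolding skorohod_def by (intro measurable_restrict_space1 measurable_component_singleton) auto

lemma tendsto_at_right_coordinate:
  assumes "w \<in> space skorohod" "0 \<le> t"
  shows "((\<lambda>u. emb (w u)) \<longlongrightarrow> emb (w t)) (at_right t)"
  using assms by (auto simp: space_skorohod cadlag_def limitin_state_topology)

lemma limitin_imp_tendsto_the:
  assumes "limitin state_topology w l F"
  shows "((\<lambda>u. the (w u)) \<longlongrightarrow> the l) F"
proof -
  from assms have st: "l \<in> states" "\<forall>\<^sub>F u in F. w u \<in> states"
    and lim: "((\<lambda>u. emb (w u)) \<longlongrightarrow> emb l) F"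
    by (auto simp: limitin_state_topology)
  show ?thesis
  proof (cases l)
    case None
    then have "\<forall>\<^sub>F u in F. emb (w u) < 0"
      by (intro order_tendstoD(2)[OF lim]) auto
    with st(2) have "\<forall>\<^sub>F u in F. the (w u) = the l"
      by eventually_elim (use None in \<open>auto simp: emb_neg_iff\<close>)
    then show ?thesis by (rule tendsto_eventually)
  next
    case (Some x)
    with st have "\<forall>\<^sub>F u in F. emb (w u) > -1"
      by (intro order_tendstoD(1)[OF lim]) auto
    then have "\<forall>\<^sub>F u in F. emb (w u) = the (w u)"
    proof eventually_elim
      case (elim u) then show ?case by (cases "w u") auto
    qed
    with lim Some show ?thesis by (auto intro: Lim_transform_eventually)
  qed
qed

lemma tendsto_at_right_the:
  assumes "w \<in> space skorohod" "0 \<le> t"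
  shows "((\<lambda>u. the (w u)) \<longlongrightarrow> the (w t)) (at_right t)"
  using assms by (auto simp: space_skorohod cadlag_def intro: limitin_imp_tendsto_the)

section \<open>Coordinate sigma-algebras and their generating cylinders\<close>

definition coords :: "real set \<Rightarrow> path measure" where
  "coords T = sigma (space skorohod)
     {(\<lambda>w. w r) -` B \<inter> space skorohod | r B. r \<in> T \<and> B \<in> sets state_borel}"

lemma past_eq_coords: "past s = coords {0..s}"
  by (simp add: past_def coords_def)

lemma space_coords [simp]: "space (coords T) = space skorohod"
  unfolding coords_def by (rule space_measure_of) auto

lemma sets_coords_eq: "sets (coords T) = sigma_sets (space skorohod)
     {(\<lambda>w. w r) -` B \<inter> space skorohod | r B. r \<in> T \<and> B \<in> sets state_borel}"
  unfolding coords_def by (rule sets_measure_of) auto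

lemma measurable_coords: "r \<in> T \<Longrightarrow> T \<subseteq> {0..} \<Longrightarrow> (\<lambda>w. w r) \<in> coords T \<rightarrow>\<^sub>M state_borel"
proof (rule measurableI)
  fix w assume "r \<in> T" "T \<subseteq> {0..}" "w \<in> space (coords T)"
  then show "w r \<in> space state_borel" by (auto simp: space_skorohod)
next
  fix B assume "r \<in> T" "B \<in> sets state_borel"
  then show "(\<lambda>w. w r) -` B \<inter> space (coords T) \<in> sets (coords T)"
    by (auto simp: sets_coords_eq)
qed

lemma measurable_the_coords:
  "r \<in> T \<Longrightarrow> T \<subseteq> {0..} \<Longrightarrow> (\<lambda>w. the (w r)) \<in> borel_measurable (coords T)"
  by (rule measurable_compose[OF measurable_coords measurable_the])

lemma sets_skorohod: "sets skorohod = sets (coords {0..})"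
proof
  have "(\<lambda>w. w) \<in> coords {0..} \<rightarrow>\<^sub>M skorohod"
    unfolding skorohod_def
    by (intro measurable_restrict_space2 measurable_PiM_single')
       (auto simp: space_skorohod PiE_iff extensional_def intro!: measurable_coords)
  then show "sets skorohod \<subseteq> sets (coords {0..})"
    using measurable_sets[of "\<lambda>w. w" "coords {0..}" skorohod] sets.sets_into_space[of _ skorohod]
    by (auto simp: Int_absorb2)
  show "sets (coords {0..}) \<subseteq> sets skorohod"
    unfolding sets_coords_eq
    by (rule sets.sigma_sets_subset) (auto intro!: measurable_sets)
qed

lemma sets_coords_mono: "S \<subseteq> T \<Longrightarrow> sets (coords S) \<subseteq> sets (coords T)"
  unfolding sets_coords_eq by (intro sigma_sets_mono') blast

lemma sets_past_subset: "sets (past s) \<subseteq> sets skorohod"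
  unfolding past_eq_coords sets_skorohod by (rule sets_coords_mono) auto

definition cylinder :: "real set \<Rightarrow> (real \<Rightarrow> real) \<Rightarrow> path set" where
  "cylinder J c = {w \<in> space skorohod. \<forall>j\<in>J. w j \<in> below (c j)}"

definition cylinders :: "real set \<Rightarrow> path set set" where
  "cylinders T = {cylinder J c | J c. finite J \<and> J \<subseteq> T}"

lemma Int_stable_cylinders: "Int_stable (cylinders T)"
proof (rule Int_stableI)
  fix A B assume "A \<in> cylinders T" "B \<in> cylinders T"
  then obtain J c K d where A: "A = cylinder J c" "finite J" "J \<subseteq> T"
    and B: "B = cylinder K d" "finite K" "K \<subseteq> T" by (auto simp: cylinders_def)
  let ?e = "\<lambda>j. if j \<in> J then if j \<in> K then min (c j) (d j) else c j else d j"
  have "A \<inter> B = cylinder (J \<union> K) ?e"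
    unfolding A B cylinder_def by (auto simp: in_below_iff split: if_splits) (metis option.inject)+
  with A B show "A \<inter> B \<in> cylinders T"
    by (auto simp: cylinders_def intro!: exI[of _ "J \<union> K"] exI[of _ ?e])
qed

lemma sets_coords_cylinders:
  assumes "T \<subseteq> {0..}" shows "sets (coords T) = sigma_sets (space skorohod) (cylinders T)"
proof
  let ?N = "sigma (space skorohod) (cylinders T)"
  have pow: "cylinders T \<subseteq> Pow (space skorohod)" by (auto simp: cylinders_def cylinder_def)
  have sN: "sets ?N = sigma_sets (space skorohod) (cylinders T)" by (rule sets_measure_of[OF pow])
  have spN: "space ?N = space skorohod" by (rule space_measure_of[OF pow])
  have "(\<lambda>w. w r) \<in> ?N \<rightarrow>\<^sub>M state_borel" if "r \<in> T" for r
  proof (rule measurable_state_borelI)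
    show "w r \<in> states" if "w \<in> space ?N" for w
      using that assms \<open>r \<in> T\<close> unfolding spN by (auto simp: space_skorohod)
    fix c
    have "{w \<in> space ?N. w r \<in> below c} = cylinder {r} (\<lambda>_. c)"
      unfolding spN by (auto simp: cylinder_def)
    also have "\<dots> \<in> sets ?N"
      unfolding sN
    proof (rule sigma_sets.Basic)
      show "cylinder {r} (\<lambda>_. c) \<in> cylinders T"
        unfolding cylinders_def using \<open>r \<in> T\<close>
        by (intro CollectI exI[of _ "{r}"] exI[of _ "\<lambda>_. c"]) auto
    qed
    finally show "{w \<in> space ?N. w r \<in> below c} \<in> sets ?N" .
  qed
  then have "{(\<lambda>w. w r) -` B \<inter> space skorohod | r B. r \<in> T \<and> B \<in> sets state_borel} \<subseteq> sets ?N"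
    using spN by (fastforce dest: measurable_sets)
  from sets.sigma_sets_subset[OF this]
  show "sets (coords T) \<subseteq> sigma_sets (space skorohod) (cylinders T)"
    unfolding sets_coords_eq spN sN .
  have "cylinder J c \<in> sets (coords T)" if J: "finite J" "J \<subseteq> T" for J c
  proof -
    have "{w \<in> space (coords T). w j \<in> below (c j)} \<in> sets (coords T)" if "j \<in> J" for j
      using measurable_sets[OF measurable_coords[of j T] below_sets[of "c j"]] J that assms
      by (auto simp: vimage_def Int_def conj_commute)
    then have "{w \<in> space (coords T). \<forall>j\<in>J. w j \<in> below (c j)} \<in> sets (coords T)"
      using J by (intro sets.sets_Collect_finite_All) auto
    then show ?thesis by (simp add: cylinder_def)
  qed
  then show "sigma_sets (space skorohod) (cylinders T) \<subseteq> sets (coords T)"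
    using sets.sigma_sets_subset[of "cylinders T" "coords T"] by (auto simp: cylinders_def)
qed

lemma cylinder_sets: "finite J \<Longrightarrow> J \<subseteq> T \<Longrightarrow> T \<subseteq> {0..} \<Longrightarrow> cylinder J c \<in> sets (coords T)"
  by (subst sets_coords_cylinders) (auto simp: cylinders_def)

text \<open>The identity maps both measures to the sigma-algebra \<open>coords T\<close>, where the
  pi-lambda theorem compares them as measures. With \<open>T\<close> equal to \<open>{0..s}\<close>
  this serves the h-transform identity, with \<open>{0..}\<close> the uniqueness of the law.\<close>

lemma coords_emeasure_eqI:
  assumes T: "T \<subseteq> {0..}" and sets: "sets N1 = sets skorohod" "sets N2 = sets skorohod"
    and fin: "emeasure N1 (space skorohod) \<noteq> \<infinity>"
    and eq: "\<And>J c. finite J \<Longrightarrow> J \<subseteq> T \<Longrightarrow> emeasure N1 (cylinder J c) = emeasure N2 (cylinder J c)"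
    and A: "A \<in> sets (coords T)"
  shows "emeasure N1 A = emeasure N2 A"
proof -
  have sub: "sets (coords T) \<subseteq> sets skorohod"
    unfolding sets_skorohod by (rule sets_coords_mono[OF T])
  have sp: "space N1 = space skorohod" "space N2 = space skorohod"
    using sets by (auto dest: sets_eq_imp_space_eq)
  have m: "(\<lambda>w. w) \<in> N1 \<rightarrow>\<^sub>M coords T" "(\<lambda>w. w) \<in> N2 \<rightarrow>\<^sub>M coords T"
    using sub sets sp by (auto intro!: measurableI)
  have d: "emeasure (distr N1 (coords T) (\<lambda>w. w)) A = emeasure N1 A"
    "emeasure (distr N2 (coords T) (\<lambda>w. w)) A = emeasure N2 A" if "A \<in> sets (coords T)" for A
    using that m sp sets.sets_into_space[OF that] by (auto simp: emeasure_distr Int_absorb2)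
  have "distr N1 (coords T) (\<lambda>w. w) = distr N2 (coords T) (\<lambda>w. w)"
  \<comment> \<open>The cylinder over no times is the whole space; its finite mass makes it a valid
    exhausting sequence.\<close>
  proof (rule measure_eqI_generator_eq[where \<Omega>="space skorohod" and E="cylinders T" and A="\<lambda>_. cylinder {} (\<lambda>_. 0)"])
    show "Int_stable (cylinders T)" by (rule Int_stable_cylinders)
    show "cylinders T \<subseteq> Pow (space skorohod)" by (auto simp: cylinders_def cylinder_def)
    fix X assume "X \<in> cylinders T"
    then obtain J c where X: "X = cylinder J c" "finite J" "J \<subseteq> T" by (auto simp: cylinders_def)
    then have "X \<in> sets (coords T)" using T cylinder_sets by auto
    then show "emeasure (distr N1 (coords T) (\<lambda>w. w)) X = emeasure (distr N2 (coords T) (\<lambda>w. w)) X"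
      using d eq X by simp
  next
    show "range (\<lambda>_. cylinder {} (\<lambda>_. 0)) \<subseteq> cylinders T"
      unfolding cylinders_def by blast
    have "cylinder {} (\<lambda>_. 0) \<in> sets (coords T)" using T by (intro cylinder_sets) auto
    then show "emeasure (distr N1 (coords T) (\<lambda>w. w)) (cylinder {} (\<lambda>_. 0)) \<noteq> \<infinity>"
      using d fin by (simp add: cylinder_def)
  qed (auto simp: sets_coords_cylinders[OF T, symmetric] cylinder_def)
  then show ?thesis using d A by metis
qed

section \<open>Measurability of the rescaled path\<close>

text \<open>Floor plus one, rather than the ceiling, keeps the grid points strictly to the right of
  t, as a limit along \<open>at_right t\<close> demands.\<close>

lemma filterlim_ceiling_at_right:
  fixes t :: real
  shows "filterlim (\<lambda>n. (real_of_int \<lfloor>real (Suc n) * t\<rfloor> + 1) / real (Suc n)) (at_right t) sequentially"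
proof -
  let ?\<tau> = "\<lambda>n. (real_of_int \<lfloor>real (Suc n) * t\<rfloor> + 1) / real (Suc n)"
  have gt: "t < ?\<tau> n" for n
    by (simp add: field_simps del: of_nat_Suc, linarith?)
  have le: "?\<tau> n \<le> t + recip n" for n
    by (simp add: field_simps del: of_nat_Suc, linarith?)
  have "?\<tau> \<longlonglongrightarrow> t"
  proof (rule tendsto_sandwich[OF _ _ tendsto_const])
    show "(\<lambda>n. t + recip n) \<longlonglongrightarrow> t"
      using tendsto_add[OF tendsto_const LIMSEQ_inverse_real_of_nat, of t] by simp
  qed (use gt le in \<open>auto intro!: always_eventually less_imp_le\<close>)
  moreover have "?\<tau> n \<in> {t<..} \<and> ?\<tau> n \<noteq> t" for n
    using gt[of n] by (simp del: of_nat_Suc)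
  ultimately show ?thesis
    unfolding filterlim_at by (simp del: of_nat_Suc)
qed

text \<open>Each approximation takes its times from a countable grid, which gives joint
  measurability; right continuity passes it to the limit. This allows a path to be evaluated at a
  time that depends on the path itself.\<close>

lemma measurable_pair_right_continuous:
  fixes X :: "real \<Rightarrow> 'a \<Rightarrow> real"
  assumes X [measurable]: "\<And>t. X t \<in> borel_measurable M"
    and rc: "\<And>w t. w \<in> space M \<Longrightarrow> ((\<lambda>u. X u w) \<longlongrightarrow> X t w) (at_right t)"
  shows "(\<lambda>(t, w). X t w) \<in> borel_measurable (borel \<Otimes>\<^sub>M M)"
proof (rule borel_measurable_LIMSEQ_real)
  fix n
  have "(\<lambda>p. (\<lambda>k p. X ((real_of_int k + 1) / real (Suc n)) (snd p)) \<lfloor>real (Suc n) * fst p\<rfloor> p)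
      \<in> borel_measurable (borel \<Otimes>\<^sub>M M)"
    by (rule measurable_compose_countable) measurable
  then show "(\<lambda>p. X ((real_of_int \<lfloor>real (Suc n) * fst p\<rfloor> + 1) / real (Suc n)) (snd p))
      \<in> borel_measurable (borel \<Otimes>\<^sub>M M)"
    by simp
next
  fix p :: "real \<times> 'a" assume "p \<in> space (borel \<Otimes>\<^sub>M M)"
  then have "snd p \<in> space M" by (auto simp: space_pair_measure)
  from filterlim_compose[OF rc[OF this] filterlim_ceiling_at_right]
  show "(\<lambda>n. X ((real_of_int \<lfloor>real (Suc n) * fst p\<rfloor> + 1) / real (Suc n)) (snd p))
      \<longlonglongrightarrow> (case p of (t, w) \<Rightarrow> X t w)"
    by (simp add: case_prod_beta)
qed

lemma tendsto_at_right_clamp: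
  fixes x :: "real \<Rightarrow> 'a::topological_space"
  assumes "\<And>t. 0 \<le> t \<Longrightarrow> (x \<longlongrightarrow> x t) (at_right t)" "0 \<le> s"
  shows "((\<lambda>u. x (max 0 (min s u))) \<longlongrightarrow> x (max 0 (min s t))) (at_right t)"
proof (cases "0 \<le> t \<and> t < s")
  case True
  then have "\<forall>\<^sub>F u in at_right t. u \<in> {t<..<s}"
    by (auto intro: eventually_at_rightI)
  then have "\<forall>\<^sub>F u in at_right t. x u = x (max 0 (min s u))"
    by eventually_elim (use True in auto)
  with True assms(1)[of t] show ?thesis
    by (auto intro: Lim_transform_eventually)
next
  case False
  have "\<forall>\<^sub>F u in at_right t. x (max 0 (min s u)) = x (max 0 (min s t))"
  proof (cases "t < 0")
    case True
    then have "\<forall>\<^sub>F u in at_right t. u \<in> {t<..<0}"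
      by (auto intro: eventually_at_rightI)
    then show ?thesis by eventually_elim (use True assms(2) in auto)
  next
    case nonneg: False
    with False have "s \<le> t" by auto
    then show ?thesis
      using eventually_at_right_less[of t] by (auto elim!: eventually_mono)
  qed
  then show ?thesis by (rule tendsto_eventually)
qed

text \<open>Clamping the time to [0, s] leaves a function of the path up to s only, so that
  evaluation at a variable time stays measurable with respect to \<open>past s\<close>.\<close>

lemma measurable_pair_past:
  assumes "0 \<le> s"
  shows "(\<lambda>(t, w). the (w (max 0 (min s t)))) \<in> borel_measurable (borel \<Otimes>\<^sub>M past s)"
  unfolding past_eq_coords using assms
  by (intro measurable_pair_right_continuous measurable_the_coords
        tendsto_at_right_clamp[where x = "\<lambda>u. the (w u)" for w])
     (auto intro!: tendsto_at_right_the)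

text \<open>Paths are constant on negative times, where they are \<open>undefined\<close>, so no positivity is needed here.\<close>

lemma measurable_pair_coordinate:
  fixes \<phi> :: "real option \<Rightarrow> real"
  assumes \<phi>: "\<phi> \<in> borel_measurable state_borel"
    and rc: "\<And>w t. w \<in> space skorohod \<Longrightarrow> 0 \<le> t \<Longrightarrow> ((\<lambda>u. \<phi> (w u)) \<longlongrightarrow> \<phi> (w t)) (at_right t)"
  shows "(\<lambda>(t, w). \<phi> (w t)) \<in> borel_measurable (borel \<Otimes>\<^sub>M skorohod)"
proof (rule measurable_pair_right_continuous)
  have neg: "w t = undefined" if "w \<in> space skorohod" "t < 0" for w t
    using that by (auto simp: space_skorohod extensional_def)
  fix t :: real
  show "(\<lambda>w. \<phi> (w t)) \<in> borel_measurable skorohod"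
  proof (cases "0 \<le> t")
    case True
    then show ?thesis by (intro measurable_compose[OF measurable_coordinate \<phi>])
  next
    case False
    then show ?thesis by (subst measurable_cong[where g = "\<lambda>_. \<phi> undefined"]) (auto simp: neg)
  qed
  fix w assume w: "w \<in> space skorohod"
  show "((\<lambda>u. \<phi> (w u)) \<longlongrightarrow> \<phi> (w t)) (at_right t)"
  proof (cases "0 \<le> t")
    case False
    then have "\<forall>\<^sub>F u in at_right t. u \<in> {t<..<0}" by (intro eventually_at_rightI[of t 0]) auto
    then have "\<forall>\<^sub>F u in at_right t. \<phi> (w u) = \<phi> (w t)"
      by eventually_elim (use neg[OF w] False in auto)
    then show ?thesis by (rule tendsto_eventually)
  qed (rule rc[OF w])
qed

lemmas measurable_pair_the = measurable_pair_coordinate[OF measurable_the tendsto_at_right_the]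
  and measurable_pair_emb = measurable_pair_coordinate[OF measurable_emb tendsto_at_right_coordinate]

text \<open>Right continuity finds, after each time at which the path is below b, a rational time
  with the same property. The supremum becomes countable, and \<open>-\<infinity>\<close> is its
  neutral value.\<close>

lemma last_time_eq_SUP_rat:
  assumes "w \<in> space skorohod"
  shows "last_time b w = (SUP q\<in>{q\<in>\<rat>. 0 \<le> q}. if w q \<in> below b then ereal q else -\<infinity>)" (is "_ = ?R")
proof (rule antisym)
  have st: "w u \<in> states" if "0 \<le> u" for u using assms that by (auto simp: space_skorohod)
  show "last_time b w \<le> ?R"
    unfolding last_time_def
  proof (rule SUP_least)
    fix t assume "t \<in> {t. 0 \<le> t \<and> (\<exists>x. w t = Some x \<and> x < b)}"
    then obtain x where t: "0 \<le> t" "w t = Some x" "x < b" by auto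
    with st[of t] have x: "0 \<le> x" by auto
    note lim = tendsto_at_right_coordinate[OF assms t(1)]
    have "\<forall>\<^sub>F u in at_right t. emb (w u) > -1" "\<forall>\<^sub>F u in at_right t. emb (w u) < b"
      using t x by (auto intro!: order_tendstoD[OF lim])
    then have "\<forall>\<^sub>F u in at_right t. -1 < emb (w u) \<and> emb (w u) < b" by (rule eventually_conj)
    then obtain v where v: "t < v" "\<And>u. t < u \<Longrightarrow> u < v \<Longrightarrow> -1 < emb (w u) \<and> emb (w u) < b"
      by (auto simp: eventually_at_right_field)
    obtain q where q: "q \<in> \<rat>" "t < q" "q < v" using Rats_dense_in_real[OF v(1)] by auto
    with v(2)[of q] st[of q] t(1) have "w q \<in> below b"
      by (cases "w q") (auto simp: in_below_iff)
    have "ereal t \<le> (if w q \<in> below b then ereal q else -\<infinity>)"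
      using q \<open>w q \<in> below b\<close> by simp
    also have "\<dots> \<le> ?R" using q t(1) by (intro SUP_upper) auto
    finally show "ereal t \<le> ?R" .
  qed
  show "?R \<le> last_time b w"
    unfolding last_time_def
    by (rule SUP_least) (auto intro!: SUP_upper simp: in_below_iff)
qed

lemma measurable_last_time [measurable]: "last_time b \<in> borel_measurable skorohod"
proof -
  have "(\<lambda>w. if w q \<in> below b then ereal q else -\<infinity>) \<in> borel_measurable skorohod" if "0 \<le> q" for q
  proof -
    have [measurable]: "(\<lambda>w. w q) \<in> skorohod \<rightarrow>\<^sub>M state_borel" using that by measurable
    show ?thesis by measurable
  qed
  then have "(\<lambda>w. SUP q\<in>{q\<in>\<rat>. 0 \<le> q}. if w q \<in> below b then ereal q else -\<infinity>) \<in> borel_measurable skorohod"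
    by (intro borel_measurable_SUP) (auto intro: countable_subset[OF _ countable_rat])
  then show ?thesis
    by (subst measurable_cong[OF last_time_eq_SUP_rat]) auto
qed

lemma limitin_state_topology_unique:
  assumes "limitin state_topology w l F" "limitin state_topology w l' F" "F \<noteq> bot"
  shows "l = l'"
proof -
  have "emb l = emb l'" "l \<in> states" "l' \<in> states"
    using assms by (auto simp: limitin_state_topology intro: tendsto_unique)
  then show ?thesis by (cases l; cases l') auto
qed

lemma limitin_left_limit:
  assumes "w \<in> space skorohod" "0 < t"
  shows "limitin state_topology w (left_limit w t) (at_left t)"
proof -
  obtain l where l: "limitin state_topology w l (at_left t)"
    using assms by (auto simp: space_skorohod cadlag_def)
  then have "left_limit w t = l"
    unfolding left_limit_def by (rule the_equality) (auto intro: limitin_state_topology_unique[OF _ l])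
  with l show ?thesis by simp
qed

lemma filterlim_at_left_diff: "filterlim (\<lambda>n. t - recip n) (at_left t) sequentially"
proof (rule filterlim_at[THEN iffD2], intro conjI)
  show "(\<lambda>n. t - recip n) \<longlonglongrightarrow> t"
    using tendsto_diff[OF tendsto_const LIMSEQ_inverse_real_of_nat, of t] by simp
qed (auto intro!: always_eventually)

text \<open>A limit along a fixed sequence replaces the definite description of the left limit and
  is plainly measurable. Cadlag paths have left limits at positive times only, hence the condition
  on the last passage time.\<close>

lemma pre_last_value_eq_lim:
  assumes w: "w \<in> space skorohod" and L: "0 < last_time b w" "last_time b w \<noteq> \<infinity>"
  shows "pre_last_value b w =
    lim (\<lambda>n. the (w (real_of_ereal (last_time b w) - recip n)))"
proof -
  define t where "t = real_of_ereal (last_time b w)"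
  have "0 < t" using L unfolding t_def by (cases "last_time b w") auto
  have "((\<lambda>u. the (w u)) \<longlongrightarrow> pre_last_value b w) (at_left t)"
    unfolding pre_last_value_def t_def[symmetric]
    by (intro limitin_imp_tendsto_the limitin_left_limit w \<open>0 < t\<close>)
  from filterlim_compose[OF this filterlim_at_left_diff]
  have "(\<lambda>n. the (w (t - recip n))) \<longlonglongrightarrow> pre_last_value b w" .
  then show ?thesis by (simp add: limI t_def)
qed

section \<open>The rescaled path is cadlag and depends measurably on the path\<close>

lemma limitin_map_option:
  assumes "limitin state_topology w l F" "0 < k"
  shows "limitin state_topology (\<lambda>t. map_option (\<lambda>x. k * x) (w t)) (map_option (\<lambda>x. k * x) l) F"
proof -
  from assms have st: "l \<in> states" "\<forall>\<^sub>F u in F. w u \<in> states"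
    and lim: "((\<lambda>u. emb (w u)) \<longlongrightarrow> emb l) F"
    by (auto simp: limitin_state_topology)
  have map_st: "map_option (\<lambda>x. k * x) z \<in> states" if "z \<in> states" for z
    using that assms(2) by (cases z) auto
  have "((\<lambda>u. emb (map_option (\<lambda>x. k * x) (w u))) \<longlongrightarrow> emb (map_option (\<lambda>x. k * x) l)) F"
  proof (cases l)
    case None
    then have "\<forall>\<^sub>F u in F. emb (w u) < 0"
      by (intro order_tendstoD(2)[OF lim]) auto
    with st(2) have "\<forall>\<^sub>F u in F. emb (map_option (\<lambda>x. k * x) (w u)) = -1"
      by eventually_elim (auto simp: emb_neg_iff)
    with None show ?thesis by (auto intro: tendsto_eventually)
  next
    case (Some x)
    with st have "\<forall>\<^sub>F u in F. emb (w u) > -1"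
      by (intro order_tendstoD(1)[OF lim]) auto
    then have "\<forall>\<^sub>F u in F. k * emb (w u) = emb (map_option (\<lambda>x. k * x) (w u))"
    proof eventually_elim
      case (elim u) then show ?case by (cases "w u") auto
    qed
    with tendsto_mult[OF tendsto_const[of k] lim] Some show ?thesis
      by (auto intro: Lim_transform_eventually)
  qed
  moreover have "\<forall>\<^sub>F u in F. map_option (\<lambda>x. k * x) (w u) \<in> states"
    using st(2) by eventually_elim (rule map_st)
  ultimately show ?thesis
    using st(1) map_st by (auto simp: limitin_state_topology)
qed

lemma limitin_state_topology_compose:
  assumes "limitin state_topology w l F" "filterlim f F G"
  shows "limitin state_topology (\<lambda>t. w (f t)) l G"
  using assms filterlim_compose[of "\<lambda>t. emb (w t)" _ F f G] eventually_compose_filterlim[of _ F f G]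
  by (auto simp: limitin_state_topology)

lemma filterlim_mult_at_right:
  fixes k :: real assumes "0 < k" shows "filterlim (\<lambda>u. u * k) (at_right (t * k)) (at_right t)"
proof (rule filterlim_at[THEN iffD2], intro conjI)
  show "((\<lambda>u. u * k) \<longlongrightarrow> t * k) (at_right t)" by (intro tendsto_intros)
qed (use assms eventually_at_right_less[of t] in \<open>auto elim!: eventually_mono\<close>)

lemma filterlim_mult_at_left:
  fixes k :: real assumes "0 < k" shows "filterlim (\<lambda>u. u * k) (at_left (t * k)) (at_left t)"
proof (rule filterlim_at[THEN iffD2], intro conjI)
  show "((\<lambda>u. u * k) \<longlongrightarrow> t * k) (at_left t)" by (intro tendsto_intros)
  have "\<forall>\<^sub>F u in at_left t. u < t" by (auto simp: eventually_at_filter)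
  then show "\<forall>\<^sub>F u in at_left t. u * k \<in> {..<t * k} \<and> u * k \<noteq> t * k"
    by eventually_elim (use assms in auto)
qed

lemma limitin_None: "\<forall>\<^sub>F u in F. v u = None \<Longrightarrow> limitin state_topology v None F"
  by (auto simp: limitin_state_topology elim: eventually_mono intro!: tendsto_eventually)

text \<open>The path is the cadlag function \<open>v\<close> up to time L / m and the cemetery from
  then on, so the one-sided limits at the switch are the only delicate ones.\<close>

lemma rescaled_path_in_space:
  assumes w: "w \<in> space skorohod" and b: "0 < b"
  shows "rescaled_path \<alpha> b w \<in> space skorohod"
proof (cases "well_defined_at b w")
  case False
  have "cadlag state_topology (\<lambda>t\<in>{0..}. None)"
    unfolding cadlag_def
  proof (intro conjI allI impI exI)
    fix t :: real assume t: "0 \<le> t"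
    have "\<forall>\<^sub>F u in at_right t. (\<lambda>t\<in>{0..}. None) u = None"
      using eventually_at_right_less[of t] by eventually_elim (use t in auto)
    from limitin_None[OF this] t
    show "limitin state_topology (\<lambda>t\<in>{0..}. None) ((\<lambda>t\<in>{0..}. None) t) (at_right t)"
      by (simp add: restrict_def)
  next
    fix t :: real assume t: "0 < t"
    have "\<forall>\<^sub>F u in at_left t. u \<in> {0<..<t}" using t by (auto intro: eventually_at_leftI)
    then have "\<forall>\<^sub>F u in at_left t. (\<lambda>t\<in>{0..}. None) u = None"
      by eventually_elim auto
    then show "limitin state_topology (\<lambda>t\<in>{0..}. None) None (at_left t)"
      by (rule limitin_None)
  qed
  with False show ?thesis
    by (auto simp: rescaled_path_def space_skorohod)
next
  case True
  define L where "L = real_of_ereal (last_time b w)"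
  define k where "k = b / pre_last_value b w"
  define m where "m = (pre_last_value b w / b) powr \<alpha>"
  have L: "last_time b w = ereal L"
    using True unfolding L_def well_defined_at_def by (simp add: ereal_real)
  have g: "0 < pre_last_value b w" using True by (auto simp: well_defined_at_def)
  then have pos: "0 < k" "0 < m" using b by (auto simp: k_def m_def)
  define v where "v = (\<lambda>t. map_option (\<lambda>x. k * x) (w (t * m)))"
  have Y: "rescaled_path \<alpha> b w t = (if t * m < L then v t else None)" if "0 \<le> t" for t
    using that True L by (simp add: rescaled_path_def k_def m_def v_def Let_def cong: if_cong)
  have right: "limitin state_topology v (v t) (at_right t)" if "0 \<le> t" for t
    unfolding v_def
    using w that pos
    by (intro limitin_map_option limitin_state_topology_compose[OF _ filterlim_mult_at_right])
       (auto simp: space_skorohod cadlag_def)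
  have left: "\<exists>l. limitin state_topology v l (at_left t)" if t: "0 < t" for t
    unfolding v_def
    using limitin_map_option[OF limitin_state_topology_compose[OF limitin_left_limit[OF w, of "t * m"]
        filterlim_mult_at_left]] pos t
    by auto
  have st: "v t \<in> states" if "0 \<le> t" for t
  proof -
    have "w (t * m) \<in> states" using w that pos by (auto simp: space_skorohod)
    then show ?thesis using pos by (cases "w (t * m)") (auto simp: v_def)
  qed
  have "cadlag state_topology (rescaled_path \<alpha> b w)"
    unfolding cadlag_def
  proof (intro conjI allI impI)
    fix t :: real assume t: "0 \<le> t"
    show "limitin state_topology (rescaled_path \<alpha> b w) (rescaled_path \<alpha> b w t) (at_right t)"
    proof (cases "t * m < L")
      case True
      then have "t < L / m" using pos by (simp add: field_simps)
      then have "\<forall>\<^sub>F u in at_right t. u \<in> {t<..<L / m}" by (auto intro: eventually_at_rightI)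
      then have "\<forall>\<^sub>F u in at_right t. v u = rescaled_path \<alpha> b w u"
        by eventually_elim (use t pos Y in \<open>auto simp: field_simps\<close>)
      with right[OF t] Y[OF t] True show ?thesis
        by (auto intro: limitin_transform_eventually)
    next
      case False
      have "\<forall>\<^sub>F u in at_right t. rescaled_path \<alpha> b w u = None"
        using eventually_at_right_less[of t]
      proof eventually_elim
        case (elim u)
        with False pos have "\<not> u * m < L" by (smt (verit) mult_right_mono)
        with elim t Y[of u] show ?case by auto
      qed
      with False Y[OF t] show ?thesis
        by (auto intro: limitin_None)
    qed
  next
    fix t :: real assume t: "0 < t"
    then have nn: "\<forall>\<^sub>F u in at_left t. u \<in> {0<..<t}"
      by (auto intro: eventually_at_leftI)
    show "\<exists>l. limitin state_topology (rescaled_path \<alpha> b w) l (at_left t)"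
    \<comment> \<open>At \<open>t * m = L\<close> the path is already dead, but its left limit is
      still that of \<open>v\<close>. So the equality case goes with the live path here, whereas for
      right limits it goes with the cemetery.\<close>
    proof (cases "t * m \<le> L")
      case True
      from nn have "\<forall>\<^sub>F u in at_left t. v u = rescaled_path \<alpha> b w u"
      proof eventually_elim
        case (elim u)
        with pos have "u * m < t * m" by auto
        with True elim Y[of u] show ?case by auto
      qed
      with left[OF t] show ?thesis by (auto intro: limitin_transform_eventually)
    next
      case False
      then have "max 0 (L / m) < t" using pos t by (simp add: field_simps)
      then have "\<forall>\<^sub>F u in at_left t. u \<in> {max 0 (L / m)<..<t}"
        by (intro eventually_at_leftI[of "max 0 (L / m)"])
      then have "\<forall>\<^sub>F u in at_left t. rescaled_path \<alpha> b w u = None"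
        by eventually_elim (use Y pos in \<open>auto simp: field_simps\<close>)
      then have "limitin state_topology (rescaled_path \<alpha> b w) None (at_left t)"
        by (rule limitin_None)
      then show ?thesis by auto
    qed
  qed
  moreover have "rescaled_path \<alpha> b w \<in> extensional {0..}" by (simp add: rescaled_path_def Let_def)
  ultimately show ?thesis using Y st by (auto simp: space_skorohod)
qed

lemma measurable_rescaled_path:
  assumes "0 < b" shows "rescaled_path \<alpha> b \<in> skorohod \<rightarrow>\<^sub>M skorohod"
proof -
  define G where "G w = lim (\<lambda>n. the (w (real_of_ereal (last_time b w) - recip n)))" for w
  have pair: "(\<lambda>w. (\<lambda>(t, w). f (w t)) (\<tau> w, w)) \<in> borel_measurable skorohod"
    if [measurable]: "(\<lambda>(t, w). f (w t)) \<in> borel_measurable (borel \<Otimes>\<^sub>M skorohod)"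
      "\<tau> \<in> borel_measurable skorohod" for f :: "real option \<Rightarrow> real" and \<tau>
    by measurable
  have [measurable]: "G \<in> borel_measurable skorohod"
    unfolding G_def
    using pair[OF measurable_pair_the] by (intro borel_measurable_lim_metric) simp
  have "(\<lambda>w. rescaled_path \<alpha> b w t) \<in> skorohod \<rightarrow>\<^sub>M state_borel" if t: "0 \<le> t" for t
  proof (rule measurable_state_borelI)
    show "rescaled_path \<alpha> b w t \<in> states" if "w \<in> space skorohod" for w
      using rescaled_path_in_space[OF that assms, of \<alpha>] t by (auto simp: space_skorohod)
  next
    fix c
    define E where "E w = emb (w (t * (G w / b) powr \<alpha>))" for w
    have [measurable]: "E \<in> borel_measurable skorohod"
      unfolding E_def using pair[OF measurable_pair_emb] by simp
    \<comment> \<open>\<open>G\<close> is the undershoot only when the last passage time is positive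
      and finite. Otherwise both sides are false: a nonnegative rescaled time below the last passage
      time forces the latter to be positive. The condition \<open>0 \<le> E w\<close> says that the
      inspected value is alive.\<close>
    have "rescaled_path \<alpha> b w t \<in> below c \<longleftrightarrow> last_time b w \<noteq> \<infinity> \<and> 0 < G w \<and>
        ereal (t * (G w / b) powr \<alpha>) < last_time b w \<and> 0 \<le> E w \<and> b / G w * E w < c"
      if w: "w \<in> space skorohod" for w
    proof (cases "0 < last_time b w \<and> last_time b w \<noteq> \<infinity>")
      case True
      then have G: "pre_last_value b w = G w"
        unfolding G_def using pre_last_value_eq_lim[OF w] by auto
      have nonneg: "0 \<le> t * (G w / b) powr \<alpha>" using t by simp
      then have "w (t * (G w / b) powr \<alpha>) \<in> states"
        using w by (auto simp: space_skorohod)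
      then show ?thesis
        using True nonneg t G assms
        by (cases "w (t * (G w / b) powr \<alpha>)")
           (auto simp: rescaled_path_def well_defined_at_def E_def in_below_iff Let_def)
    next
      case False
      then have "\<not> (ereal (t * r powr \<alpha>) < last_time b w \<and> last_time b w \<noteq> \<infinity>)" for r
        using t order.strict_trans1[of 0 "ereal (t * r powr \<alpha>)" "last_time b w"] by auto
      then have "rescaled_path \<alpha> b w t = None" and
        "\<not> (ereal (t * (G w / b) powr \<alpha>) < last_time b w \<and> last_time b w \<noteq> \<infinity>)"
        using t by (auto simp: rescaled_path_def well_defined_at_def Let_def)
      then show ?thesis
        by (auto simp: in_below_iff)
    qed
    then have "{w \<in> space skorohod. rescaled_path \<alpha> b w t \<in> below c} = {w \<in> space skorohod.
      last_time b w \<noteq> \<infinity> \<and> 0 < G w \<and>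
        ereal (t * (G w / b) powr \<alpha>) < last_time b w \<and> 0 \<le> E w \<and> b / G w * E w < c}"
      by auto
    also have "\<dots> \<in> sets skorohod" by measurable
    finally show "{w \<in> space skorohod. rescaled_path \<alpha> b w t \<in> below c} \<in> sets skorohod" .
  qed
  moreover have "rescaled_path \<alpha> b w \<in> space skorohod" if "w \<in> space skorohod" for w
    using that assms by (rule rescaled_path_in_space)
  ultimately have "(\<lambda>w. rescaled_path \<alpha> b w) \<in> skorohod \<rightarrow>\<^sub>M skorohod"
    by (subst (2) skorohod_def)
       (intro measurable_restrict_space2 measurable_PiM_single', auto simp: space_skorohod PiE_iff)
  then show ?thesis by simp
qed

section \<open>Uniqueness of Laplace transforms\<close>

text \<open>All moments of a law on [0, 1] are at most 1, so the exponential series may be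
  integrated term by term. Hence the moments determine the characteristic function.\<close>

lemma (in real_distribution) char_sums_moments:
  assumes unit: "AE y in M. 0 \<le> y \<and> y \<le> 1"
  shows "(\<lambda>n. (\<i> * of_real t) ^ n / fact n * of_real (\<integral>y. y ^ n \<partial>M)) sums char M t"
proof -
  define g where "g n y = (\<i> * of_real t) ^ n / fact n * of_real (y ^ n)" for n and y :: real
  have int: "integrable M (\<lambda>y. y ^ n)" for n
  proof (rule integrable_const_bound[where B=1])
    show "AE y in M. norm (y ^ n) \<le> 1"
      using unit by eventually_elim (simp add: power_le_one)
  qed simp
  have gint: "integrable M (g n)" for n
    unfolding g_def by (intro integrable_mult_right integrable_of_real int)
  have sexp: "summable (\<lambda>n. \<bar>t\<bar> ^ n / fact n)" using summable_exp[of "\<bar>t\<bar>"] by (simp add: field_simps)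
  have ng: "norm (g n y) \<le> \<bar>t\<bar> ^ n / fact n" if "0 \<le> y \<and> y \<le> 1" for n y
  proof -
    have "norm (g n y) = \<bar>t\<bar> ^ n / fact n * y ^ n"
      using that by (simp add: g_def norm_mult norm_divide norm_power)
    also have "\<dots> \<le> \<bar>t\<bar> ^ n / fact n * 1"
      using that by (intro mult_left_mono power_le_one) auto
    finally show ?thesis by simp
  qed
  have gs: "(\<lambda>n. g n y) sums iexp (t * y)" for y
    using exp_converges[of "\<i> * of_real (t * y)"]
    by (simp add: g_def scaleR_conv_of_real power_mult_distrib field_simps)
  have "(\<lambda>n. \<integral>y. g n y \<partial>M) sums (\<integral>y. (\<Sum>n. g n y) \<partial>M)"
  proof (rule sums_integral)
    show "AE y in M. summable (\<lambda>n. norm (g n y))"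
      using unit
    proof eventually_elim
      case (elim y)
      show ?case by (rule summable_comparison_test'[OF sexp, of 0]) (use ng[OF elim] in auto)
    qed
    have "(\<integral>y. norm (g n y) \<partial>M) \<le> (\<integral>y. \<bar>t\<bar> ^ n / fact n \<partial>M)" for n
    proof (rule integral_mono_AE)
      show "AE y in M. norm (g n y) \<le> \<bar>t\<bar> ^ n / fact n"
        using unit by eventually_elim (rule ng)
    qed (use gint in auto)
    then show "summable (\<lambda>n. \<integral>y. norm (g n y) \<partial>M)"
      by (intro summable_comparison_test'[OF sexp, of 0]) (use prob_space in auto)
  qed (rule gint)
  moreover have "(\<Sum>n. g n y) = iexp (t * y)" for y using gs by (rule sums_unique[symmetric])
  moreover have "(\<integral>y. g n y \<partial>M) = (\<i> * of_real t) ^ n / fact n * of_real (\<integral>y. y ^ n \<partial>M)" for n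
    unfolding g_def by (simp del: of_real_power)
  ultimately show ?thesis by (simp add: char_def)
qed

text \<open>The substitution y = exp (- x) carries both laws to [0, 1] and turns the Laplace
  transforms at the integers into moments. These determine the characteristic function, and the
  logarithm carries the equality of laws back.\<close>

lemma Laplace_uniqueness:
  assumes "real_distribution M" "real_distribution N"
    and "AE x in M. 0 \<le> x" "AE x in N. 0 \<le> x"
    and eq: "\<And>n::nat. (\<integral>x. exp (- real n * x) \<partial>M) = (\<integral>x. exp (- real n * x) \<partial>N)"
  shows "M = N"
proof -
  interpret M: real_distribution M by fact
  interpret N: real_distribution N by fact
  let ?e = "\<lambda>x::real. exp (- x)"
  let ?M = "distr M borel ?e" and ?N = "distr N borel ?e"
  have rd: "real_distribution ?M" "real_distribution ?N"
    by (intro M.real_distribution_distr N.real_distribution_distr; simp)+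
  interpret M': real_distribution ?M by fact
  interpret N': real_distribution ?N by fact
  have unit: "AE y in ?M. 0 \<le> y \<and> y \<le> 1" "AE y in ?N. 0 \<le> y \<and> y \<le> 1"
    using assms(3,4) by (auto simp: AE_distr_iff)
  have "(\<integral>y. y ^ n \<partial>?M) = (\<integral>y. y ^ n \<partial>?N)" for n
    using eq[of n] by (simp add: integral_distr exp_of_nat_mult[symmetric])
  then have "char ?M t = char ?N t" for t
    using M'.char_sums_moments[OF unit(1), of t] N'.char_sums_moments[OF unit(2), of t]
    by (auto intro: sums_unique2)
  then have "?M = ?N" by (intro Levy_uniqueness rd ext)
  then have "distr ?M borel (\<lambda>y. - ln y) = distr ?N borel (\<lambda>y. - ln y)" by simp
  then have "distr M borel (\<lambda>x. x) = distr N borel (\<lambda>x. x)"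
    by (subst (asm) (1 2) distr_distr) (auto simp: o_def)
  then show ?thesis by (simp add: distr_id2 M.events_eq_borel N.events_eq_borel)
qed

lemma continuous_AE_eq:
  fixes f g :: "real \<Rightarrow> real"
  assumes "continuous_on UNIV f" "continuous_on UNIV g" "AE x in lborel. f x = g x"
  shows "f = g"
proof (rule ccontr)
  assume "f \<noteq> g"
  then obtain x where x: "f x \<noteq> g x" by auto
  have "open {x. f x \<noteq> g x}"
    using assms by (intro open_Collect_neq) auto
  moreover have "negligible {x. f x \<noteq> g x}"
    using AE_completion[OF assms(3)] by (auto simp: negligible_iff_null_sets AE_iff_null_sets[symmetric] eventually_ae_filter
      intro: null_sets_subset null_sets_completion_subset)
  ultimately show False using open_not_negligible x by blast
qed

text \<open>The scaling of the densities and the Chapman-Kolmogorov equation are first obtained for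
  laws; through this lemma they hold at every point.\<close>

lemma continuous_density_eq:
  fixes f g :: "real \<Rightarrow> real"
  assumes "continuous_on UNIV f" "continuous_on UNIV g" "\<And>x. 0 \<le> f x" "\<And>x. 0 \<le> g x"
    and eq: "density lborel (\<lambda>x. ennreal (f x)) = density lborel (\<lambda>x. ennreal (g x))"
  shows "f = g"
proof (rule continuous_AE_eq[OF assms(1,2)])
  have "AE x in lborel. ennreal (f x) = ennreal (g x)"
    by (rule sigma_finite_measure.density_unique[OF lborel.sigma_finite_measure_axioms _ _ eq])
       (simp_all add: borel_measurable_continuous_onI assms)
  then show "AE x in lborel. f x = g x"
    by eventually_elim (use assms in auto)
qed

section \<open>Densities and scaling\<close>

locale subordinator =
  fixes \<alpha> C b :: real and M :: "path measure" and f :: "real \<Rightarrow> real \<Rightarrow> real"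
  assumes \<alpha>: "0 < \<alpha>" and C: "0 < C" and b: "0 < b"
    and law: "stable_subordinator_law \<alpha> C 0 M" and dens: "continuous_densities M f"
begin

definition X :: "real \<Rightarrow> path \<Rightarrow> real" where "X t w = the (w t)"

lemma sets_M: "sets M = sets skorohod"
  and alive: "AE w in M. \<forall>t\<ge>0. w t \<noteq> None"
  and levy: "levy_process M X"
  and mono_X: "AE w in M. \<forall>s t. 0 \<le> s \<and> s \<le> t \<longrightarrow> X s w \<le> X t w"
  and Laplace_X: "0 \<le> t \<Longrightarrow> 0 \<le> q \<Longrightarrow> (\<integral>w. exp (- q * X t w) \<partial>M) = exp (- t * C * q powr \<alpha>)"
  using law unfolding stable_subordinator_law_def X_def by auto

sublocale prob_space M
  using levy by (simp add: levy_process_def)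

lemma space_M: "space M = space skorohod"
  using sets_M by (rule sets_eq_imp_space_eq)

lemma measurable_X [measurable]: "0 \<le> t \<Longrightarrow> X t \<in> borel_measurable M"
  using levy by (simp add: levy_process_def)

lemma X_zero: "AE w in M. X 0 w = 0"
  using levy by (simp add: levy_process_def)

lemma distr_increment:
  assumes "0 \<le> s" "s \<le> t"
  shows "distr M borel (\<lambda>w. X t w - X s w) = distr M borel (X (t - s))"
proof -
  have "\<forall>s\<ge>0. \<forall>t\<ge>0. distr M borel (\<lambda>w. X (s + t) w - X s w) = distr M borel (X t)"
    using levy by (simp add: levy_process_def)
  from this[rule_format, of s "t - s"] assms show ?thesis by simp
qed

lemma indep_increments:
  "0 \<le> \<tau> 0 \<Longrightarrow> (\<And>i. i < n \<Longrightarrow> \<tau> i \<le> \<tau> (Suc i)) \<Longrightarrow>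
    indep_vars (\<lambda>_. borel) (\<lambda>i w. X (\<tau> (Suc i)) w - X (\<tau> i) w) {..<n}"
  using levy unfolding levy_process_def by blast

lemma nonneg_X: "AE w in M. \<forall>t\<ge>0. 0 \<le> X t w"
  using alive
proof (rule AE_mp, intro AE_I2 impI allI)
  fix w and t :: real assume "w \<in> space M" "\<forall>t\<ge>0. w t \<noteq> None" "0 \<le> t"
  then have "w t \<in> states" "w t \<noteq> None" by (auto simp: space_M space_skorohod)
  then show "0 \<le> X t w" by (cases "w t") (auto simp: X_def)
qed

lemma continuous_f: "0 < t \<Longrightarrow> continuous_on UNIV (f t)"
  and f_nonneg: "0 < t \<Longrightarrow> 0 \<le> f t a"
  and distributed_X: "0 < t \<Longrightarrow> distributed M lborel (X t) (\<lambda>a. ennreal (f t a))"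
  using dens unfolding continuous_densities_def X_def by auto

lemma measurable_f [measurable]: "0 < t \<Longrightarrow> f t \<in> borel_measurable borel"
  using continuous_f by (rule borel_measurable_continuous_onI)

lemma nn_integral_X:
  "0 < t \<Longrightarrow> g \<in> borel_measurable borel \<Longrightarrow> (\<integral>\<^sup>+w. g (X t w) \<partial>M) = (\<integral>\<^sup>+a. ennreal (f t a) * g a \<partial>lborel)"
  using distributed_nn_integral[OF distributed_X, of t g] by simp

lemma real_distribution_X: "0 \<le> t \<Longrightarrow> real_distribution (distr M borel (\<lambda>w. k * X t w))"
  by (intro real_distribution_distr) measurable

text \<open>The Laplace exponents agree: (t / k^\<alpha>) C (q k)^\<alpha> = t C q^\<alpha>.\<close>

lemma distr_scaled:
  assumes k: "0 < k" and t: "0 \<le> t"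
  shows "distr M borel (\<lambda>w. k * X (t / k powr \<alpha>) w) = distr M borel (X t)"
proof (rule Laplace_uniqueness)
  have t': "0 \<le> t / k powr \<alpha>" using t by simp
  show "real_distribution (distr M borel (\<lambda>w. k * X (t / k powr \<alpha>) w))"
    by (rule real_distribution_X[OF t'])
  show "real_distribution (distr M borel (X t))"
    using real_distribution_X[OF t, of 1] by simp
  note [measurable] = measurable_X[OF t] measurable_X[OF t']
  show "AE x in distr M borel (X t). 0 \<le> x" "AE x in distr M borel (\<lambda>w. k * X (t / k powr \<alpha>) w). 0 \<le> x"
  proof -
    show "AE x in distr M borel (X t). 0 \<le> x"
      using nonneg_X by (subst AE_distr_iff) (use t in auto)
    have "AE w in M. 0 \<le> k * X (t / k powr \<alpha>) w"
      using nonneg_X by eventually_elim (use k t' in auto)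
    then show "AE x in distr M borel (\<lambda>w. k * X (t / k powr \<alpha>) w). 0 \<le> x"
      by (subst AE_distr_iff) auto
  qed
  fix n :: nat
  have e: "(\<lambda>x::real. exp (- real n * x)) \<in> borel_measurable borel" by measurable
  have m: "(\<lambda>w. k * X (t / k powr \<alpha>) w) \<in> borel_measurable M" by measurable
  have "(\<integral>x. exp (- real n * x) \<partial>distr M borel (\<lambda>w. k * X (t / k powr \<alpha>) w))
    = (\<integral>w. exp (- (real n * k) * X (t / k powr \<alpha>) w) \<partial>M)"
    unfolding integral_distr[OF m e] by (simp only: mult.assoc minus_mult_left)
  also have "\<dots> = exp (- (t / k powr \<alpha>) * C * (real n * k) powr \<alpha>)"
    using k by (intro Laplace_X[OF t']) auto
  also have "\<dots> = exp (- t * C * real n powr \<alpha>)"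
    using k by (simp add: powr_mult)
  also have "\<dots> = (\<integral>w. exp (- real n * X t w) \<partial>M)"
    by (rule Laplace_X[OF t, symmetric]) simp
  also have "\<dots> = (\<integral>x. exp (- real n * x) \<partial>distr M borel (X t))"
    by (rule integral_distr[OF measurable_X[OF t] e, symmetric])
  finally show "(\<integral>x. exp (- real n * x) \<partial>distr M borel (\<lambda>w. k * X (t / k powr \<alpha>) w)) =
      (\<integral>x. exp (- real n * x) \<partial>distr M borel (X t))" .
qed

lemma distr_X_density:
  assumes "0 < t" shows "distr M borel (X t) = density lborel (\<lambda>a. ennreal (f t a))"
proof -
  have "distr M borel (X t) = distr M lborel (X t)" by (rule distr_cong) auto
  then show ?thesis using distributed_X[OF assms] by (simp add: distributed_def)
qed

lemma f_scaled:
  assumes k: "0 < k" and t: "0 < t"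
  shows "f t (k * a) = f (t / k powr \<alpha>) a / k"
proof -
  let ?t = "t / k powr \<alpha>"
  have t': "0 < ?t" using k t by simp
  have "density lborel (\<lambda>x. ennreal (f t x)) = distr M borel (\<lambda>w. k * X ?t w)"
    using distr_scaled[OF k, of t] t by (simp add: distr_X_density[OF t, symmetric])
  also have "\<dots> = distr M lborel (\<lambda>w. 0 + k * X ?t w)"
    by (rule distr_cong) auto
  also have "\<dots> = density lborel (\<lambda>x. ennreal (f ?t ((x - 0) / k)) / ennreal \<bar>k\<bar>)"
    using distributed_affine[OF distributed_X[OF t'], of k 0] k by (simp add: distributed_def)
  also have "\<dots> = density lborel (\<lambda>x. ennreal (f ?t (x / k) / k))"
    using k f_nonneg[OF t'] by (simp add: divide_ennreal)
  finally have "f t = (\<lambda>x. f ?t (x / k) / k)"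
    using k f_nonneg[OF t] f_nonneg[OF t']
    by (intro continuous_density_eq continuous_f[OF t] continuous_on_divide continuous_on_const
        continuous_on_id continuous_on_compose2[OF continuous_f[OF t']]) auto
  from fun_cong[OF this, of "k * a"] show ?thesis using k by simp
qed

lemma f_zero:
  assumes t: "0 < t" and a: "a \<le> 0" shows "f t a = 0"
proof -
  have "(\<integral>\<^sup>+x. ennreal (f t x) * indicator {..<0} x \<partial>lborel) = (\<integral>\<^sup>+w. indicator {..<0} (X t w) \<partial>M)"
    by (rule nn_integral_X[symmetric, OF t]) measurable
  also have "\<dots> = (\<integral>\<^sup>+w. 0 \<partial>M)"
  proof (rule nn_integral_cong_AE)
    show "AE w in M. indicator {..<0} (X t w) = (0::ennreal)"
      using nonneg_X by eventually_elim (use t in \<open>auto simp: not_less[symmetric]\<close>)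
  qed
  finally have "AE x in lborel. ennreal (f t x) * indicator {..<0} x = 0"
    using t by (subst nn_integral_0_iff_AE[symmetric]) auto
  then have zero: "AE x in lborel. x < 0 \<longrightarrow> f t x = 0"
    by eventually_elim (use f_nonneg[OF t] in \<open>auto simp: indicator_def ennreal_eq_0_iff intro: antisym\<close>)
  \<comment> \<open>The factor \<open>min x 0\<close> turns a statement about the negative half-line
    into an identity between two continuous functions on the whole line, where equality almost
    everywhere implies equality.\<close>
  have "AE x in lborel. min x 0 * f t x = 0"
    using zero by eventually_elim (auto simp: min_def)
  then have eq: "(\<lambda>x. min x 0 * f t x) = (\<lambda>_. 0)"
    using continuous_f[OF t] by (intro continuous_AE_eq) (auto intro!: continuous_intros)
  have "f t x = 0" if "x < 0" for x
    using fun_cong[OF eq, of x] that by auto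
  then have "closure {..<0} \<subseteq> {x. f t x = 0}"
    using continuous_f[OF t] by (intro closure_minimal closed_Collect_eq) auto
  with a show ?thesis by (auto simp: closure_lessThan)
qed

text \<open>\<open>F\<close> is \<open>f\<close> extended by 0 to nonpositive times, in a form that is visibly jointly measurable.\<close>

definition F :: "real \<Rightarrow> real \<Rightarrow> real" where
  "F t a = (if 0 < t then f 1 (a / t powr (1 / \<alpha>)) / t powr (1 / \<alpha>) else 0)"

lemma F_eq:
  assumes t: "0 < t" shows "F t a = f t a"
proof -
  let ?k = "t powr (1 / \<alpha>)"
  have k: "0 < ?k" "?k powr \<alpha> = t" using t \<alpha> by (auto simp: powr_powr)
  have "f t (?k * (a / ?k)) = f (t / ?k powr \<alpha>) (a / ?k) / ?k" by (rule f_scaled[OF k(1) t])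
  then show ?thesis using k t by (simp only: F_def if_True k(2)) simp
qed

lemma F_nonneg: "0 \<le> F t a"
  using f_nonneg[of 1] by (simp add: F_def)

lemma measurable_F [measurable]: "(\<lambda>(t, a). F t a) \<in> borel_measurable (borel \<Otimes>\<^sub>M borel)"
  using measurable_f[of 1] unfolding F_def by measurable

text \<open>The potential density, with extended values because its finiteness is only established
  in \<open>U_b\<close> and \<open>U_finite\<close>.\<close>

definition U :: "real \<Rightarrow> ennreal" where
  "U a = (\<integral>\<^sup>+t. ennreal (F t a) \<partial>lborel)"

lemma measurable_U [measurable]: "U \<in> borel_measurable borel"
  unfolding U_def by measurable

lemma F_scaled:
  assumes k: "0 < k" shows "F (k powr \<alpha> * t) (k * a) = F t a / k"
proof (cases "0 < t")
  case True
  then show ?thesis using f_scaled[OF k, of "k powr \<alpha> * t" a] k by (simp add: F_eq)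
qed (use k in \<open>simp add: F_def zero_less_mult_iff\<close>)

text \<open>Substituting k^\<alpha> t for t contributes a factor k^\<alpha>, and the scaling of the
  transition density a factor 1 / k.\<close>

lemma U_scaled:
  assumes k: "0 < k" shows "U (k * a) = ennreal (k powr (\<alpha> - 1)) * U a"
proof -
  have "U (k * a) = ennreal \<bar>k powr \<alpha>\<bar> * (\<integral>\<^sup>+t. ennreal (F (0 + k powr \<alpha> * t) (k * a)) \<partial>lborel)"
    unfolding U_def using k by (intro nn_integral_real_affine) auto
  also have "\<dots> = ennreal (k powr \<alpha>) * (\<integral>\<^sup>+t. ennreal (1 / k) * ennreal (F t a) \<partial>lborel)"
    using k F_nonneg by (simp add: F_scaled ennreal_mult[symmetric])
  also have "\<dots> = ennreal (k powr \<alpha>) * (ennreal (1 / k) * U a)"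
    unfolding U_def by (subst nn_integral_cmult) auto
  also have "\<dots> = ennreal (k powr (\<alpha> - 1)) * U a"
    using k by (simp add: mult.assoc[symmetric] ennreal_mult[symmetric] powr_diff)
  finally show ?thesis .
qed

lemma U_nonpos: "a \<le> 0 \<Longrightarrow> U a = 0"
proof -
  assume a: "a \<le> 0"
  have "F t a = 0" for t using f_zero[of t a] a F_eq[of t a] by (cases "0 < t") (auto simp: F_def)
  then show ?thesis by (simp add: U_def)
qed

text \<open>Finiteness is assumed because the Lebesgue integral in \<open>potential_density\<close>
  would take the default value 0 if it diverged.\<close>

lemma potential_density_eq: "ennreal (potential_density f a) = U a" if "U a < \<infinity>"
proof -
  have "potential_density f a = (\<integral>t. F t a \<partial>lborel)"
    unfolding potential_density_def set_lebesgue_integral_def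
    by (intro Bochner_Integration.integral_cong) (auto simp: indicator_def F_eq[symmetric], simp add: F_def)
  moreover have "integrable lborel (\<lambda>t. F t a)"
    using that F_nonneg by (intro integrableI_nonneg) (auto simp: U_def)
  ultimately show ?thesis
    unfolding U_def using F_nonneg by (simp add: nn_integral_eq_integral)
qed

end

section \<open>Independence of increments and finite-dimensional laws\<close>

text \<open>Adding 0 and s to the given times makes every X_j a partial sum of increments from the
  starting value 0, and lets the enumeration end at s. The value \<open>\<kappa> j\<close> is the
  number of increments that add up to X_j.\<close>

lemma sorted_enumeration:
  fixes J :: "real set"
  assumes J: "finite J" "J \<subseteq> {0..s}" and s: "0 \<le> s"
  obtains \<tau> :: "nat \<Rightarrow> real" and n \<kappa> where "\<tau> 0 = 0" "\<tau> n = s" "\<And>i. i < n \<Longrightarrow> \<tau> i \<le> \<tau> (Suc i)"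
    "\<And>j. j \<in> J \<Longrightarrow> \<kappa> j \<le> n" "\<And>j. j \<in> J \<Longrightarrow> \<tau> (\<kappa> j) = j"
proof -
  define xs where "xs = sorted_list_of_set (insert 0 (insert s J))"
  have xs: "sorted xs" "set xs = insert 0 (insert s J)" 
    using J by (simp_all add: xs_def del: sorted_list_of_set_insert_remove)
  define n where "n = length xs - 1"
  have len: "length xs = Suc n" using xs(2) by (cases xs) (auto simp: n_def)
  have nth: "0 \<le> xs ! i" "xs ! i \<le> s" if "i \<le> n" for i
  proof -
    have "xs ! i \<in> set xs" using that len by auto
    then show "0 \<le> xs ! i" "xs ! i \<le> s" using xs J s by auto
  qed
  obtain k0 where k0: "k0 \<le> n" "xs ! k0 = 0" using xs(2) len by (metis in_set_conv_nth insertI1 less_Suc_eq_le)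
  have "xs ! 0 \<le> 0" using sorted_nth_mono[OF xs(1), of 0 k0] k0 len by auto
  then have 0: "xs ! 0 = 0" using nth[of 0] by auto
  obtain k1 where k1: "k1 \<le> n" "xs ! k1 = s" using xs(2) len by (metis in_set_conv_nth insertI1 insertI2 less_Suc_eq_le)
  have "s \<le> xs ! n" using sorted_nth_mono[OF xs(1), of k1 n] k1 len by auto
  then have n: "xs ! n = s" using nth[of n] by auto
  have "\<exists>k\<le>n. xs ! k = j" if "j \<in> J" for j
    using that xs(2) len by (metis in_set_conv_nth insertI2 less_Suc_eq_le)
  then obtain \<kappa> where \<kappa>: "\<And>j. j \<in> J \<Longrightarrow> \<kappa> j \<le> n \<and> xs ! \<kappa> j = j" by metis
  show ?thesis
    by (rule that[of "\<lambda>i. xs ! i" n \<kappa>]) (use 0 n \<kappa> xs(1) len in \<open>auto simp: sorted_iff_nth_Suc\<close>)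
qed

lemma borel_measurable_partial_sum:
  fixes m n :: nat
  shows "m \<le> n \<Longrightarrow> (\<lambda>v. \<Sum>i<m. v i :: real) \<in> borel_measurable (PiM {..<n} (\<lambda>_. borel))"
  by (rule borel_measurable_sum[of "{..<m}" "\<lambda>i v. v i"], rule measurable_component_singleton) auto

context subordinator
begin

section \<open>The Markov property at a deterministic time\<close>

lemma past_subalgebra: "(\<lambda>w. w) \<in> M \<rightarrow>\<^sub>M past s"
  using sets_past_subset[of s] sets.sets_into_space[of _ "past s"]
  by (auto intro!: measurableI simp: space_M past_eq_coords Int_absorb2 sets_M)

text \<open>The definition of a Levy process speaks of finitely many increments only. A cylinder
  event up to s is almost surely a condition on finitely many increments before s, and intersection
  stability of the cylinders extends independence to the whole past.\<close>

lemma indep_past_increment: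
  assumes s: "0 \<le> s" and t: "s \<le> t" and A: "A \<in> sets (past s)" and B: "B \<in> sets borel"
  shows "prob (A \<inter> ((\<lambda>w. X t w - X s w) -` B \<inter> space M))
    = prob A * prob ((\<lambda>w. X t w - X s w) -` B \<inter> space M)"
proof -
  let ?\<xi> = "\<lambda>w. X t w - X s w"
  let ?B = "{?\<xi> -` A \<inter> space M | A. A \<in> sets borel}"
  have [measurable]: "?\<xi> \<in> borel_measurable M"
    using s t by (intro borel_measurable_diff measurable_X) auto
  have sets_past: "sets (past s) = sigma_sets (space M) (cylinders {0..s})"
    unfolding past_eq_coords space_M by (rule sets_coords_cylinders) auto
  have "indep_set (cylinders {0..s}) ?B"
  proof (rule indep_setI)
    show "cylinders {0..s} \<subseteq> events"
      using sets_past sets_past_subset[of s] unfolding sets_M by auto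
    show "?B \<subseteq> events" by auto
    fix a' b' assume "a' \<in> cylinders {0..s}" "b' \<in> ?B"
    then obtain J c B where a: "a' = cylinder J c" and J: "finite J" "J \<subseteq> {0..s}"
      and b': "b' = ?\<xi> -` B \<inter> space M" and [measurable]: "B \<in> sets borel"
      by (auto simp: cylinders_def)
    obtain \<tau> n \<kappa> where \<tau>: "\<tau> 0 = 0" "\<tau> n = s" "\<And>i. i < n \<Longrightarrow> \<tau> i \<le> \<tau> (Suc i)"
      and \<kappa>: "\<And>j. j \<in> J \<Longrightarrow> \<kappa> j \<le> n" "\<And>j. j \<in> J \<Longrightarrow> \<tau> (\<kappa> j) = j"
      by (rule sorted_enumeration[OF J s]) auto
    \<comment> \<open>Appending t as a last point makes X_t - X_s the increment of index n.\<close>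
    define \<sigma> where "\<sigma> = \<tau>(Suc n := t)"
    define D where "D i w = X (\<sigma> (Suc i)) w - X (\<sigma> i) w" for i w
    have "indep_vars (\<lambda>_. borel) D {..<Suc n}"
      unfolding D_def by (rule indep_increments) (use \<tau> t in \<open>auto simp: \<sigma>_def less_Suc_eq\<close>)
    then have iv: "indep_var (PiM {..<n} (\<lambda>_. borel)) (\<lambda>w. restrict (\<lambda>i. D i w) {..<n})
        (PiM {n} (\<lambda>_. borel)) (\<lambda>w. restrict (\<lambda>i. D i w) {n})"
      by (rule indep_var_restrict) auto
    define S where "S = {v \<in> space (PiM {..<n} (\<lambda>_. borel)). \<forall>j\<in>J. (\<Sum>i<\<kappa> j. v i) < (c j :: real)}"
    have S [measurable]: "S \<in> sets (PiM {..<n} (\<lambda>_. borel))"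
    proof -
      have "(\<lambda>v. \<Sum>i<\<kappa> j. v i :: real) \<in> borel_measurable (PiM {..<n} (\<lambda>_. borel))" if "j \<in> J" for j
        using \<kappa>(1)[OF that] by (rule borel_measurable_partial_sum)
      then show ?thesis unfolding S_def
        using J(1) by (intro sets.sets_Collect_finite_All) auto
    qed
    define T where "T = {v \<in> space (PiM {n} (\<lambda>_. borel)). v n \<in> B}"
    have T [measurable]: "T \<in> sets (PiM {n} (\<lambda>_. borel))"
      unfolding T_def by measurable
    have Dsum: "AE w in M. \<forall>j\<in>J. (\<Sum>i<\<kappa> j. D i w) = X j w"
      using X_zero
    proof eventually_elim
      case (elim w)
      have "(\<Sum>i<\<kappa> j. D i w) = (\<Sum>i<\<kappa> j. X (\<tau> (Suc i)) w - X (\<tau> i) w)" if "j \<in> J" for j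
        using \<kappa>(1)[OF that] by (intro sum.cong) (auto simp: D_def \<sigma>_def)
      then show ?case using \<kappa> \<tau> elim 
        by (simp add: sum_lessThan_telescope[of "\<lambda>i. X (\<tau> i) w"])
    qed
    \<comment> \<open>The two events agree almost surely only, since this is how X_0 = 0, survival
      and nonnegativity are known.\<close>
    have aA: "AE w in M. w \<in> a' \<longleftrightarrow> w \<in> (\<lambda>w. restrict (\<lambda>i. D i w) {..<n}) -` S \<inter> space M"
      using Dsum alive nonneg_X AE_space
    proof eventually_elim
      case (elim w)
      have "(\<Sum>i<\<kappa> j. restrict (\<lambda>i. D i w) {..<n} i) = X j w" if "j \<in> J" for j
        using elim(1) \<kappa>(1)[OF that] that by (auto intro!: sum.cong)
      moreover have "w j \<in> below (c j) \<longleftrightarrow> X j w < c j" if "j \<in> J" for j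
      proof -
        have "0 \<le> j" using that J by auto
        then obtain x where "w j = Some x" "0 \<le> X j w" using elim by (cases "w j") auto
        then show ?thesis by (auto simp: in_below_iff X_def)
      qed
      ultimately show ?case
        using elim(4) by (auto simp: a cylinder_def S_def space_M space_PiM)
    qed
    have bB: "b' = (\<lambda>w. restrict (\<lambda>i. D i w) {n}) -` T \<inter> space M"
      using \<tau>(2) by (auto simp: b' T_def D_def \<sigma>_def space_PiM)
    have rv: "(\<lambda>w. restrict (\<lambda>i. D i w) {..<n}) \<in> M \<rightarrow>\<^sub>M PiM {..<n} (\<lambda>_. borel)"
      "(\<lambda>w. restrict (\<lambda>i. D i w) {n}) \<in> M \<rightarrow>\<^sub>M PiM {n} (\<lambda>_. borel)"
      using iv by (auto dest: indep_var_rv1 indep_var_rv2)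
    let ?A = "(\<lambda>w. restrict (\<lambda>i. D i w) {..<n}) -` S \<inter> space M"
    have ev: "?A \<in> events" "a' \<in> events" "b' \<in> events"
      using measurable_sets[OF rv(1) S] \<open>cylinders {0..s} \<subseteq> events\<close> \<open>a' \<in> cylinders {0..s}\<close>
        \<open>?B \<subseteq> events\<close> \<open>b' \<in> ?B\<close> by auto
    have "prob (a' \<inter> b') = prob (?A \<inter> b')"
      using aA ev by (intro measure_eq_AE) auto
    also have "?A \<inter> b' = (\<lambda>w. (restrict (\<lambda>i. D i w) {..<n}, restrict (\<lambda>i. D i w) {n})) -` (S \<times> T) \<inter> space M"
      by (auto simp: bB)
    also have "prob \<dots> = prob ?A * prob b'"
      unfolding bB by (rule indep_varD[OF iv S T])
    also have "prob ?A = prob a'"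
      using aA ev by (intro measure_eq_AE) auto
    finally show "prob (a' \<inter> b') = prob a' * prob b'" .
  qed
  then have "indep_set (sigma_sets (space M) (cylinders {0..s})) (sigma_sets (space M) ?B)"
  proof (rule indep_set_sigma_sets)
    show "Int_stable ?B"
    proof (rule Int_stableI)
      fix a b assume "a \<in> ?B" "b \<in> ?B"
      then obtain A B where "a = ?\<xi> -` A \<inter> space M" "b = ?\<xi> -` B \<inter> space M" "A \<inter> B \<in> sets borel" by auto
      then show "a \<inter> b \<in> ?B" by (intro CollectI exI[of _ "A \<inter> B"]) auto
    qed
  qed (rule Int_stable_cylinders)
  then show ?thesis
    using A B unfolding sets_past by (intro indep_setD[of "sigma_sets (space M) (cylinders {0..s})"]) auto
qed

text \<open>By independence the joint law of the past, seen as the identity map into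
  \<open>past s\<close>, and of the increment is a product measure; the rest is Tonelli's
  theorem.\<close>

lemma nn_integral_past_increment:
  assumes s: "0 \<le> s" and t: "s < t" and H: "H \<in> borel_measurable (past s \<Otimes>\<^sub>M borel)"
  shows "(\<integral>\<^sup>+w. H (w, X t w - X s w) \<partial>M)
    = (\<integral>\<^sup>+w. (\<integral>\<^sup>+x. ennreal (f (t - s) x) * H (w, x) \<partial>lborel) \<partial>M)"
proof -
  let ?\<xi> = "\<lambda>w. X t w - X s w"
  have [measurable]: "?\<xi> \<in> borel_measurable M"
    using s t by (intro borel_measurable_diff measurable_X) auto
  note [measurable] = past_subalgebra[of s] H measurable_f[of "t - s"]
  have pair: "distr M (past s) (\<lambda>w. w) \<Otimes>\<^sub>M distr M borel ?\<xi> = distr M (past s \<Otimes>\<^sub>M borel) (\<lambda>w. (w, ?\<xi> w))"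
  proof (rule pair_measure_eqI)
    show "sigma_finite_measure (distr M (past s) (\<lambda>w. w))" "sigma_finite_measure (distr M borel ?\<xi>)"
      by (intro prob_space_imp_sigma_finite prob_space_distr; measurable)+
    fix A B assume "A \<in> sets (distr M (past s) (\<lambda>w. w))" "B \<in> sets (distr M borel ?\<xi>)"
    then have [measurable]: "A \<in> sets (past s)" "B \<in> sets borel" by auto
    then have "A \<subseteq> space M" using sets.sets_into_space[of A "past s"] by (simp add: space_M past_eq_coords)
    have "(\<lambda>w. (w, ?\<xi> w)) -` (A \<times> B) \<inter> space M = A \<inter> (?\<xi> -` B \<inter> space M)"
      using \<open>A \<subseteq> space M\<close> by auto
    then show "emeasure (distr M (past s) (\<lambda>w. w)) A * emeasure (distr M borel ?\<xi>) B =
        emeasure (distr M (past s \<Otimes>\<^sub>M borel) (\<lambda>w. (w, ?\<xi> w))) (A \<times> B)"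
      using indep_past_increment[OF s, of t A B] t \<open>A \<subseteq> space M\<close>
      by (simp add: emeasure_distr emeasure_eq_measure Int_absorb2 ennreal_mult)
  qed simp
  interpret D: prob_space "distr M borel ?\<xi>" by (rule prob_space_distr) measurable
  have "(\<integral>\<^sup>+w. H (w, ?\<xi> w) \<partial>M) = (\<integral>\<^sup>+p. H p \<partial>distr M (past s \<Otimes>\<^sub>M borel) (\<lambda>w. (w, ?\<xi> w)))"
    by (simp add: nn_integral_distr)
  also have "\<dots> = (\<integral>\<^sup>+w. (\<integral>\<^sup>+x. H (w, x) \<partial>distr M borel ?\<xi>) \<partial>distr M (past s) (\<lambda>w. w))"
    unfolding pair[symmetric] by (rule D.nn_integral_fst[symmetric]) (simp add: H)
  also have "\<dots> = (\<integral>\<^sup>+w. (\<integral>\<^sup>+x. H (w, x) \<partial>distr M borel ?\<xi>) \<partial>M)"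
  proof (rule nn_integral_distr[OF past_subalgebra])
    have "(\<lambda>(w, x). H (w, x)) \<in> borel_measurable (distr M (past s) (\<lambda>w. w) \<Otimes>\<^sub>M distr M borel ?\<xi>)"
      by (simp add: H)
    then show "(\<lambda>w. \<integral>\<^sup>+x. H (w, x) \<partial>distr M borel ?\<xi>) \<in> borel_measurable (distr M (past s) (\<lambda>w. w))"
      by (rule D.borel_measurable_nn_integral)
  qed
  also have "\<dots> = (\<integral>\<^sup>+w. (\<integral>\<^sup>+x. ennreal (f (t - s) x) * H (w, x) \<partial>lborel) \<partial>M)"
  proof (rule nn_integral_cong)
    fix w assume "w \<in> space M"
    then have "w \<in> space (past s)" by (simp add: space_M past_eq_coords)
    then have "(\<lambda>x. H (w, x)) \<in> borel_measurable borel" by measurable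
    then show "(\<integral>\<^sup>+x. H (w, x) \<partial>distr M borel ?\<xi>) = (\<integral>\<^sup>+x. ennreal (f (t - s) x) * H (w, x) \<partial>lborel)"
      using s t by (simp add: distr_increment distr_X_density nn_integral_density)
  qed
  finally show ?thesis .
qed

lemma measurable_X_past: "0 \<le> r \<Longrightarrow> r \<le> s \<Longrightarrow> X r \<in> borel_measurable (past s)"
  unfolding X_def past_eq_coords by (intro measurable_the_coords) auto

text \<open>Shifting by X_s makes the position at time t the integration variable, so that
  constraints which depend on this position can be studied for one position at a time.\<close>

lemma markov_density:
  assumes s: "0 \<le> s" and t: "s < t"
    and G: "(\<lambda>(a, w). G a w) \<in> borel_measurable (borel \<Otimes>\<^sub>M past s)"
  shows "(\<integral>\<^sup>+w. G (X t w) w \<partial>M)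
    = (\<integral>\<^sup>+w. (\<integral>\<^sup>+a. ennreal (F (t - s) (a - X s w)) * G a w \<partial>lborel) \<partial>M)"
proof -
  note [measurable] = measurable_X_past[OF s order_refl]
  define H where "H p = G (X s (fst p) + snd p) (fst p)" for p
  have "(\<lambda>p. (\<lambda>(a, w). G a w) (X s (fst p) + snd p, fst p)) \<in> borel_measurable (past s \<Otimes>\<^sub>M borel)"
    by (rule measurable_compose[OF _ G]) measurable
  then have H: "H \<in> borel_measurable (past s \<Otimes>\<^sub>M borel)"
    by (simp add: H_def[abs_def])
  have "(\<integral>\<^sup>+w. G (X t w) w \<partial>M) = (\<integral>\<^sup>+w. H (w, X t w - X s w) \<partial>M)"
    by (simp add: H_def)
  also have "\<dots> = (\<integral>\<^sup>+w. (\<integral>\<^sup>+x. ennreal (f (t - s) x) * H (w, x) \<partial>lborel) \<partial>M)"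
    by (rule nn_integral_past_increment[OF s t H])
  also have "\<dots> = (\<integral>\<^sup>+w. (\<integral>\<^sup>+a. ennreal (F (t - s) (a - X s w)) * G a w \<partial>lborel) \<partial>M)"
  proof (rule nn_integral_cong)
    fix w assume "w \<in> space M"
    then have w: "w \<in> space (past s)" by (simp add: space_M past_eq_coords)
    have "(\<lambda>a. (\<lambda>(a, w). G a w) (a, w)) \<in> borel_measurable borel"
      using w by (intro measurable_compose[OF _ G]) measurable
    then have [measurable]: "(\<lambda>a. G a w) \<in> borel_measurable borel" by simp
    have "(\<integral>\<^sup>+a. ennreal (F (t - s) (a - X s w)) * G a w \<partial>lborel)
      = (\<integral>\<^sup>+x. ennreal (F (t - s) (X s w + 1 * x - X s w)) * G (X s w + 1 * x) w \<partial>lborel)"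
      using nn_integral_real_affine[of "\<lambda>a. ennreal (F (t - s) (a - X s w)) * G a w" 1 "X s w"] by simp
    then show "(\<integral>\<^sup>+x. ennreal (f (t - s) x) * H (w, x) \<partial>lborel)
      = (\<integral>\<^sup>+a. ennreal (F (t - s) (a - X s w)) * G a w \<partial>lborel)"
      using t by (simp add: H_def F_eq)
  qed
  finally show ?thesis .
qed

text \<open>The density vanishes to the left of 0, so compactness of [0, K] bounds it on the
  half-line. A half-line suffices for Chapman-Kolmogorov because a - X_r is at most a.\<close>

lemma bounded_f_atMost:
  assumes "0 < t" obtains B where "0 \<le> B" "\<And>a. a \<le> K \<Longrightarrow> f t a \<le> B"
proof -
  have "continuous_on {0..K} (f t)"
    using continuous_f[OF assms] by (rule continuous_on_subset) auto
  then have "bounded (f t ` {0..K})" by (intro compact_imp_bounded compact_continuous_image) auto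
  then obtain B where "\<forall>a\<in>{0..K}. \<bar>f t a\<bar> \<le> B" by (auto simp: bounded_iff)
  then have "f t a \<le> max 0 B" if "a \<le> K" for a
    using that f_zero[OF assms, of a] by (cases "0 \<le> a") force+
  then show ?thesis by (intro that[of "max 0 B"]) auto
qed

text \<open>Both sides are densities of X at time u + r, and both are continuous in a, the left one
  by dominated convergence. Hence they agree at every a.\<close>

lemma Chapman_Kolmogorov:
  assumes r: "0 \<le> r" and u: "0 < u"
  shows "(\<integral>\<^sup>+w. ennreal (F u (a - X r w)) \<partial>M) = ennreal (F (u + r) a)"
proof (cases "r = 0")
  case True
  then have "(\<integral>\<^sup>+w. ennreal (F u (a - X r w)) \<partial>M) = (\<integral>\<^sup>+w. ennreal (F u a) \<partial>M)"
    using X_zero by (intro nn_integral_cong_AE) (auto elim!: eventually_mono)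
  then show ?thesis using True by (simp add: emeasure_space_1)
next
  case False
  with r have r: "0 < r" by simp
  note [measurable] = measurable_f[OF u] measurable_X[of r]
  define g where "g a = (\<integral>w. f u (a - X r w) \<partial>M)" for a
  have bnd: "\<exists>B. \<forall>a\<le>K. AE w in M. norm (f u (a - X r w)) \<le> B" for K
  proof -
    obtain B where B: "\<And>a. a \<le> K \<Longrightarrow> f u a \<le> B" by (rule bounded_f_atMost[OF u, of K]) blast
    have "AE w in M. norm (f u (a - X r w)) \<le> B" if "a \<le> K" for a
      using nonneg_X
    proof eventually_elim
      case (elim w)
      then have "a - X r w \<le> K" using that r by (smt (verit))
      from B[OF this] show ?case using f_nonneg[OF u] by simp
    qed
    then show ?thesis by blast
  qed
  have int: "integrable M (\<lambda>w. f u (a - X r w))" for a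
  proof -
    obtain B where "AE w in M. norm (f u (a - X r w)) \<le> B" using bnd[of a] by blast
    then show ?thesis using r by (intro integrable_const_bound) measurable
  qed
  have g: "(\<integral>\<^sup>+w. ennreal (F u (a - X r w)) \<partial>M) = ennreal (g a)" for a
    using u int f_nonneg[OF u] by (simp add: F_eq g_def nn_integral_eq_integral)
  have cont_g: "continuous_on UNIV g"
  proof (rule continuous_on_sequentiallyI)
    fix x :: "nat \<Rightarrow> real" and a assume x: "x \<longlonglongrightarrow> a"
    then obtain K where K: "\<And>n. \<bar>x n\<bar> \<le> K"
      using convergent_imp_Bseq[of x] by (auto simp: convergent_def Bseq_def)
    obtain B where B: "\<And>n. AE w in M. norm (f u (x n - X r w)) \<le> B"
      using bnd[of K] K by (metis abs_le_D1)
    have "(\<lambda>n. \<integral>w. f u (x n - X r w) \<partial>M) \<longlonglongrightarrow> (\<integral>w. f u (a - X r w) \<partial>M)"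
    proof (rule integral_dominated_convergence[where w = "\<lambda>_. B"])
      show "AE w in M. (\<lambda>n. f u (x n - X r w)) \<longlonglongrightarrow> f u (a - X r w)"
        using continuous_f[OF u] x
        by (intro always_eventually allI isCont_tendsto_compose[of _ "f u"])
           (auto simp: continuous_on_eq_continuous_at intro!: tendsto_intros)
      show "(\<lambda>w. f u (a - X r w)) \<in> borel_measurable M" "(\<lambda>w. f u (x n - X r w)) \<in> borel_measurable M" for n
        using int by blast+
    qed (use B in auto)
    then show "(\<lambda>n. g (x n)) \<longlonglongrightarrow> g a" by (simp add: g_def)
  qed
  have ur: "0 < u + r" using u r by simp
  note [measurable] = measurable_f[OF ur]
  have "density lborel (\<lambda>a. ennreal (f (u + r) a)) = density lborel (\<lambda>a. ennreal (g a))"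
  proof (rule measure_eqI)
    fix A assume "A \<in> sets (density lborel (\<lambda>a. ennreal (f (u + r) a)))"
    then have [measurable]: "A \<in> sets borel" by simp
    have "emeasure (density lborel (\<lambda>a. ennreal (f (u + r) a))) A = (\<integral>\<^sup>+w. indicator A (X (u + r) w) \<partial>M)"
      using ur by (simp add: emeasure_density nn_integral_X)
    also have "\<dots> = (\<integral>\<^sup>+w. (\<integral>\<^sup>+a. ennreal (F u (a - X r w)) * indicator A a \<partial>lborel) \<partial>M)"
      using markov_density[of r "u + r" "\<lambda>a w. indicator A a"] r u by simp
    also have "\<dots> = (\<integral>\<^sup>+a. (\<integral>\<^sup>+w. ennreal (F u (a - X r w)) * indicator A a \<partial>M) \<partial>lborel)"
      using r by (intro pair_sigma_finite.Fubini') (auto simp: pair_sigma_finite_def sigma_finite_measure_axioms lborel.sigma_finite_measure_axioms)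
    also have "\<dots> = (\<integral>\<^sup>+a. ennreal (g a) * indicator A a \<partial>lborel)"
      using r by (intro nn_integral_cong) (subst nn_integral_multc, auto simp: g)
    also have "\<dots> = emeasure (density lborel (\<lambda>a. ennreal (g a))) A"
      using borel_measurable_continuous_onI[OF cont_g] by (simp add: emeasure_density)
    finally show "emeasure (density lborel (\<lambda>a. ennreal (f (u + r) a))) A = emeasure (density lborel (\<lambda>a. ennreal (g a))) A" .
  qed simp
  moreover have "0 \<le> g a" for a unfolding g_def using f_nonneg[OF u] by simp
  ultimately have "f (u + r) = g"
    using f_nonneg[OF ur] by (intro continuous_density_eq continuous_f[OF ur] cont_g)
  then show ?thesis using g ur by (simp add: F_eq)
qed

text \<open>For a fixed endpoint a at time t, the process \<open>F (t - r) (a - X r w)\<close> with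
  r < t is a martingale by Chapman-Kolmogorov; up to normalisation it is the density of the bridge
  to a. Its mean against a function of the past of s may therefore be taken at s.\<close>

lemma nn_integral_past_density:
  assumes G: "G \<in> borel_measurable (past s)" and s: "0 \<le> s" "s \<le> r" "r < t"
  shows "(\<integral>\<^sup>+w. ennreal (F (t - r) (a - X r w)) * G w \<partial>M) = (\<integral>\<^sup>+w. ennreal (F (t - s) (a - X s w)) * G w \<partial>M)"
proof (cases "s = r")
  case False
  with s have sr: "s < r" by simp
  note [measurable] = G measurable_X_past[OF s(1) order_refl]
  define H where "H p = ennreal (F (t - r) (a - X s (fst p) - snd p)) * G (fst p)" for p
  have "(\<integral>\<^sup>+w. ennreal (F (t - r) (a - X r w)) * G w \<partial>M) = (\<integral>\<^sup>+w. H (w, X r w - X s w) \<partial>M)"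
    by (simp add: H_def)
  also have "\<dots> = (\<integral>\<^sup>+w. (\<integral>\<^sup>+x. ennreal (f (r - s) x) * H (w, x) \<partial>lborel) \<partial>M)"
    by (rule nn_integral_past_increment[OF s(1) sr]) (unfold H_def, measurable)
  also have "\<dots> = (\<integral>\<^sup>+w. ennreal (F (t - s) (a - X s w)) * G w \<partial>M)"
  proof (rule nn_integral_cong)
    fix w
    let ?a = "a - X s w"
    have "(\<integral>\<^sup>+x. ennreal (f (r - s) x) * H (w, x) \<partial>lborel)
      = (\<integral>\<^sup>+x. ennreal (f (r - s) x) * ennreal (F (t - r) (?a - x)) * G w \<partial>lborel)"
      by (simp add: H_def mult.assoc)
    also have "\<dots> = (\<integral>\<^sup>+x. ennreal (f (r - s) x) * ennreal (F (t - r) (?a - x)) \<partial>lborel) * G w"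
      using sr measurable_f[of "r - s"] by (intro nn_integral_multc) auto
    also have "(\<integral>\<^sup>+x. ennreal (f (r - s) x) * ennreal (F (t - r) (?a - x)) \<partial>lborel)
       = (\<integral>\<^sup>+v. ennreal (F (t - r) (?a - X (r - s) v)) \<partial>M)"
      using sr by (intro nn_integral_X[symmetric]) auto
    also have "\<dots> = ennreal (F (t - s) ?a)"
      using Chapman_Kolmogorov[of "r - s" "t - r" ?a] sr s by simp
    finally show "(\<integral>\<^sup>+x. ennreal (f (r - s) x) * H (w, x) \<partial>lborel) = ennreal (F (t - s) ?a) * G w" .
  qed
  finally show ?thesis .
qed simp

text \<open>The scaled increments over the compressed grid are independent and have the laws of the
  increments over the original grid; the positions are the same partial sums of both
  families.\<close>

lemma distr_scaled_finite:
  assumes J: "finite J" "J \<subseteq> {0..}" and k: "0 < k"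
  shows "distr M (PiM J (\<lambda>_. borel)) (\<lambda>w. \<lambda>j\<in>J. k * X (j / k powr \<alpha>) w)
    = distr M (PiM J (\<lambda>_. borel)) (\<lambda>w. \<lambda>j\<in>J. X j w)"
proof -
  define s where "s = Max (insert 0 J)"
  have s: "0 \<le> s" "J \<subseteq> {0..s}" using J by (auto simp: s_def)
  obtain \<tau> n \<kappa> where \<tau>: "\<tau> 0 = 0" "\<tau> n = s" "\<And>i. i < n \<Longrightarrow> \<tau> i \<le> \<tau> (Suc i)"
    and \<kappa>: "\<And>j. j \<in> J \<Longrightarrow> \<kappa> j \<le> n" "\<And>j. j \<in> J \<Longrightarrow> \<tau> (\<kappa> j) = j"
    by (rule sorted_enumeration[OF J(1) s(2) s(1)]) auto
  have \<tau>_nonneg: "0 \<le> \<tau> i" if "i \<le> n" for i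
    using that by (induction i) (use \<tau> in \<open>auto intro: order_trans\<close>)
  define q where "q = k powr \<alpha>"
  have q: "0 < q" using k by (simp add: q_def)
  define D where "D i w = X (\<tau> (Suc i)) w - X (\<tau> i) w" for i w
  define E where "E i w = k * (X (\<tau> (Suc i) / q) w - X (\<tau> i / q) w)" for i w
  have nn: "0 \<le> \<tau> i" "0 \<le> \<tau> (Suc i)" "\<tau> i \<le> \<tau> (Suc i)" if "i < n" for i
    using that \<tau> \<tau>_nonneg by auto
  have [measurable]: "D i \<in> borel_measurable M" "E i \<in> borel_measurable M" if "i < n" for i
    using nn[OF that] q unfolding D_def E_def by (auto intro!: borel_measurable_diff borel_measurable_times)
  have ivD: "indep_vars (\<lambda>_. borel) D {..<n}"
    unfolding D_def by (rule indep_increments) (use \<tau> in auto)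
  have "indep_vars (\<lambda>_. borel) (\<lambda>i w. X (\<tau> (Suc i) / q) w - X (\<tau> i / q) w) {..<n}"
    using indep_increments[of "\<lambda>i. \<tau> i / q" n] \<tau> q by (auto simp: divide_right_mono)
  then have ivE: "indep_vars (\<lambda>_. borel) E {..<n}"
    unfolding E_def by (rule indep_vars_compose2) measurable
  have marg: "distr M borel (E i) = distr M borel (D i)" if i: "i < n" for i
  proof -
    let ?r = "\<tau> (Suc i) / q - \<tau> i / q"
    have r: "0 \<le> \<tau> i / q" "\<tau> i / q \<le> \<tau> (Suc i) / q" "0 \<le> \<tau> (Suc i) / q" "0 \<le> ?r"
      using nn[OF i] q by (auto simp: divide_right_mono)
    have "distr M borel (E i) = distr (distr M borel (\<lambda>w. X (\<tau> (Suc i) / q) w - X (\<tau> i / q) w)) borel (\<lambda>x. k * x)"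
      unfolding E_def using r by (subst distr_distr) (auto simp: o_def)
    also have "distr M borel (\<lambda>w. X (\<tau> (Suc i) / q) w - X (\<tau> i / q) w) = distr M borel (X ?r)"
      by (rule distr_increment[OF r(1,2)])
    also have "distr (distr M borel (X ?r)) borel (\<lambda>x. k * x) = distr M borel (\<lambda>w. k * X ?r w)"
      using r by (subst distr_distr) (auto simp: o_def)
    also have "\<dots> = distr M borel (X (\<tau> (Suc i) - \<tau> i))"
      using distr_scaled[OF k, of "\<tau> (Suc i) - \<tau> i"] nn[OF i] by (simp add: q_def diff_divide_distrib)
    also have "\<dots> = distr M borel (D i)"
      unfolding D_def using nn[OF i] by (intro distr_increment[symmetric]) auto
    finally show ?thesis .
  qed
  let ?P = "PiM {..<n} (\<lambda>_. borel :: real measure)"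
  have inc: "distr M ?P (\<lambda>w. \<lambda>i\<in>{..<n}. E i w) = distr M ?P (\<lambda>w. \<lambda>i\<in>{..<n}. D i w)"
  \<comment> \<open>The description of independence by a product law needs a nonempty index
    set.\<close>
  proof (cases "n = 0")
    case True
    then show ?thesis by (intro distr_cong) (auto simp: fun_eq_iff)
  next
    case False
    then have ne: "{..<n} \<noteq> {}" by auto
    have "distr M ?P (\<lambda>w. \<lambda>i\<in>{..<n}. E i w) = PiM {..<n} (\<lambda>i. distr M borel (E i))"
      using ivE by (subst (asm) indep_vars_iff_distr_eq_PiM'[OF ne]) auto
    also have "\<dots> = PiM {..<n} (\<lambda>i. distr M borel (D i))"
      using marg by (intro PiM_cong) auto
    also have "\<dots> = distr M ?P (\<lambda>w. \<lambda>i\<in>{..<n}. D i w)"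
      using ivD by (subst (asm) indep_vars_iff_distr_eq_PiM'[OF ne]) auto
    finally show ?thesis .
  qed
  define S where "S v = (\<lambda>j\<in>J. \<Sum>i<\<kappa> j. v i :: real)" for v
  have S [measurable]: "S \<in> ?P \<rightarrow>\<^sub>M PiM J (\<lambda>_. borel)"
    unfolding S_def
  proof (rule measurable_restrict)
    fix j assume "j \<in> J"
    with \<kappa>(1) show "(\<lambda>v. \<Sum>i<\<kappa> j. v i) \<in> borel_measurable ?P"
      by (intro borel_measurable_partial_sum)
  qed
  \<comment> \<open>Stated for an arbitrary process \<open>Y\<close>, because it is used both for X
    and for the scaled process.\<close>
  have partial_sums: "distr M (PiM J (\<lambda>_. borel)) (\<lambda>w. \<lambda>j\<in>J. Y j w)
      = distr (distr M ?P (\<lambda>w. \<lambda>i\<in>{..<n}. Z i w)) (PiM J (\<lambda>_. borel)) S"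
    if Y: "\<And>t. 0 \<le> t \<Longrightarrow> Y t \<in> borel_measurable M" "AE w in M. Y 0 w = 0"
      and Z: "\<And>i w. Z i w = Y (\<tau> (Suc i)) w - Y (\<tau> i) w" for Y Z
  proof -
    have rv: "(\<lambda>w. \<lambda>i\<in>{..<n}. Z i w) \<in> M \<rightarrow>\<^sub>M ?P"
      unfolding Z using nn by (intro measurable_restrict borel_measurable_diff Y(1)) auto
    have "distr M (PiM J (\<lambda>_. borel)) (\<lambda>w. \<lambda>j\<in>J. Y j w)
      = distr M (PiM J (\<lambda>_. borel)) (\<lambda>w. S (\<lambda>i\<in>{..<n}. Z i w))"
    proof (rule distr_cong_AE)
      show "AE w in M. (\<lambda>j\<in>J. Y j w) = S (\<lambda>i\<in>{..<n}. Z i w)"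
        using Y(2)
      proof eventually_elim
        case (elim w)
        have "(\<Sum>i<\<kappa> j. (\<lambda>i\<in>{..<n}. Z i w) i) = Y j w" if "j \<in> J" for j
        proof -
          have "(\<Sum>i<\<kappa> j. (\<lambda>i\<in>{..<n}. Z i w) i) = (\<Sum>i<\<kappa> j. Y (\<tau> (Suc i)) w - Y (\<tau> i) w)"
            using \<kappa>(1)[OF that] by (intro sum.cong) (auto simp: Z)
          then show ?thesis
            using \<kappa>(2)[OF that] \<tau> elim by (simp add: sum_lessThan_telescope[of "\<lambda>i. Y (\<tau> i) w"])
        qed
        then show ?case by (auto simp: S_def fun_eq_iff)
      qed
      show "(\<lambda>w. \<lambda>j\<in>J. Y j w) \<in> M \<rightarrow>\<^sub>M PiM J (\<lambda>_. borel)"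
        using J by (intro measurable_restrict Y(1)) auto
    qed (auto intro: measurable_compose[OF rv S])
    then show ?thesis by (simp only: distr_distr[OF S rv] o_def)
  qed
  have "distr M (PiM J (\<lambda>_. borel)) (\<lambda>w. \<lambda>j\<in>J. k * X (j / q) w)
      = distr (distr M ?P (\<lambda>w. \<lambda>i\<in>{..<n}. E i w)) (PiM J (\<lambda>_. borel)) S"
  proof (rule partial_sums)
    show "(\<lambda>w. k * X (t / q) w) \<in> borel_measurable M" if "0 \<le> t" for t
      using that q by (intro borel_measurable_times borel_measurable_const measurable_X) simp
    show "AE w in M. k * X (0 / q) w = 0" using X_zero by eventually_elim simp
  qed (simp add: E_def right_diff_distrib)
  also have "\<dots> = distr M (PiM J (\<lambda>_. borel)) (\<lambda>w. \<lambda>j\<in>J. X j w)"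
    unfolding inc by (rule partial_sums[symmetric]) (simp_all add: measurable_X X_zero D_def)
  finally show ?thesis by (simp add: q_def)
qed

end

section \<open>Occupation of rescaled positions\<close>

text \<open>The Markov property will require a positive gap between the constraint times and t.
  Monotone convergence over the gaps 1 / (n + 1) recovers the strict inequality.\<close>

lemma SUP_nn_integral_less:
  assumes g [measurable]: "g \<in> borel_measurable N" and h [measurable]: "h \<in> borel_measurable N"
  shows "(SUP n. \<integral>\<^sup>+x. (if h x \<le> t - recip n then g x else 0) \<partial>N)
    = (\<integral>\<^sup>+x. (if h x < (t::real) then g x else (0::ennreal)) \<partial>N)"
proof -
  have "(SUP n. \<integral>\<^sup>+x. (if h x \<le> t - recip n then g x else 0) \<partial>N)
    = (\<integral>\<^sup>+x. (SUP n. if h x \<le> t - recip n then g x else 0) \<partial>N)"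
  proof (rule nn_integral_monotone_convergence_SUP[symmetric])
    show "incseq (\<lambda>n x. if h x \<le> t - recip n then g x else 0)"
    proof (intro incseq_SucI le_funI)
      fix n x
      have "recip (Suc n) \<le> recip n" by simp
      then have "h x \<le> t - recip n \<Longrightarrow> h x \<le> t - recip (Suc n)"
        by linarith
      then show "(if h x \<le> t - recip n then g x else 0)
          \<le> (if h x \<le> t - recip (Suc n) then g x else 0)"
        by (auto simp del: of_nat_Suc)
    qed
  qed measurable
  also have "\<dots> = (\<integral>\<^sup>+x. (if h x < t then g x else 0) \<partial>N)"
  proof (rule nn_integral_cong)
    fix x
    show "(SUP n. if h x \<le> t - recip n then g x else 0) = (if h x < t then g x else 0)"
    proof (cases "h x < t")
      case True
      then obtain n where n: "recip n < t - h x"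
        using reals_Archimedean[of "t - h x"] by auto
      show ?thesis
      proof (rule antisym)
        show "(if h x < t then g x else 0) \<le> (SUP n. if h x \<le> t - recip n then g x else 0)"
          using n True by (intro SUP_upper2[of n]) auto
      next
        show "(SUP n. if h x \<le> t - recip n then g x else 0) \<le> (if h x < t then g x else 0)"
          by (rule SUP_least) (simp add: True)
      qed
    next
      case False
      have "\<not> h x \<le> t - recip n" for n
        using False by (smt (verit) inverse_positive_iff_positive of_nat_0_less_iff zero_less_Suc)
      with False show ?thesis by auto
    qed
  qed
  finally show ?thesis .
qed

context subordinator
begin

lemma Fubini_lborel:
  assumes "(\<lambda>(t, w). g t w) \<in> borel_measurable (borel \<Otimes>\<^sub>M M)"
  shows "(\<integral>\<^sup>+t. (\<integral>\<^sup>+w. g t w \<partial>M) \<partial>lborel) = (\<integral>\<^sup>+w. (\<integral>\<^sup>+t. g t w \<partial>lborel) \<partial>M)"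
proof -
  interpret LM: pair_sigma_finite lborel M
    by (intro pair_sigma_finite.intro lborel.sigma_finite_measure_axioms sigma_finite_measure_axioms)
  have "borel_measurable (lborel \<Otimes>\<^sub>M M) = borel_measurable (borel \<Otimes>\<^sub>M M)"
    by (rule measurable_cong_sets[OF sets_pair_measure_cong]) auto
  with assms show ?thesis by (intro LM.Fubini'[symmetric]) simp
qed

lemma measurable_pair_X [measurable]: "(\<lambda>(t, w). X t w) \<in> borel_measurable (borel \<Otimes>\<^sub>M M)"
proof -
  have *: "borel_measurable (borel \<Otimes>\<^sub>M M) = borel_measurable (borel \<Otimes>\<^sub>M skorohod)"
    by (rule measurable_cong_sets[OF sets_pair_measure_cong[OF refl sets_M] refl])
  show ?thesis unfolding X_def * by (rule measurable_pair_the)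
qed

text \<open>The speed at which time has to run so that the path multiplied by b / a has the original
  law again. At the undershoot it is the time factor in the definition of Y.\<close>

definition clock :: "real \<Rightarrow> real" where
  "clock a = (a / b) powr \<alpha>"

lemma clock_nonneg [simp]: "0 \<le> clock a"
  by (simp add: clock_def)

lemma measurable_clock [measurable]: "clock \<in> borel_measurable borel"
  unfolding clock_def by measurable

definition rescaled :: "real \<Rightarrow> real \<Rightarrow> path \<Rightarrow> real" where
  "rescaled a r w = b / a * X (r * clock a) w"

text \<open>The constraint times are \<open>r j\<close> and not the indices j themselves, so that
  they can be shifted while the index set stays the same.\<close>

definition rescaled_below :: "real set \<Rightarrow> (real \<Rightarrow> real) \<Rightarrow> (real \<Rightarrow> real) \<Rightarrow> real \<Rightarrow> path \<Rightarrow> bool" where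
  "rescaled_below J r c a w \<longleftrightarrow> (\<forall>j\<in>J. rescaled a (r j) w < c j)"

abbreviation test :: "real set \<Rightarrow> (real \<Rightarrow> real) \<Rightarrow> (real \<Rightarrow> real) \<Rightarrow> (real \<Rightarrow> ennreal) \<Rightarrow> real \<Rightarrow> path \<Rightarrow> ennreal" where
  "test J r c \<psi> a w \<equiv> (if 0 < a \<and> rescaled_below J r c a w then \<psi> a else 0)"

abbreviation weight :: "real set \<Rightarrow> (real \<Rightarrow> real) \<Rightarrow> (real \<Rightarrow> real) \<Rightarrow> real \<Rightarrow> path \<Rightarrow> ennreal" where
  "weight J r c s w \<equiv> (if \<forall>j\<in>J. X (r j) w < c j then U (b - X s w) else 0)"

text \<open>The factor that homogeneity produces when the potential density is brought from level a
  to level b.\<close>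

abbreviation \<gamma> :: "real \<Rightarrow> real" where
  "\<gamma> a \<equiv> (a / b) powr (\<alpha> - 1)"

text \<open>The analogue of \<open>target\<close> in which the position at time t stands for the
  undershoot and t for the last passage time. If all \<open>r j\<close> are at most s, the path is
  inspected before time t only.\<close>

definition hit :: "real set \<Rightarrow> (real \<Rightarrow> real) \<Rightarrow> (real \<Rightarrow> real) \<Rightarrow> real \<Rightarrow> real \<Rightarrow> path \<Rightarrow> bool" where
  "hit J r c s t w \<longleftrightarrow>
    0 < t \<and> s * clock (X t w) < t \<and> 0 < X t w \<and> rescaled_below J r c (X t w) w"

abbreviation jumps :: "real set \<Rightarrow> (real \<Rightarrow> real) \<Rightarrow> (real \<Rightarrow> real) \<Rightarrow> real \<Rightarrow> real \<Rightarrow> real \<Rightarrow> path \<Rightarrow> bool" where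
  "jumps J r c s \<delta> t w \<equiv> hit J r c s t w \<and> X t w < b \<and> b \<le> X (t + \<delta>) w"

text \<open>The conditional probability that the process jumps over \<open>b\<close> within time \<open>\<delta>\<close>, given its position.\<close>

definition crossing :: "real \<Rightarrow> real \<Rightarrow> ennreal" where
  "crossing \<delta> x = (if x < b then \<integral>\<^sup>+a. (if b \<le> a then ennreal (F \<delta> (a - x)) else 0) \<partial>lborel else 0)"

lemma measurable_crossing [measurable]: "crossing \<delta> \<in> borel_measurable borel"
  unfolding crossing_def by measurable

context
  fixes J :: "real set" and r c :: "real \<Rightarrow> real" and s :: real
  assumes J: "finite J" and r: "\<And>j. j \<in> J \<Longrightarrow> 0 \<le> r j" "\<And>j. j \<in> J \<Longrightarrow> r j \<le> s" and s: "0 \<le> s"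
begin

section \<open>Constraints on the path rescaled by its position at time t\<close>

lemma measurable_rescaled_below [measurable]:
  "Measurable.pred (borel \<Otimes>\<^sub>M M) (\<lambda>(a, w). rescaled_below J r c a w)"
  unfolding rescaled_below_def rescaled_def case_prod_beta
  using J by (intro pred_intros_finite borel_measurable_pred_less) measurable

text \<open>When \<open>s * clock a \<le> v\<close>, all constraint times lie in [0, v], and
  clamping them to this interval changes nothing. The condition is what confines the event to the
  past of v.\<close>

lemma measurable_rescaled_below_past:
  assumes v: "0 \<le> v"
  shows "Measurable.pred (borel \<Otimes>\<^sub>M past v)
    (\<lambda>p. s * clock (fst p) \<le> v \<and> rescaled_below J r c (fst p) (snd p))"
proof -
  define cl where "cl a w \<longleftrightarrow> (\<forall>j\<in>J. b / a * X (max 0 (min v (r j * clock a))) w < c j)" for a w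
  have cl: "cl a w \<longleftrightarrow> rescaled_below J r c a w" if "s * clock a \<le> v" for a w
  proof -
    have "max 0 (min v (r j * clock a)) = r j * clock a" if "j \<in> J" for j
    proof -
      have "r j * clock a \<le> s * clock a" using r[OF that] by (intro mult_right_mono) auto
      then show ?thesis using \<open>s * clock a \<le> v\<close> r[OF that] by auto
    qed
    then show ?thesis by (simp add: cl_def rescaled_below_def rescaled_def)
  qed
  have "(\<lambda>p. b / fst p * (\<lambda>(t, w). the (w (max 0 (min v t)))) (r j * clock (fst p), snd p))
      \<in> borel_measurable (borel \<Otimes>\<^sub>M past v)" for j
    by (intro borel_measurable_times measurable_compose[OF _ measurable_pair_past[OF v]]) measurable
  then have "Measurable.pred (borel \<Otimes>\<^sub>M past v) (\<lambda>p. cl (fst p) (snd p))"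
    unfolding cl_def X_def using J by (intro pred_intros_finite borel_measurable_pred_less) auto
  then have "Measurable.pred (borel \<Otimes>\<^sub>M past v) (\<lambda>p. s * clock (fst p) \<le> v \<and> cl (fst p) (snd p))"
    by measurable
  then show ?thesis by (simp add: cl cong: conj_cong)
qed

text \<open>The constraint times depend on the position at time t, so the Markov property is applied
  at the deterministic time t - \<epsilon>, which dominates them on the event considered. Exchanging
  the integrals then fixes the position.\<close>

lemma markov_rescaled_gap:
  assumes \<epsilon>: "0 < \<epsilon>" and \<psi> [measurable]: "\<psi> \<in> borel_measurable borel" and t: "0 < t"
  shows "(\<integral>\<^sup>+w. (if s * clock (X t w) \<le> t - \<epsilon> then
        test J r c \<psi> (X t w) w else 0) \<partial>M)
    = (\<integral>\<^sup>+a. (if s * clock a \<le> t - \<epsilon> then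
        (\<integral>\<^sup>+w. ennreal (F (t - s * clock a) (a - X (s * clock a) w)) *
          test J r c \<psi> a w \<partial>M) else 0) \<partial>lborel)"
proof (cases "\<epsilon> \<le> t")
  case False
  then have no: "\<not> s * clock a \<le> t - \<epsilon>" for a
    using s clock_nonneg[of a] by (smt (verit) mult_nonneg_nonneg)
  show ?thesis by (simp add: no)
next
  case True
  define v where "v = t - \<epsilon>"
  have v: "0 \<le> v" "v < t" using True \<epsilon> by (auto simp: v_def)
  define G where "G a w = (if s * clock a \<le> v \<and> rescaled_below J r c a w then if 0 < a then \<psi> a else 0 else 0)" for a w
  note [measurable] = measurable_rescaled_below_past[OF v(1)]
  have G1: "(\<lambda>p. G (fst p) (snd p)) \<in> borel_measurable (borel \<Otimes>\<^sub>M past v)"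
    unfolding G_def by measurable
  then have G2: "(\<lambda>(a, w). G a w) \<in> borel_measurable (borel \<Otimes>\<^sub>M past v)"
    by (simp add: case_prod_beta)
  have "(\<lambda>p. (\<lambda>(a, w). G a w) (fst p, (\<lambda>w. w) (snd p))) \<in> borel_measurable (borel \<Otimes>\<^sub>M M)"
    by (rule measurable_compose[OF _ G2]) (use past_subalgebra in measurable)
  then have GM [measurable]: "(\<lambda>p. G (fst p) (snd p)) \<in> borel_measurable (borel \<Otimes>\<^sub>M M)"
    by (simp add: case_prod_beta)
  note [measurable] = measurable_X[OF v(1)]
  have "(\<integral>\<^sup>+w. (if s * clock (X t w) \<le> t - \<epsilon> then
        test J r c \<psi> (X t w) w else 0) \<partial>M)
      = (\<integral>\<^sup>+w. G (X t w) w \<partial>M)"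
    by (intro nn_integral_cong) (simp add: G_def v_def[symmetric])
  also have "\<dots> = (\<integral>\<^sup>+w. (\<integral>\<^sup>+a. ennreal (F (t - v) (a - X v w)) * G a w \<partial>lborel) \<partial>M)"
    by (rule markov_density[OF v G2])
  also have "\<dots> = (\<integral>\<^sup>+a. (\<integral>\<^sup>+w. ennreal (F (t - v) (a - X v w)) * G a w \<partial>M) \<partial>lborel)"
    by (rule Fubini_lborel[symmetric]) (simp add: case_prod_beta)
  also have "\<dots> = (\<integral>\<^sup>+a. (if s * clock a \<le> t - \<epsilon> then
        (\<integral>\<^sup>+w. ennreal (F (t - s * clock a) (a - X (s * clock a) w)) *
          test J r c \<psi> a w \<partial>M) else 0) \<partial>lborel)"
  proof (rule nn_integral_cong)
    fix a
    show "(\<integral>\<^sup>+w. ennreal (F (t - v) (a - X v w)) * G a w \<partial>M) = (if s * clock a \<le> t - \<epsilon> then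
        (\<integral>\<^sup>+w. ennreal (F (t - s * clock a) (a - X (s * clock a) w)) *
          test J r c \<psi> a w \<partial>M) else 0)"
    proof (cases "s * clock a \<le> v")
      case True
      let ?r = "s * clock a"
      have "(\<lambda>w. X (r j * clock a) w) \<in> borel_measurable (past ?r)" if "j \<in> J" for j
        using r[OF that] by (intro measurable_X_past mult_right_mono) auto
      then have "Measurable.pred (past ?r) (\<lambda>w. rescaled_below J r c a w)"
        unfolding rescaled_below_def rescaled_def using J
        by (intro pred_intros_finite borel_measurable_pred_less borel_measurable_times) auto
      then have "(\<lambda>w. if 0 < a \<and> rescaled_below J r c a w then \<psi> a else 0) \<in> borel_measurable (past ?r)"
        by measurable
      \<comment> \<open>With a fixed, \<open>?r\<close> is a constant time and the constraints
        belong to its past; the martingale property moves the density from v back to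
        \<open>?r\<close>.\<close>
      from nn_integral_past_density[OF this, of v t a] True v s
      have "(\<integral>\<^sup>+w. ennreal (F (t - v) (a - X v w)) * test J r c \<psi> a w \<partial>M)
        = (\<integral>\<^sup>+w. ennreal (F (t - ?r) (a - X ?r w)) * test J r c \<psi> a w \<partial>M)"
        by simp
      moreover have "G a w = test J r c \<psi> a w" for w
        using True by (simp add: G_def)
      ultimately show ?thesis using True by (simp add: v_def[symmetric])
    qed (simp add: G_def v_def)
  qed
  finally show ?thesis .
qed

lemma markov_rescaled:
  assumes \<psi> [measurable]: "\<psi> \<in> borel_measurable borel" and t: "0 < t"
  shows "(\<integral>\<^sup>+w. (if s * clock (X t w) < t then
        test J r c \<psi> (X t w) w else 0) \<partial>M)
    = (\<integral>\<^sup>+a. (\<integral>\<^sup>+w. ennreal (F (t - s * clock a) (a - X (s * clock a) w)) *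
          test J r c \<psi> a w \<partial>M) \<partial>lborel)"
proof -
  note [measurable] = measurable_X[OF less_imp_le[OF t]]
  define g where "g a = (\<integral>\<^sup>+w. ennreal (F (t - s * clock a) (a - X (s * clock a) w)) *
          test J r c \<psi> a w \<partial>M)" for a
  have "(\<lambda>p. ennreal (F (t - s * clock (fst p)) (fst p - X (s * clock (fst p)) (snd p))) *
          (if 0 < fst p \<and> rescaled_below J r c (fst p) (snd p) then \<psi> (fst p) else 0)) \<in> borel_measurable (borel \<Otimes>\<^sub>M M)"
    by measurable
  then have [measurable]: "g \<in> borel_measurable borel"
    unfolding g_def by (intro borel_measurable_nn_integral) (simp add: case_prod_beta)
  have "(\<integral>\<^sup>+w. (if s * clock (X t w) < t then
        test J r c \<psi> (X t w) w else 0) \<partial>M)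
      = (SUP n. \<integral>\<^sup>+w. (if s * clock (X t w) \<le> t - recip n then
        test J r c \<psi> (X t w) w else 0) \<partial>M)"
    by (rule SUP_nn_integral_less[symmetric]) measurable
  also have "\<dots> = (SUP n. \<integral>\<^sup>+a. (if s * clock a \<le> t - recip n then g a else 0) \<partial>lborel)"
    unfolding g_def by (subst markov_rescaled_gap[OF _ \<psi> t]) simp_all
  also have "\<dots> = (\<integral>\<^sup>+a. (if s * clock a < t then g a else 0) \<partial>lborel)"
    by (rule SUP_nn_integral_less) measurable
  \<comment> \<open>\<open>F\<close> vanishes at nonpositive times, so \<open>g\<close> already
    contains the condition \<open>s * clock a < t\<close>.\<close>
  also have "\<dots> = (\<integral>\<^sup>+a. g a \<partial>lborel)"
    by (intro nn_integral_cong) (auto simp: g_def F_def)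
  finally show ?thesis by (simp add: g_def)
qed

text \<open>Self-similarity with k = b / a turns k times the positions at the times
  \<open>i * clock a\<close> into the positions at the times i. Homogeneity replaces level a by
  level b at the price of \<open>\<gamma> a\<close>, so all dependence on a becomes a
  scalar.\<close>

lemma nn_integral_rescaled_eq:
  assumes a: "0 < a"
  shows "(\<integral>\<^sup>+w. (if rescaled_below J r c a w then U (a - X (s * clock a) w) else 0) \<partial>M)
    = ennreal (\<gamma> a) * (\<integral>\<^sup>+w. weight J r c s w \<partial>M)"
proof -
  define k where "k = b / a"
  have k: "0 < k" using a b by (simp add: k_def)
  have con: "r * clock a = r / k powr \<alpha>" for r
    using a b by (simp add: clock_def k_def powr_divide)
  define I where "I = insert s (r ` J)"
  have I: "finite I" "I \<subseteq> {0..}" using J r s by (auto simp: I_def)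
  define \<Phi> where "\<Phi> v = (if \<forall>j\<in>J. v (r j) < c j then U (b - v s) else 0)" for v :: "real \<Rightarrow> real"
  have [measurable]: "(\<lambda>v. v i) \<in> borel_measurable (PiM I (\<lambda>_. borel :: real measure))" if "i \<in> I" for i
    using that by (rule measurable_component_singleton)
  have "Measurable.pred (PiM I (\<lambda>_. borel)) (\<lambda>v. \<forall>j\<in>J. v (r j) < c j)"
    using J by (intro pred_intros_finite borel_measurable_pred_less) (auto simp: I_def)
  moreover have "(\<lambda>v. U (b - v s)) \<in> borel_measurable (PiM I (\<lambda>_. borel))"
    by measurable (simp add: I_def)
  ultimately have \<Phi>: "\<Phi> \<in> borel_measurable (PiM I (\<lambda>_. borel))"
    unfolding \<Phi>_def by measurable
  have rv1: "(\<lambda>w. \<lambda>i\<in>I. k * X (i / k powr \<alpha>) w) \<in> M \<rightarrow>\<^sub>M PiM I (\<lambda>_. borel)"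
    using I k by (intro measurable_restrict borel_measurable_times measurable_const measurable_X) auto
  have rv2: "(\<lambda>w. \<lambda>i\<in>I. X i w) \<in> M \<rightarrow>\<^sub>M PiM I (\<lambda>_. borel)"
    using I by (intro measurable_restrict measurable_X) auto
  have mS: "(\<lambda>w. if \<forall>j\<in>J. X (r j) w < c j then U (b - X s w) else 0) = (\<lambda>w. \<Phi> (\<lambda>i\<in>I. X i w))"
    by (auto simp: \<Phi>_def I_def)
  have "(\<integral>\<^sup>+w. (if rescaled_below J r c a w then U (a - X (s * clock a) w) else 0) \<partial>M)
     = (\<integral>\<^sup>+w. ennreal (\<gamma> a) * \<Phi> (\<lambda>i\<in>I. k * X (i / k powr \<alpha>) w) \<partial>M)"
  proof (rule nn_integral_cong)
    fix w
    have "U (a - X (s / k powr \<alpha>) w) = U (a / b * (b - k * X (s / k powr \<alpha>) w))"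
      using a b by (simp add: k_def right_diff_distrib)
    also have "\<dots> = ennreal (\<gamma> a) * U (b - k * X (s / k powr \<alpha>) w)"
      using a b by (intro U_scaled) simp
    finally have "U (a - X (s / k powr \<alpha>) w) = ennreal (\<gamma> a) * U (b - k * X (s / k powr \<alpha>) w)" .
    moreover have "rescaled_below J r c a w \<longleftrightarrow> (\<forall>j\<in>J. k * X (r j / k powr \<alpha>) w < c j)"
      unfolding rescaled_below_def rescaled_def con k_def[symmetric] ..
    ultimately show "(if rescaled_below J r c a w then U (a - X (s * clock a) w) else 0)
      = ennreal (\<gamma> a) * \<Phi> (\<lambda>i\<in>I. k * X (i / k powr \<alpha>) w)"
      by (simp add: \<Phi>_def I_def con)
  qed
  also have "\<dots> = ennreal (\<gamma> a) * (\<integral>\<^sup>+w. \<Phi> (\<lambda>i\<in>I. k * X (i / k powr \<alpha>) w) \<partial>M)"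
    by (rule nn_integral_cmult) (rule measurable_compose[OF rv1 \<Phi>])
  also have "(\<integral>\<^sup>+w. \<Phi> (\<lambda>i\<in>I. k * X (i / k powr \<alpha>) w) \<partial>M)
      = (\<integral>\<^sup>+v. \<Phi> v \<partial>distr M (PiM I (\<lambda>_. borel)) (\<lambda>w. \<lambda>i\<in>I. k * X (i / k powr \<alpha>) w))"
    by (rule nn_integral_distr[symmetric, OF rv1]) (simp add: \<Phi>)
  also have "\<dots> = (\<integral>\<^sup>+v. \<Phi> v \<partial>distr M (PiM I (\<lambda>_. borel)) (\<lambda>w. \<lambda>i\<in>I. X i w))"
    by (simp only: distr_scaled_finite[OF I k])
  also have "\<dots> = (\<integral>\<^sup>+w. \<Phi> (\<lambda>i\<in>I. X i w) \<partial>M)"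
    by (rule nn_integral_distr[OF rv2]) (simp add: \<Phi>)
  finally show ?thesis unfolding mS .
qed

text \<open>The product form arises here: once t is integrated out, the terminal position a enters
  through the potential density and the constraint times alone, and scaling reduces both to the
  scalar \<open>\<gamma> a\<close>.\<close>

lemma occupation_rescaled:
  assumes \<psi> [measurable]: "\<psi> \<in> borel_measurable borel"
  shows "(\<integral>\<^sup>+t. (\<integral>\<^sup>+w. (if 0 < t \<and> s * clock (X t w) < t \<and> 0 < X t w \<and> rescaled_below J r c (X t w) w
        then \<psi> (X t w) else 0) \<partial>M) \<partial>lborel)
    = (\<integral>\<^sup>+a. (if 0 < a then \<psi> a * ennreal (\<gamma> a) else 0) \<partial>lborel) *
      (\<integral>\<^sup>+w. weight J r c s w \<partial>M)"
proof -
  define R where "R = (\<integral>\<^sup>+w. weight J r c s w \<partial>M)"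
  define h where "h t a w = ennreal (F (t - s * clock a) (a - X (s * clock a) w)) *
          test J r c \<psi> a w" for t a w
  have h: "(\<lambda>q. h (fst q) (fst (snd q)) (snd (snd q))) \<in> borel_measurable (borel \<Otimes>\<^sub>M (borel \<Otimes>\<^sub>M M))"
    unfolding h_def by measurable
  have h3: "(\<lambda>q. h (fst (fst q)) (snd (fst q)) (snd q)) \<in> borel_measurable ((borel \<Otimes>\<^sub>M borel) \<Otimes>\<^sub>M M)"
    using measurable_compose[OF _ h, of "\<lambda>q. (fst (fst q), snd (fst q), snd q)"] by simp
  have h2: "(\<lambda>p. \<integral>\<^sup>+w. h (fst p) (snd p) w \<partial>M) \<in> borel_measurable (borel \<Otimes>\<^sub>M borel)"
    by (rule borel_measurable_nn_integral) (use h3 in \<open>simp add: case_prod_beta\<close>)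
  have ha: "(\<lambda>(t, w). h t a w) \<in> borel_measurable (borel \<Otimes>\<^sub>M M)" for a
    using measurable_compose[OF _ h, of "\<lambda>q. (fst q, a, snd q)"] by (simp add: case_prod_beta)
  have "(\<integral>\<^sup>+t. (\<integral>\<^sup>+w. (if 0 < t \<and> s * clock (X t w) < t \<and> 0 < X t w \<and> rescaled_below J r c (X t w) w
        then \<psi> (X t w) else 0) \<partial>M) \<partial>lborel)
      = (\<integral>\<^sup>+t. (\<integral>\<^sup>+a. (\<integral>\<^sup>+w. h t a w \<partial>M) \<partial>lborel) \<partial>lborel)"
  proof (rule nn_integral_cong)
    fix t
    show "(\<integral>\<^sup>+w. (if 0 < t \<and> s * clock (X t w) < t \<and> 0 < X t w \<and> rescaled_below J r c (X t w) w
        then \<psi> (X t w) else 0) \<partial>M) = (\<integral>\<^sup>+a. (\<integral>\<^sup>+w. h t a w \<partial>M) \<partial>lborel)"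
    proof (cases "0 < t")
      case True
      then have "(if 0 < t \<and> s * clock (X t w) < t \<and> 0 < X t w \<and> rescaled_below J r c (X t w) w
          then \<psi> (X t w) else 0) = (if s * clock (X t w) < t then
        test J r c \<psi> (X t w) w else 0)" for w
        by simp
      then show ?thesis
        by (simp only: markov_rescaled[OF \<psi> True] h_def)
    next
      case False
      have "F (t - s * clock a) x = 0" for a x
      proof -
        have "0 \<le> s * clock a" using s by simp
        with False have "\<not> 0 < t - s * clock a" by linarith
        then show ?thesis by (simp only: F_def if_False)
      qed
      with False show ?thesis by (simp add: h_def)
    qed
  qed
  also have "\<dots> = (\<integral>\<^sup>+a. (\<integral>\<^sup>+t. (\<integral>\<^sup>+w. h t a w \<partial>M) \<partial>lborel) \<partial>lborel)"
    by (rule lborel_pair.Fubini'[symmetric]) (use h2 in \<open>simp add: case_prod_beta\<close>)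
  also have "\<dots> = (\<integral>\<^sup>+a. (if 0 < a then \<psi> a * ennreal (\<gamma> a) else 0) * R \<partial>lborel)"
  proof (rule nn_integral_cong)
    fix a
    have "(\<integral>\<^sup>+t. (\<integral>\<^sup>+w. h t a w \<partial>M) \<partial>lborel) = (\<integral>\<^sup>+w. (\<integral>\<^sup>+t. h t a w \<partial>lborel) \<partial>M)"
      using ha[of a] by (rule Fubini_lborel)
    also have "\<dots> = (\<integral>\<^sup>+w. U (a - X (s * clock a) w) * test J r c \<psi> a w \<partial>M)"
    proof (rule nn_integral_cong)
      fix w
      let ?x = "a - X (s * clock a) w"
      have "(\<integral>\<^sup>+t. h t a w \<partial>lborel) = (\<integral>\<^sup>+t. ennreal (F (t - s * clock a) ?x) \<partial>lborel) *
          test J r c \<psi> a w"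
        unfolding h_def by (rule nn_integral_multc) measurable
      \<comment> \<open>Translating time by \<open>s * clock a\<close> removes the starting time of
        the density; the total over all durations is the potential density.\<close>
      also have "(\<integral>\<^sup>+t. ennreal (F (t - s * clock a) ?x) \<partial>lborel) = U ?x"
        using nn_integral_real_affine[of "\<lambda>t. ennreal (F (t - s * clock a) ?x)" 1 "s * clock a"]
        by (simp add: U_def)
      finally show "(\<integral>\<^sup>+t. h t a w \<partial>lborel) = U ?x * test J r c \<psi> a w" .
    qed
    also have "\<dots> = (if 0 < a then \<psi> a * ennreal (\<gamma> a) else 0) * R"
    proof (cases "0 < a")
      case True
      have m: "(\<lambda>w. if rescaled_below J r c a w then U (a - X (s * clock a) w) else 0) \<in> borel_measurable M"
        by measurable
      have "(\<integral>\<^sup>+w. U (a - X (s * clock a) w) * test J r c \<psi> a w \<partial>M)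
        = (\<integral>\<^sup>+w. \<psi> a * (if rescaled_below J r c a w then U (a - X (s * clock a) w) else 0) \<partial>M)"
      proof (rule nn_integral_cong)
        fix w
        show "U (a - X (s * clock a) w) * test J r c \<psi> a w
          = \<psi> a * (if rescaled_below J r c a w then U (a - X (s * clock a) w) else 0)"
          by (cases "rescaled_below J r c a w") (simp_all only: True simp_thms if_True if_False mult_zero_right mult_zero_left mult.commute)
      qed
      also have "\<dots> = \<psi> a * (\<integral>\<^sup>+w. (if rescaled_below J r c a w then U (a - X (s * clock a) w) else 0) \<partial>M)"
        using m by (rule nn_integral_cmult)
      also have "\<dots> = \<psi> a * (ennreal (\<gamma> a) * R)"
        unfolding R_def by (simp only: nn_integral_rescaled_eq[OF True])
      finally show ?thesis using True by (simp add: mult.assoc)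
    qed simp
    finally show "(\<integral>\<^sup>+t. (\<integral>\<^sup>+w. h t a w \<partial>M) \<partial>lborel)
      = (if 0 < a then \<psi> a * ennreal (\<gamma> a) else 0) * R" .
  qed
  also have "\<dots> = (\<integral>\<^sup>+a. (if 0 < a then \<psi> a * ennreal (\<gamma> a) else 0) \<partial>lborel) * R"
    by (rule nn_integral_multc) measurable
  finally show ?thesis by (simp add: R_def)
qed

section \<open>Times from which the level is crossed within a short window\<close>

lemma measurable_hit [measurable]: "Measurable.pred (borel \<Otimes>\<^sub>M M) (\<lambda>(t, w). hit J r c s t w)"
  unfolding hit_def by measurable

lemma nn_integral_hit_crossing:
  assumes \<delta>: "0 < \<delta>" and t: "0 < t"
  shows "(\<integral>\<^sup>+w. (if jumps J r c s \<delta> t w then 1 else 0) \<partial>M)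
    = (\<integral>\<^sup>+w. (if hit J r c s t w then crossing \<delta> (X t w) else 0) \<partial>M)"
proof -
  have t0: "0 \<le> t" using t by simp
  note [measurable] = measurable_X_past[OF t0 order_refl] measurable_rescaled_below_past[OF t0]
  define G :: "real \<Rightarrow> path \<Rightarrow> ennreal" where
    "G a w = (if hit J r c s t w \<and> X t w < b \<and> b \<le> a then 1 else 0)" for a w
  have "Measurable.pred (past t) (\<lambda>w. (\<lambda>p. s * clock (fst p) \<le> t \<and> rescaled_below J r c (fst p) (snd p)) (X t w, w))"
    by measurable
  then have [measurable]: "Measurable.pred (past t) (\<lambda>w. s * clock (X t w) \<le> t \<and> rescaled_below J r c (X t w) w)"
    by simp
  \<comment> \<open>The weak inequality, although implied by the strict one, is kept next to the
    constraints because only their conjunction is known to be measurable with respect to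
    \<open>past t\<close>.\<close>
  have "Measurable.pred (past t) (\<lambda>w. (s * clock (X t w) \<le> t \<and> rescaled_below J r c (X t w) w) \<and>
      s * clock (X t w) < t \<and> 0 < X t w)"
    by measurable
  also have "(\<lambda>w. (s * clock (X t w) \<le> t \<and> rescaled_below J r c (X t w) w) \<and>
      s * clock (X t w) < t \<and> 0 < X t w) = hit J r c s t"
    using t by (auto simp: hit_def fun_eq_iff)
  finally have [measurable]: "Measurable.pred (past t) (hit J r c s t)" .
  have "(\<lambda>p. G (fst p) (snd p)) \<in> borel_measurable (borel \<Otimes>\<^sub>M past t)"
    unfolding G_def by measurable
  then have G: "(\<lambda>(a, w). G a w) \<in> borel_measurable (borel \<Otimes>\<^sub>M past t)"
    by (simp add: case_prod_beta)
  have "(\<integral>\<^sup>+w. G (X (t + \<delta>) w) w \<partial>M)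
    = (\<integral>\<^sup>+w. (\<integral>\<^sup>+a. ennreal (F (t + \<delta> - t) (a - X t w)) * G a w \<partial>lborel) \<partial>M)"
    by (rule markov_density[OF t0 _ G]) (use \<delta> in simp)
  also have "\<dots> = (\<integral>\<^sup>+w. (if hit J r c s t w then crossing \<delta> (X t w) else 0) \<partial>M)"
  proof (rule nn_integral_cong)
    fix w
    show "(\<integral>\<^sup>+a. ennreal (F (t + \<delta> - t) (a - X t w)) * G a w \<partial>lborel) = (if hit J r c s t w then crossing \<delta> (X t w) else 0)"
    proof (cases "hit J r c s t w \<and> X t w < b")
      case True
      then have "ennreal (F (t + \<delta> - t) (a - X t w)) * G a w = (if b \<le> a then ennreal (F \<delta> (a - X t w)) else 0)" for a
        by (simp add: G_def)
      with True show ?thesis by (simp only: crossing_def if_True)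
    next
      case False
      then have "G a w = 0" for a by (auto simp: G_def)
      with False show ?thesis by (auto simp: crossing_def)
    qed
  qed
  finally show ?thesis by (simp add: G_def)
qed

lemma measurable_crossing_time:
  "(\<lambda>(t, w). if jumps J r c s \<delta> t w then 1 else 0 :: ennreal) \<in> borel_measurable (borel \<Otimes>\<^sub>M M)"
  by measurable

text \<open>The occupation formula with \<open>crossing \<delta>\<close> as test function: the first
  factor sees the window only, the second the constraints only.\<close>

lemma nn_integral_crossing_time:
  assumes \<delta>: "0 < \<delta>"
  shows "(\<integral>\<^sup>+w. (\<integral>\<^sup>+t. (if jumps J r c s \<delta> t w then 1 else 0) \<partial>lborel) \<partial>M)
    = (\<integral>\<^sup>+a. (if 0 < a then crossing \<delta> a * ennreal (\<gamma> a) else 0) \<partial>lborel) *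
      (\<integral>\<^sup>+w. weight J r c s w \<partial>M)"
proof -
  have "(\<integral>\<^sup>+w. (\<integral>\<^sup>+t. (if jumps J r c s \<delta> t w then 1 else 0) \<partial>lborel) \<partial>M)
    = (\<integral>\<^sup>+t. (\<integral>\<^sup>+w. (if jumps J r c s \<delta> t w then 1 else 0) \<partial>M) \<partial>lborel)"
    using measurable_crossing_time by (rule Fubini_lborel[symmetric])
  also have "\<dots> = (\<integral>\<^sup>+t. (\<integral>\<^sup>+w. (if hit J r c s t w then crossing \<delta> (X t w) else 0) \<partial>M) \<partial>lborel)"
  proof (rule nn_integral_cong)
    fix t
    show "(\<integral>\<^sup>+w. (if jumps J r c s \<delta> t w then 1 else 0) \<partial>M)
      = (\<integral>\<^sup>+w. (if hit J r c s t w then crossing \<delta> (X t w) else 0) \<partial>M)"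
    proof (cases "0 < t")
      case True
      show ?thesis by (rule nn_integral_hit_crossing[OF \<delta> True])
    qed (simp add: hit_def)
  qed
  also have "\<dots> = (\<integral>\<^sup>+a. (if 0 < a then crossing \<delta> a * ennreal (\<gamma> a) else 0) \<partial>lborel) *
      (\<integral>\<^sup>+w. weight J r c s w \<partial>M)"
    unfolding hit_def by (rule occupation_rescaled) measurable
  finally show ?thesis .
qed

end

end

section \<open>Behaviour near the last passage time\<close>

context subordinator
begin

text \<open>On such paths the study of the last passage time is deterministic. Unboundedness makes
  that time finite, and strict increase makes the undershoot exceed every earlier value.\<close>

definition good :: "path \<Rightarrow> bool" where
  "good w \<longleftrightarrow> w \<in> space skorohod \<and> (\<forall>t\<ge>0. w t \<noteq> None) \<and> X 0 w = 0 \<and>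
    (\<forall>s t. 0 \<le> s \<and> s < t \<longrightarrow> X s w < X t w) \<and> (\<forall>K. \<exists>t\<ge>0. K \<le> X t w)"

text \<open>The increment has the law of X at time t - s, which has a density and hence no atom at
  0.\<close>

lemma AE_increment_nonzero:
  assumes "0 \<le> s" "s < t" shows "AE w in M. X s w \<noteq> X t w"
proof -
  have u: "0 < t - s" using assms by simp
  have "(\<integral>\<^sup>+w. indicator {0} (X (t - s) w) \<partial>M) = (\<integral>\<^sup>+a. ennreal (f (t - s) a) * indicator {0} a \<partial>lborel)"
    by (rule nn_integral_X[OF u]) simp
  also have "\<dots> = (\<integral>\<^sup>+(a::real). 0 \<partial>lborel)"
  proof (rule nn_integral_cong_AE)
    show "AE a in lborel. ennreal (f (t - s) a) * indicator {0} a = 0"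
      using AE_lborel_singleton[of "0::real"] by eventually_elim simp
  qed
  finally have "(\<integral>\<^sup>+w. indicator {0::real} (X (t - s) w) \<partial>M) = 0" by simp
  then have "AE w in M. indicator {0::real} (X (t - s) w) = (0::ennreal)"
    using u by (subst nn_integral_0_iff_AE[symmetric]) auto
  then have "AE w in M. X (t - s) w \<noteq> 0" by eventually_elim (auto simp: indicator_def)
  then have "AE x in distr M borel (X (t - s)). x \<noteq> 0" using u by (subst AE_distr_iff) auto
  then have "AE x in distr M borel (\<lambda>w. X t w - X s w). x \<noteq> 0"
    by (simp only: distr_increment[OF assms(1) less_imp_le[OF assms(2)]])
  then have "AE w in M. X t w - X s w \<noteq> 0" using assms by (subst (asm) AE_distr_iff) auto
  then show ?thesis by eventually_elim auto
qed

text \<open>Two rationals between s and t reduce strictness to countably many pairs, since the path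
  is already known to be nondecreasing.\<close>

lemma AE_strict_mono: "AE w in M. \<forall>s t. 0 \<le> s \<and> s < t \<longrightarrow> X s w < X t w"
proof -
  have "AE w in M. \<forall>p\<in>{p\<in>\<rat>. 0 \<le> p}. \<forall>q\<in>{q\<in>\<rat>. p < q}. X p w \<noteq> X q w"
    by (intro AE_ball_countable'[OF AE_ball_countable'] AE_increment_nonzero)
       (auto intro: countable_subset[OF _ countable_rat])
  with mono_X show ?thesis
  proof eventually_elim
    case (elim w)
    show ?case
    proof (intro allI impI)
      fix s t :: real assume st: "0 \<le> s \<and> s < t"
      then obtain p where p: "p \<in> \<rat>" "s < p" "p < t" using Rats_dense_in_real[of s t] by auto
      then obtain q where q: "q \<in> \<rat>" "p < q" "q < t" using Rats_dense_in_real[of p t] by auto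
      have "X s w \<le> X p w" "X p w \<le> X q w" "X q w \<le> X t w" using elim(1) st p q by auto
      moreover have "X p w \<noteq> X q w" using elim(2) st p q by auto
      ultimately show "X s w < X t w" by simp
    qed
  qed
qed

lemma AE_unbounded: "AE w in M. \<forall>K. \<exists>t\<ge>0. K \<le> X t w"
proof -
  have "AE w in M. \<exists>n::nat. real k \<le> X (real n) w" for k :: nat
  proof -
    let ?B = "{w \<in> space M. \<forall>n::nat. X (real n) w < real k}"
    have B: "?B \<in> events" by measurable
    \<comment> \<open>Exponential Markov inequality with q = 1: the path below k at time n has exp
      (k - X_n) at least 1, and the Laplace transform decays geometrically in n.\<close>
    have "prob ?B \<le> exp (real k) * exp (- C) ^ n" for n
    proof -
      have int: "integrable M (\<lambda>w. exp (- 1 * X (real n) w))"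
      proof (rule integrable_const_bound[where B = 1])
        show "AE w in M. norm (exp (- 1 * X (real n) w)) \<le> 1"
          using nonneg_X by eventually_elim simp
      qed measurable
      have "prob ?B \<le> (\<integral>w. exp (real k) * exp (- 1 * X (real n) w) \<partial>M)"
      proof -
        have "prob ?B = (\<integral>w. indicator ?B w \<partial>M)" using B by simp
        also have "\<dots> \<le> (\<integral>w. exp (real k) * exp (- 1 * X (real n) w) \<partial>M)"
        proof (rule integral_mono)
          show "integrable M (indicator ?B :: _ \<Rightarrow> real)"
            using B by (intro integrable_real_indicator) (auto simp: emeasure_eq_measure)
          show "integrable M (\<lambda>w. exp (real k) * exp (- 1 * X (real n) w))" using int by simp
          fix w assume "w \<in> space M"
          show "indicator ?B w \<le> exp (real k) * exp (- 1 * X (real n) w)"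
          proof (cases "w \<in> ?B")
            case True
            then have "0 \<le> real k - X (real n) w" by (auto intro: less_imp_le)
            then show ?thesis using True by (simp add: exp_add[symmetric])
          qed simp
        qed
        finally show ?thesis .
      qed
      also have "\<dots> = exp (real k) * exp (- C) ^ n"
        using Laplace_X[of "real n" 1] int by (simp add: exp_of_nat_mult[symmetric])
      finally show ?thesis .
    qed
    moreover have "(\<lambda>n. exp (real k) * exp (- C) ^ n) \<longlonglongrightarrow> exp (real k) * 0"
      using C by (intro tendsto_intros LIMSEQ_power_zero) simp
    ultimately have "prob ?B \<le> exp (real k) * 0"
      by (intro LIMSEQ_le_const[of "\<lambda>n. exp (real k) * exp (- C) ^ n"]) blast+
    then have "prob ?B = 0" by (simp add: measure_le_0_iff)
    then have "AE w in M. w \<notin> ?B" using B by (simp add: prob_eq_0)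
    with AE_space show ?thesis by eventually_elim (auto simp: not_less)
  qed
  then have "AE w in M. \<forall>k::nat. \<exists>n::nat. real k \<le> X (real n) w" by (simp add: AE_all_countable)
  then show ?thesis
  proof eventually_elim
    case (elim w)
    show ?case
    proof
      fix K :: real
      obtain k :: nat where "K \<le> real k" using real_arch_simple by blast
      with elim obtain n where "K \<le> X (real n) w" by (meson order_trans)
      then show "\<exists>t\<ge>0. K \<le> X t w" by (intro exI[of _ "real n"]) auto
    qed
  qed
qed

lemma AE_good: "AE w in M. good w"
  using AE_space alive X_zero AE_strict_mono AE_unbounded
  by eventually_elim (simp add: good_def space_M)

section \<open>Last passage time and undershoot of a good path\<close>

definition L :: "path \<Rightarrow> real" where "L w = real_of_ereal (last_time b w)"

definition g :: "path \<Rightarrow> real" where "g w = pre_last_value b w"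

lemma good_mono: "good w \<Longrightarrow> 0 \<le> s \<Longrightarrow> s \<le> t \<Longrightarrow> X s w \<le> X t w"
  by (cases "s = t") (auto simp: good_def intro: less_imp_le)

lemma good_strict: "good w \<Longrightarrow> 0 \<le> s \<Longrightarrow> s < t \<Longrightarrow> X s w < X t w"
  by (auto simp: good_def)

lemma good_nonneg: "good w \<Longrightarrow> 0 \<le> t \<Longrightarrow> 0 \<le> X t w"
  using good_mono[of w 0 t] by (simp add: good_def)

lemma good_right_continuous: "good w \<Longrightarrow> 0 \<le> t \<Longrightarrow> ((\<lambda>u. X u w) \<longlongrightarrow> X t w) (at_right t)"
  unfolding X_def good_def by (intro tendsto_at_right_the) auto

text \<open>The times at which the path is below b form an interval containing 0 and bounded by
  unboundedness of the path. By right continuity it has no largest element, so it is half-open and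
  ends at L.\<close>

lemma good_last_time:
  assumes w: "good w"
  shows last_time_eq: "last_time b w = ereal (L w)" and L_pos: "0 < L w"
    and below_b_iff: "\<And>t. 0 \<le> t \<Longrightarrow> X t w < b \<longleftrightarrow> t < L w"
proof -
  define S where "S = {t. 0 \<le> t \<and> X t w < b}"
  obtain K where K: "0 \<le> K" "b \<le> X K w" using w unfolding good_def by blast
  have S_le: "t \<le> K" if "t \<in> S" for t
    using that K good_mono[OF w, of K t] by (auto simp: S_def not_less[symmetric])
  have bdd: "bdd_above S" using S_le by (auto simp: bdd_above_def)
  have zero: "0 \<in> S" using w b by (simp add: S_def good_def)
  have set_eq: "{t. 0 \<le> t \<and> (\<exists>x. w t = Some x \<and> x < b)} = S"
    using w by (auto simp: S_def X_def good_def)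
  have "last_time b w = ereal (Sup S)"
    unfolding last_time_def set_eq
  proof (rule Sup_eqI)
    fix y assume "y \<in> ereal ` S"
    then show "y \<le> ereal (Sup S)" using bdd by (auto intro: cSup_upper)
  next
    fix y assume y: "\<And>z. z \<in> ereal ` S \<Longrightarrow> z \<le> y"
    show "ereal (Sup S) \<le> y"
    proof (cases y)
      case (real r)
      then have "x \<le> r" if "x \<in> S" for x using y[of "ereal x"] that by simp
      then have "Sup S \<le> r" using zero by (intro cSup_least) auto
      then show ?thesis using real by simp
    next
      case MInf
      then show ?thesis using y[of "ereal 0"] zero by auto
    qed simp
  qed
  then have L: "L w = Sup S" and last: "last_time b w = ereal (L w)" by (auto simp: L_def)
  show "last_time b w = ereal (L w)" by (rule last)
  have open_S: "\<exists>u\<in>S. t < u" if "t \<in> S" for t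
  proof -
    have t: "0 \<le> t" "X t w < b" using that by (auto simp: S_def)
    have "\<forall>\<^sub>F u in at_right t. X u w < b"
      by (rule order_tendstoD(2)[OF good_right_continuous[OF w t(1)] t(2)])
    then have "\<forall>\<^sub>F u in at_right t. X u w < b \<and> t < u"
      using eventually_at_right_less by (rule eventually_conj)
    then obtain u where "X u w < b" "t < u"
      using eventually_happens'[of "at_right t"] by auto
    then show ?thesis using t by (intro bexI[of _ u]) (auto simp: S_def)
  qed
  have lt: "t < L w" if "t \<in> S" for t
    using open_S[OF that] bdd by (auto simp: L intro: less_le_trans cSup_upper)
  show "0 < L w" by (rule lt[OF zero])
  fix t :: real assume t: "0 \<le> t"
  show "X t w < b \<longleftrightarrow> t < L w"
  proof
    assume "X t w < b" then show "t < L w" using t by (intro lt) (simp add: S_def)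
  next
    assume "t < L w"
    then obtain u where u: "u \<in> S" "t < u" using less_cSupE[of t S] zero unfolding L by auto
    then have "X t w < X u w" using w t by (intro good_strict) auto
    then show "X t w < b" using u by (simp add: S_def)
  qed
qed

lemma eventually_at_left_L:
  assumes "good w" "t < L w" shows "\<forall>\<^sub>F u in at_left (L w). t < u \<and> 0 < u \<and> u < L w"
proof -
  have "\<forall>\<^sub>F u in at_left (L w). u \<in> {max 0 t<..<L w}"
    by (rule eventually_at_leftI[of "max 0 t"]) (use assms L_pos in auto)
  then show ?thesis by eventually_elim auto
qed

text \<open>The undershoot is a left limit, so it is at most b and, by strict increase, larger than
  every value before L. The strictness later keeps Y strictly below b.\<close>

lemma good_undershoot:
  assumes w: "good w"
  shows tendsto_g: "((\<lambda>u. X u w) \<longlongrightarrow> g w) (at_left (L w))" and g_pos: "0 < g w" and g_le_b: "g w \<le> b"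
    and X_less_g: "\<And>t. 0 \<le> t \<Longrightarrow> t < L w \<Longrightarrow> X t w < g w"
proof -
  have "limitin state_topology w (left_limit w (L w)) (at_left (L w))"
    using w L_pos[OF w] by (intro limitin_left_limit) (auto simp: good_def)
  then show lim: "((\<lambda>u. X u w) \<longlongrightarrow> g w) (at_left (L w))"
    unfolding X_def g_def pre_last_value_def L_def by (rule limitin_imp_tendsto_the)
  show less: "X t w < g w" if t: "0 \<le> t" "t < L w" for t
  proof -
    \<comment> \<open>The value at the midpoint stays below the limit, and strict increase from t to
      the midpoint makes the inequality strict.\<close>
    define v where "v = (t + L w) / 2"
    have v: "t < v" "v < L w" using t by (auto simp: v_def)
    have "\<forall>\<^sub>F u in at_left (L w). X v w \<le> X u w"
      using eventually_at_left_L[OF w v(2)]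
      by eventually_elim (use w v t in \<open>auto intro: good_mono\<close>)
    then have "X v w \<le> g w" by (rule tendsto_lowerbound[OF lim]) simp
    with good_strict[OF w t(1) v(1)] show ?thesis by simp
  qed
  show "0 < g w" using less[of 0] L_pos[OF w] w by (simp add: good_def)
  have "\<forall>\<^sub>F u in at_left (L w). X u w \<le> b"
    using eventually_at_left_L[OF w L_pos[OF w]]
    by eventually_elim (use below_b_iff[OF w] in \<open>auto intro: less_imp_le\<close>)
  then show "g w \<le> b" by (rule tendsto_upperbound[OF lim]) simp
qed

lemma good_well_defined: "good w \<Longrightarrow> well_defined_at b w"
  using last_time_eq g_pos by (simp add: well_defined_at_def g_def)

lemma good_rescaled_path:
  assumes w: "good w" and r: "0 \<le> r"
  shows "rescaled_path \<alpha> b w r =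
    (if r * clock (g w) < L w then Some (rescaled (g w) r w) else None)"
proof -
  have "w (r * clock (g w)) \<noteq> None" using w r by (simp add: good_def)
  then have "w (r * clock (g w)) = Some (X (r * clock (g w)) w)" by (simp add: X_def)
  then show ?thesis
    using r good_well_defined[OF w] last_time_eq[OF w]
    by (simp add: rescaled_path_def Let_def g_def[symmetric] clock_def[symmetric] rescaled_def)
qed

text \<open>For constraint times in [0, s] on a good path, this says that Y is alive at s and
  satisfies the constraints.\<close>

definition target :: "real set \<Rightarrow> (real \<Rightarrow> real) \<Rightarrow> (real \<Rightarrow> real) \<Rightarrow> real \<Rightarrow> path \<Rightarrow> bool" where
  "target J r c s w \<longleftrightarrow> s * clock (g w) < L w \<and> (\<forall>j\<in>J. rescaled (g w) (r j) w < c j)"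

lemma clock_mono: "0 < x \<Longrightarrow> x \<le> y \<Longrightarrow> clock x \<le> clock y"
  unfolding clock_def using \<alpha> b by (intro powr_mono2) (auto simp: divide_right_mono)

lemma clock_pos: "0 < x \<Longrightarrow> 0 < clock x"
  using b by (simp add: clock_def)

lemma tendsto_clock_g:
  "good w \<Longrightarrow> ((\<lambda>u. clock (X u w)) \<longlongrightarrow> clock (g w)) (at_left (L w))"
  unfolding clock_def using g_pos[of w] b by (intro tendsto_intros tendsto_g) auto

text \<open>As t increases to L, X_t approaches the undershoot from below, so the inspected times
  stay to the left of their limits and monotonicity bounds the inspected values. Only the factor b /
  X_t has to converge, and jumps of X at the inspected times do no harm.\<close>

lemma eventually_hit:
  assumes w: "good w" and J: "finite J" and r: "\<And>j. j \<in> J \<Longrightarrow> 0 \<le> r j" and s: "0 \<le> s"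
    and target: "target J r c s w"
  shows "\<forall>\<^sub>F t in at_left (L w). hit J r c s t w"
proof -
  note lim = tendsto_g[OF w] and g = g_pos[OF w]
  have "\<forall>\<^sub>F t in at_left (L w). s * clock (g w) < t \<and> 0 < t \<and> t < L w"
    using target by (intro eventually_at_left_L w) (simp add: target_def)
  moreover have "\<forall>\<^sub>F t in at_left (L w). \<forall>j\<in>J. b / X t w * X (r j * clock (g w)) w < c j"
  proof (intro eventually_ball_finite[OF J] ballI)
    fix j assume j: "j \<in> J"
    have "((\<lambda>t. b / X t w * X (r j * clock (g w)) w) \<longlongrightarrow> b / g w * X (r j * clock (g w)) w) (at_left (L w))"
      using g by (intro tendsto_intros lim) simp
    then show "\<forall>\<^sub>F t in at_left (L w). b / X t w * X (r j * clock (g w)) w < c j"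
      by (rule order_tendstoD(2)) (use target j in \<open>auto simp: target_def rescaled_def\<close>)
  qed
  ultimately show ?thesis
  proof eventually_elim
    case (elim t)
    have X: "0 < X t w" "X t w < g w"
      using good_strict[OF w, of 0 t] X_less_g[OF w, of t] elim w by (auto simp: good_def)
    then have con: "clock (X t w) \<le> clock (g w)" by (intro clock_mono) auto
    have "s * clock (X t w) \<le> s * clock (g w)" using con s by (intro mult_left_mono)
    moreover have "rescaled (X t w) (r j) w < c j" if j: "j \<in> J" for j
    proof -
      have "X (r j * clock (X t w)) w \<le> X (r j * clock (g w)) w"
        using r[OF j] con by (intro good_mono w mult_left_mono) auto
      then have "rescaled (X t w) (r j) w \<le> b / X t w * X (r j * clock (g w)) w"
        unfolding rescaled_def using X b by (intro mult_left_mono) auto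
      with elim j show ?thesis by force
    qed
    ultimately show ?case using elim X by (simp add: hit_def rescaled_below_def)
  qed
qed

text \<open>For a violated constraint, times approached from the left could miss a jump. The
  strictly larger \<open>r' j\<close> makes the inspected time eventually pass its limit for
  \<open>r j\<close>, and the factor b / X_t exceeds b / g, so the violation persists. If Y is dead
  at s, the larger \<open>s'\<close> eventually pushes the clock beyond L.\<close>

lemma eventually_not_hit:
  assumes w: "good w" and J: "finite J" and r: "\<And>j. j \<in> J \<Longrightarrow> 0 \<le> r j" "\<And>j. j \<in> J \<Longrightarrow> r j < r' j"
    and c: "\<And>j. j \<in> J \<Longrightarrow> c' j < c j" and s: "0 \<le> s" "s < s'"
    and target: "\<not> target J r c s w"
  shows "\<forall>\<^sub>F t in at_left (L w). \<not> hit J r' c' s' t w"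
proof -
  note lim = tendsto_clock_g[OF w] and g = g_pos[OF w]
  note cg = clock_pos[OF g]
  show ?thesis
  proof (cases "s * clock (g w) < L w")
    case False
    then have "L w < s' * clock (g w)" using s cg by (smt (verit) mult_strict_right_mono)
    moreover have "((\<lambda>t. s' * clock (X t w)) \<longlongrightarrow> s' * clock (g w)) (at_left (L w))"
      by (intro tendsto_intros lim)
    ultimately have "\<forall>\<^sub>F t in at_left (L w). L w < s' * clock (X t w)" by (intro order_tendstoD(1))
    with eventually_at_left_L[OF w L_pos[OF w]] show ?thesis
      by eventually_elim (auto simp: hit_def)
  next
    case True
    with target obtain j where j: "j \<in> J" "c j \<le> rescaled (g w) (r j) w"
      by (auto simp: target_def not_less)
    have "((\<lambda>t. r' j * clock (X t w)) \<longlongrightarrow> r' j * clock (g w)) (at_left (L w))"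
      by (intro tendsto_intros lim)
    moreover have "r j * clock (g w) < r' j * clock (g w)"
      using r(2)[OF j(1)] cg by simp
    ultimately have "\<forall>\<^sub>F t in at_left (L w). r j * clock (g w) < r' j * clock (X t w)"
      by (intro order_tendstoD(1))
    with eventually_at_left_L[OF w L_pos[OF w]] show ?thesis
    proof eventually_elim
      case (elim t)
      have X: "0 < X t w" "X t w < g w"
        using good_strict[OF w, of 0 t] X_less_g[OF w, of t] elim w by (auto simp: good_def)
      have "0 \<le> r j * clock (g w)" using r(1)[OF j(1)] cg by simp
      then have le: "X (r j * clock (g w)) w \<le> X (r' j * clock (X t w)) w"
        "0 \<le> X (r j * clock (g w)) w"
        using elim w by (auto intro: good_mono good_nonneg)
      have "c' j < c j" by (rule c[OF j(1)])
      also have "c j \<le> b / g w * X (r j * clock (g w)) w" using j by (simp add: rescaled_def)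
      also have "\<dots> \<le> b / X t w * X (r' j * clock (X t w)) w"
        using X b le g by (intro mult_mono divide_left_mono) auto
      finally have "\<not> rescaled (X t w) (r' j) w < c' j" by (simp add: rescaled_def)
      then show ?case using j by (auto simp: hit_def rescaled_below_def)
    qed
  qed
qed

text \<open>On a good path the level is crossed within the window exactly from the times t > 0 with
  L - 1 / (n + 1) <= t < L. So this is the mean of the indicator of \<open>hit\<close> over that
  interval, and it converges as soon as \<open>hit\<close> is constant near L.\<close>

definition average :: "real set \<Rightarrow> (real \<Rightarrow> real) \<Rightarrow> (real \<Rightarrow> real) \<Rightarrow> real \<Rightarrow> nat \<Rightarrow> path \<Rightarrow> ennreal" where
  "average J r c s n w = ennreal (real (Suc n)) *
    (\<integral>\<^sup>+t. (if jumps J r c s (recip n) t w then 1 else 0) \<partial>lborel)"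

lemma crossing_window:
  assumes w: "good w" and t: "0 < t" and \<delta>: "0 < \<delta>"
  shows "X t w < b \<and> b \<le> X (t + \<delta>) w \<longleftrightarrow> L w - \<delta> \<le> t \<and> t < L w"
  using below_b_iff[OF w, of t] below_b_iff[OF w, of "t + \<delta>"] t \<delta> by (auto simp: not_less)

lemma window_measure:
  "ennreal (real (Suc n)) * (\<integral>\<^sup>+t. indicator {x - recip n..<x} t \<partial>lborel) = 1"
  by (simp add: ennreal_mult[symmetric] del: of_nat_Suc)

lemma average_le_1:
  assumes w: "good w" shows "average J r c s n w \<le> 1"
proof -
  let ?\<delta> = "recip n"
  have "average J r c s n w \<le> ennreal (real (Suc n)) * (\<integral>\<^sup>+t. indicator {L w - ?\<delta>..<L w} t \<partial>lborel)"
    unfolding average_def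
  proof (intro mult_left_mono nn_integral_mono)
    fix t
    show "(if jumps J r c s ?\<delta> t w then 1 else 0) \<le> (indicator {L w - ?\<delta>..<L w} t :: ennreal)"
      using crossing_window[OF w, of t ?\<delta>] by (auto simp: hit_def simp del: of_nat_Suc)
  qed simp
  then show ?thesis by (simp only: window_measure)
qed

lemma tendsto_average_1:
  assumes w: "good w" and hit: "\<forall>\<^sub>F t in at_left (L w). hit J r c s t w"
  shows "(\<lambda>n. average J r c s n w) \<longlonglongrightarrow> 1"
proof -
  obtain l where l: "l < L w" "\<And>t. l < t \<Longrightarrow> t < L w \<Longrightarrow> hit J r c s t w"
    using hit by (auto simp: eventually_at_left_field)
  \<comment> \<open>The maximum with 0 places the whole window in positive times, as
    \<open>crossing_window\<close> requires.\<close>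
  have "\<forall>\<^sub>F n in sequentially. recip n < L w - max l 0"
    using l L_pos[OF w] by (intro order_tendstoD(2)[OF LIMSEQ_inverse_real_of_nat]) auto
  then have "\<forall>\<^sub>F n in sequentially. average J r c s n w = 1"
  proof eventually_elim
    case (elim n)
    let ?\<delta> = "recip n"
    have "(if jumps J r c s ?\<delta> t w then 1 else 0) = (indicator {L w - ?\<delta>..<L w} t :: ennreal)" for t
    proof (cases "t \<in> {L w - ?\<delta>..<L w}")
      case True
      then have t: "0 < t" "hit J r c s t w" using elim l(2)[of t] by (auto simp del: of_nat_Suc)
      then show ?thesis using crossing_window[OF w t(1), of ?\<delta>] True by (simp del: of_nat_Suc)
    next
      case False
      then show ?thesis using crossing_window[OF w, of t ?\<delta>] by (auto simp: hit_def simp del: of_nat_Suc)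
    qed
    then show ?case by (simp only: average_def window_measure)
  qed
  then show ?thesis by (rule tendsto_eventually)
qed

lemma tendsto_average_0:
  assumes w: "good w" and hit: "\<forall>\<^sub>F t in at_left (L w). \<not> hit J r c s t w"
  shows "(\<lambda>n. average J r c s n w) \<longlonglongrightarrow> 0"
proof -
  obtain l where l: "l < L w" "\<And>t. l < t \<Longrightarrow> t < L w \<Longrightarrow> \<not> hit J r c s t w"
    using hit by (auto simp: eventually_at_left_field)
  have "\<forall>\<^sub>F n in sequentially. recip n < L w - l"
    using l by (intro order_tendstoD(2)[OF LIMSEQ_inverse_real_of_nat]) auto
  then have "\<forall>\<^sub>F n in sequentially. average J r c s n w = 0"
  proof eventually_elim
    case (elim n)
    let ?\<delta> = "recip n"
    have no: "\<not> (jumps J r c s ?\<delta> t w)" for t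
    proof
      assume h: "jumps J r c s ?\<delta> t w"
      then have "0 < t" by (simp add: hit_def)
      with h have "L w - ?\<delta> \<le> t \<and> t < L w" using crossing_window[OF w, of t ?\<delta>] by (simp del: of_nat_Suc)
      then show False using h l(2)[of t] elim by (simp del: of_nat_Suc)
    qed
    show ?case by (simp only: average_def no if_False) simp
  qed
  then show ?thesis by (rule tendsto_eventually)
qed

end

section \<open>The law of the rescaled path\<close>

lemma death_time_eq_INF_rat:
  assumes "w \<in> space skorohod"
  shows "death_time w = (INF q\<in>{q\<in>\<rat>. 0 \<le> q}. if emb (w q) < 0 then ereal q else \<infinity>)" (is "_ = ?R")
proof (rule antisym)
  have st: "w u \<in> states" if "0 \<le> u" for u using assms that by (auto simp: space_skorohod)
  show "?R \<le> death_time w"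
    unfolding death_time_def
  proof (rule INF_greatest)
    fix t assume "t \<in> {t. 0 \<le> t \<and> w t = None}"
    then have t: "0 \<le> t" "w t = None" by auto
    have "\<forall>\<^sub>F u in at_right t. emb (w u) < 0"
      by (rule order_tendstoD(2)[OF tendsto_at_right_coordinate[OF assms t(1)]]) (simp add: t)
    then obtain v where v: "t < v" "\<And>u. t < u \<Longrightarrow> u < v \<Longrightarrow> emb (w u) < 0"
      by (auto simp: eventually_at_right_field)
    show "?R \<le> ereal t"
    \<comment> \<open>The time t may be irrational. The path is dead at the rationals just after t,
      so the infimum is compared with every bound beyond t.\<close>
    proof (rule dense_ge)
      fix z assume "ereal t < z"
      with ereal_dense2[OF this] obtain r where r: "t < r" "ereal r < z" by auto
      obtain q where q: "q \<in> \<rat>" "t < q" "q < min r v" using Rats_dense_in_real[of t "min r v"] r v by auto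
      have "?R \<le> (if emb (w q) < 0 then ereal q else \<infinity>)" using q t by (intro INF_lower) auto
      also have "\<dots> \<le> z" using q v(2)[of q] r less_imp_le[OF le_less_trans[of "ereal q" "ereal r" z]] by auto
      finally show "?R \<le> z" .
    qed
  qed
  show "death_time w \<le> ?R"
    unfolding death_time_def
    by (rule INF_greatest) (use st in \<open>auto intro!: INF_lower simp: emb_neg_iff\<close>)
qed

lemma measurable_death_time [measurable]: "death_time \<in> borel_measurable skorohod"
proof -
  have "(\<lambda>w. if emb (w q) < 0 then ereal q else \<infinity>) \<in> borel_measurable skorohod" if "0 \<le> q" for q
  proof -
    have [measurable]: "(\<lambda>w. w q) \<in> skorohod \<rightarrow>\<^sub>M state_borel" using that by measurable
    show ?thesis by measurable
  qed
  then have "(\<lambda>w. INF q\<in>{q\<in>\<rat>. 0 \<le> q}. if emb (w q) < 0 then ereal q else \<infinity>) \<in> borel_measurable skorohod"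
    by (intro borel_measurable_INF) (auto intro: countable_subset[OF _ countable_rat])
  then show ?thesis
    by (subst measurable_cong[OF death_time_eq_INF_rat]) auto
qed

definition alive_until :: "real \<Rightarrow> path set" where
  "alive_until s = {w \<in> space skorohod. ereal s < death_time w}"

lemma alive_until_sets [measurable]: "alive_until s \<in> sets skorohod"
  unfolding alive_until_def by measurable

text \<open>Being alive at s gives only s <= death time under absorption. Since the cemetery is
  isolated, right continuity keeps the path alive a little longer and makes the inequality
  strict.\<close>

lemma alive_untilI:
  assumes w: "w \<in> space skorohod" and s: "0 \<le> s" "w s \<noteq> None"
    and absorbed: "\<And>u. 0 \<le> u \<Longrightarrow> u \<le> s \<Longrightarrow> w u = None \<Longrightarrow> w s = None"
  shows "w \<in> alive_until s"
proof -
  have st: "w u \<in> states" if "0 \<le> u" for u using w that by (auto simp: space_skorohod)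
  have "- 1 < emb (w s)" using s st[of s] by (cases "w s") auto
  then have "\<forall>\<^sub>F u in at_right s. - 1 < emb (w u)"
    by (rule order_tendstoD(1)[OF tendsto_at_right_coordinate[OF w s(1)]])
  then obtain v where v: "s < v" "\<And>u. s < u \<Longrightarrow> u < v \<Longrightarrow> - 1 < emb (w u)"
    by (auto simp: eventually_at_right_field)
  have "v \<le> t" if t: "0 \<le> t" "w t = None" for t
  proof (rule ccontr)
    assume "\<not> v \<le> t"
    then show False using absorbed[OF t(1) _ t(2)] s(2) v(2)[of t] t(2) by (cases "t \<le> s") auto
  qed
  then have "ereal v \<le> death_time w" unfolding death_time_def by (auto intro!: INF_greatest)
  with v(1) have "ereal s < death_time w" by (simp add: less_le_trans[of "ereal s" "ereal v"])
  with w show ?thesis by (simp add: alive_until_def)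
qed

text \<open>A law with absorbed paths is determined by the events on which the path is still alive,
  since a cylinder constrains the path to be alive at its last time.\<close>

lemma conditioned_law_unique:
  assumes Q1: "is_conditioned_law h b a N Q1" and Q2: "is_conditioned_law h b a N Q2"
  shows "Q1 = Q2"
proof (rule measure_eqI)
  have sets: "sets Q = sets skorohod" if "is_conditioned_law h b a N Q" for Q
    using that by (simp add: is_conditioned_law_def)
  have space: "space Q = space skorohod" if "is_conditioned_law h b a N Q" for Q
    using sets[OF that] by (rule sets_eq_imp_space_eq)
  have total: "emeasure Q (space skorohod) = 1" if Q: "is_conditioned_law h b a N Q" for Q
    using Q prob_space.emeasure_space_1[of Q] space[OF Q] by (simp add: is_conditioned_law_def)
  show "sets Q1 = sets Q2" using sets Q1 Q2 by simp
  have cyl: "emeasure Q (cylinder J c) = (\<integral>\<^sup>+w. ennreal ((case w (Max J) of None \<Rightarrow> 0 | Some x \<Rightarrow> h x) / h a) *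
      indicator (cylinder J c) w \<partial>N)"
    if Q: "is_conditioned_law h b a N Q" and J: "finite J" "J \<subseteq> {0..}" "J \<noteq> {}" for Q J c
  proof -
    define s where "s = Max J"
    have "s \<in> J" using J by (simp add: s_def)
    with J(2) have s: "s \<in> J" "0 \<le> s" by auto
    have Js: "J \<subseteq> {0..s}" using J by (auto simp: s_def)
    have A: "cylinder J c \<in> sets (past s)"
      unfolding past_eq_coords by (rule cylinder_sets[OF J(1) Js]) auto
    have A': "cylinder J c \<in> sets Q" using A sets_past_subset[of s] sets[OF Q] by auto
    have "AE w in Q. \<forall>u t. 0 \<le> u \<and> u \<le> t \<and> w u = None \<longrightarrow> w t = None"
      using Q by (auto simp: is_conditioned_law_def)
    with AE_space have ae: "AE w in Q. w \<in> cylinder J c \<longleftrightarrow> w \<in> cylinder J c \<inter> alive_until s"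
    proof eventually_elim
      case (elim w)
      have "w \<in> alive_until s" if "w \<in> cylinder J c"
      proof (rule alive_untilI)
        show "w s \<noteq> None" using that s by (force simp: cylinder_def in_below_iff)
      qed (use elim s space[OF Q] in auto)
      then show ?case by auto
    qed
    have "emeasure Q (cylinder J c) = emeasure Q (cylinder J c \<inter> alive_until s)"
      using A' alive_until_sets[of s] sets[OF Q] by (intro emeasure_eq_AE[OF ae]) auto
    also have "\<dots> = (\<integral>\<^sup>+w. ennreal ((case w s of None \<Rightarrow> 0 | Some x \<Rightarrow> h x) / h a) * indicator (cylinder J c) w \<partial>N)"
      using Q A s unfolding is_conditioned_law_def alive_until_def by blast
    finally show ?thesis by (simp add: s_def)
  qed
  fix A assume "A \<in> sets Q1"
  then have A: "A \<in> sets (coords {0..})" using sets[OF Q1] by (simp add: sets_skorohod)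
  show "emeasure Q1 A = emeasure Q2 A"
  proof (rule coords_emeasure_eqI[OF order_refl sets[OF Q1] sets[OF Q2] _ _ A])
    show "emeasure Q1 (space skorohod) \<noteq> \<infinity>" using total[OF Q1] by simp
    fix J :: "real set" and c assume J: "finite J" "J \<subseteq> {0..}"
    show "emeasure Q1 (cylinder J c) = emeasure Q2 (cylinder J c)"
    \<comment> \<open>The cylinder over no times does not force survival, and the total mass settles
      this case.\<close>
    proof (cases "J = {}")
      case True
      then show ?thesis using total[OF Q1] total[OF Q2] by (simp add: cylinder_def)
    next
      case False
      then show ?thesis using cyl[OF Q1 J False] cyl[OF Q2 J False] by simp
    qed
  qed
qed

context subordinator
begin

section \<open>Limit of the averages and the sandwich bounds\<close>

definition R :: "real set \<Rightarrow> (real \<Rightarrow> real) \<Rightarrow> (real \<Rightarrow> real) \<Rightarrow> real \<Rightarrow> ennreal" where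
  "R J r c s = (\<integral>\<^sup>+w. weight J r c s w \<partial>M)"

definition \<kappa> :: "nat \<Rightarrow> ennreal" where
  "\<kappa> n = ennreal (real (Suc n)) * (\<integral>\<^sup>+a. (if 0 < a then crossing (recip n) a *
    ennreal (\<gamma> a) else 0) \<partial>lborel)"

lemma
  assumes J: "finite J" and r: "\<And>j. j \<in> J \<Longrightarrow> 0 \<le> r j" "\<And>j. j \<in> J \<Longrightarrow> r j \<le> s" and s: "0 \<le> s"
  shows measurable_average: "average J r c s n \<in> borel_measurable M"
    and nn_integral_average: "(\<integral>\<^sup>+w. average J r c s n w \<partial>M) = \<kappa> n * R J r c s"
proof -
  let ?\<delta> = "recip n"
  have \<delta>: "0 < ?\<delta>" by simp
  have "(\<lambda>p. (\<lambda>(t, w). if jumps J r c s ?\<delta> t w then 1 else 0 :: ennreal) (snd p, fst p))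
      \<in> borel_measurable (M \<Otimes>\<^sub>M borel)"
    by (rule measurable_compose[OF _ measurable_crossing_time[OF J r s]]) measurable
  then have "(\<lambda>w. \<integral>\<^sup>+t. (if jumps J r c s ?\<delta> t w then 1 else 0) \<partial>lborel) \<in> borel_measurable M"
    by (intro lborel.borel_measurable_nn_integral) (simp add: case_prod_beta)
  then have m: "(\<lambda>w. \<integral>\<^sup>+t. (if jumps J r c s ?\<delta> t w then 1 else 0) \<partial>lborel) \<in> borel_measurable M" .
  then show "average J r c s n \<in> borel_measurable M"
    unfolding average_def by (intro borel_measurable_times_ennreal borel_measurable_const)
  have "(\<integral>\<^sup>+w. average J r c s n w \<partial>M) = ennreal (real (Suc n)) *
     (\<integral>\<^sup>+w. (\<integral>\<^sup>+t. (if jumps J r c s ?\<delta> t w then 1 else 0) \<partial>lborel) \<partial>M)"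
    unfolding average_def using m by (rule nn_integral_cmult)
  also have "(\<integral>\<^sup>+w. (\<integral>\<^sup>+t. (if jumps J r c s ?\<delta> t w then 1 else 0) \<partial>lborel) \<partial>M)
      = (\<integral>\<^sup>+a. (if 0 < a then crossing ?\<delta> a * ennreal (\<gamma> a) else 0) \<partial>lborel) * R J r c s"
    unfolding R_def by (rule nn_integral_crossing_time[OF J r s \<delta>])
  finally show "(\<integral>\<^sup>+w. average J r c s n w \<partial>M) = \<kappa> n * R J r c s"
    by (simp only: \<kappa>_def mult.assoc)
qed

text \<open>Stated for a product because neither positivity nor finiteness of \<open>U b\<close> is
  known yet; both are consequences of this limit.\<close>

lemma tendsto_\<kappa>: "(\<lambda>n. \<kappa> n * U b) \<longlonglongrightarrow> 1"
proof -
  define c :: "real \<Rightarrow> real" where "c = (\<lambda>_. 0)"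
  have "(\<lambda>n. \<integral>\<^sup>+w. average {} c c 0 n w \<partial>M) \<longlonglongrightarrow> (\<integral>\<^sup>+w. 1 \<partial>M)"
  proof (rule nn_integral_dominated_convergence[where w = "\<lambda>_. 1"])
    show "average {} c c 0 n \<in> borel_measurable M" for n by (rule measurable_average) auto
    show "AE w in M. average {} c c 0 n w \<le> 1" for n
      using AE_good by eventually_elim (rule average_le_1)
    show "AE w in M. (\<lambda>n. average {} c c 0 n w) \<longlonglongrightarrow> 1"
      using AE_good
    proof eventually_elim
      case (elim w)
      have "target {} c c 0 w" using L_pos[OF elim] by (simp add: target_def)
      then have "\<forall>\<^sub>F t in at_left (L w). hit {} c c 0 t w" by (intro eventually_hit elim) auto
      then show ?case by (rule tendsto_average_1[OF elim])
    qed
  qed (auto simp: emeasure_space_1)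
  moreover have "R {} c c 0 = U b"
  proof -
    have "R {} c c 0 = (\<integral>\<^sup>+w. U b \<partial>M)"
      unfolding R_def
    proof (rule nn_integral_cong_AE)
      show "AE w in M. (if \<forall>j\<in>{}. X (c j) w < c j then U (b - X 0 w) else 0) = U b"
        using X_zero by eventually_elim simp
    qed
    then show ?thesis by (simp add: emeasure_space_1)
  qed
  moreover have "(\<integral>\<^sup>+w. average {} c c 0 n w \<partial>M) = \<kappa> n * R {} c c 0" for n
    by (rule nn_integral_average) auto
  ultimately show ?thesis by (simp add: emeasure_space_1)
qed

text \<open>For some n the product \<open>\<kappa> n * U b\<close> lies strictly between 0 and 2. A
  zero factor would make it 0, and an infinite \<open>U b\<close> would make it 0 or
  infinite.\<close>

lemma U_b: "U b \<noteq> 0" "U b \<noteq> \<top>"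
  and \<kappa>_nonzero: "\<exists>n. \<kappa> n \<noteq> 0"
proof -
  have "\<forall>\<^sub>F n in sequentially. 0 < \<kappa> n * U b" "\<forall>\<^sub>F n in sequentially. \<kappa> n * U b < 2"
    by (rule order_tendstoD[OF tendsto_\<kappa>], simp)+
  then have "\<forall>\<^sub>F n in sequentially. 0 < \<kappa> n * U b \<and> \<kappa> n * U b < 2" by (rule eventually_conj)
  then obtain n where n: "0 < \<kappa> n * U b" "\<kappa> n * U b < 2"
    using eventually_happens'[OF sequentially_bot] by blast
  then show "U b \<noteq> 0" "\<exists>n. \<kappa> n \<noteq> 0" by (auto intro!: exI[of _ n])
  show "U b \<noteq> \<top>"
  proof
    assume "U b = \<top>"
    with n show False by (auto simp: ennreal_mult_top split: if_splits)
  qed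
qed

text \<open>Averages are at most 1, so \<open>\<kappa> n * R J r c s\<close> is at most 1, and some
  \<open>\<kappa> n\<close> is not 0.\<close>

lemma R_finite:
  assumes J: "finite J" and r: "\<And>j. j \<in> J \<Longrightarrow> 0 \<le> r j" "\<And>j. j \<in> J \<Longrightarrow> r j \<le> s" and s: "0 \<le> s"
  shows "R J r c s < \<top>"
proof -
  obtain n where n: "\<kappa> n \<noteq> 0" using \<kappa>_nonzero by auto
  have "\<kappa> n * R J r c s = (\<integral>\<^sup>+w. average J r c s n w \<partial>M)"
    by (rule nn_integral_average[OF J r s, symmetric])
  also have "\<dots> \<le> (\<integral>\<^sup>+w. 1 \<partial>M)"
    using AE_good by (intro nn_integral_mono_AE) (auto elim!: eventually_mono intro: average_le_1)
  finally have "\<kappa> n * R J r c s \<le> 1" by (simp add: emeasure_space_1)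
  then have "\<kappa> n * R J r c s \<noteq> \<top>" by (auto simp: top_unique)
  with n have "R J r c s \<noteq> \<top>" by (auto simp: ennreal_mult_top)
  then show ?thesis by (simp add: less_top)
qed

lemma tendsto_nn_integral_average:
  assumes J: "finite J" and r: "\<And>j. j \<in> J \<Longrightarrow> 0 \<le> r j" "\<And>j. j \<in> J \<Longrightarrow> r j \<le> s" and s: "0 \<le> s"
  shows "(\<lambda>n. \<integral>\<^sup>+w. average J r c s n w \<partial>M) \<longlonglongrightarrow> R J r c s / U b"
proof -
  have fin: "R J r c s / U b < \<top>"
  proof -
    have "R J r c s / U b \<noteq> \<top>"
      using R_finite[where J = J and r = r and s = s and c = c, OF J r s] U_b
      unfolding ennreal_divide_eq_top_iff by auto
    then show ?thesis by (simp only: less_top)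
  qed
  have "R J r c s / U b * (\<kappa> n * U b) = \<kappa> n * R J r c s" for n
  proof -
    have "R J r c s / U b * (\<kappa> n * U b) = \<kappa> n * R J r c s * U b / U b"
      by (simp only: ennreal_divide_times ennreal_times_divide mult.commute mult.left_commute)
    then show ?thesis using U_b by (simp add: mult_divide_eq_ennreal)
  qed
  then show ?thesis
    using ennreal_tendsto_cmult[OF fin tendsto_\<kappa>] nn_integral_average[OF J r s] by simp
qed

text \<open>On \<open>target\<close> the averages tend to 1 with the given times and levels, so
  Fatou's lemma applies directly.\<close>

lemma target_le_R:
  assumes J: "finite J" and r: "\<And>j. j \<in> J \<Longrightarrow> 0 \<le> r j" "\<And>j. j \<in> J \<Longrightarrow> r j \<le> s" and s: "0 \<le> s"
  shows "(\<integral>\<^sup>+w. (if target J r c s w then 1 else 0) \<partial>M) \<le> R J r c s / U b"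
proof -
  have "(\<integral>\<^sup>+w. (if target J r c s w then 1 else 0) \<partial>M) \<le> (\<integral>\<^sup>+w. liminf (\<lambda>n. average J r c s n w) \<partial>M)"
  proof (rule nn_integral_mono_AE)
    show "AE w in M. (if target J r c s w then 1 else 0) \<le> liminf (\<lambda>n. average J r c s n w)"
      using AE_good
    proof eventually_elim
      case (elim w)
      show ?case
      proof (cases "target J r c s w")
        case True
        have "(\<lambda>n. average J r c s n w) \<longlonglongrightarrow> 1"
          by (rule tendsto_average_1[OF elim eventually_hit[OF elim J r(1) s True]])
        then show ?thesis by (simp add: lim_imp_Liminf)
      qed simp
    qed
  qed
  also have "\<dots> \<le> liminf (\<lambda>n. \<integral>\<^sup>+w. average J r c s n w \<partial>M)"
    by (rule nn_integral_liminf) (rule measurable_average[OF J r s])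
  also have "\<dots> = R J r c s / U b"
    by (rule lim_imp_Liminf[OF sequentially_bot tendsto_nn_integral_average[OF J r s]])
  finally show ?thesis .
qed

text \<open>Off \<open>target\<close> only the hits for the shifted times and lowered levels are
  excluded near L. The averages are bounded by 1, which permits Fatou's lemma for the upper
  limit.\<close>

lemma R_le_target:
  assumes J: "finite J" and r: "\<And>j. j \<in> J \<Longrightarrow> 0 \<le> r j" "\<And>j. j \<in> J \<Longrightarrow> r j < r' j" "\<And>j. j \<in> J \<Longrightarrow> r' j \<le> s'"
    and c: "\<And>j. j \<in> J \<Longrightarrow> c' j < c j" and s: "0 \<le> s" "s < s'"
  shows "R J r' c' s' / U b \<le> (\<integral>\<^sup>+w. (if target J r c s w then 1 else 0) \<partial>M)"
proof -
  have r': "\<And>j. j \<in> J \<Longrightarrow> 0 \<le> r' j" using r by (meson less_imp_le order_trans)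
  have s': "0 \<le> s'" using s by simp
  have "R J r' c' s' / U b = limsup (\<lambda>n. \<integral>\<^sup>+w. average J r' c' s' n w \<partial>M)"
    by (rule lim_imp_Limsup[OF sequentially_bot tendsto_nn_integral_average[OF J r' r(3) s'], symmetric])
  also have "\<dots> \<le> (\<integral>\<^sup>+w. limsup (\<lambda>n. average J r' c' s' n w) \<partial>M)"
  proof (rule nn_integral_limsup[where w = "\<lambda>_. 1"])
    show "average J r' c' s' n \<in> borel_measurable M" for n
      by (rule measurable_average[OF J r' r(3) s'])
    show "AE w in M. average J r' c' s' n w \<le> 1" for n
      using AE_good by eventually_elim (rule average_le_1)
  qed (auto simp: emeasure_space_1)
  also have "\<dots> \<le> (\<integral>\<^sup>+w. (if target J r c s w then 1 else 0) \<partial>M)"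
  proof (rule nn_integral_mono_AE)
    show "AE w in M. limsup (\<lambda>n. average J r' c' s' n w) \<le> (if target J r c s w then 1 else 0)"
      using AE_good
    proof eventually_elim
      case (elim w)
      show ?case
      proof (cases "target J r c s w")
        case True
        have "limsup (\<lambda>n. average J r' c' s' n w) \<le> 1"
          using average_le_1[OF elim] by (intro Limsup_bounded always_eventually) blast
        with True show ?thesis by simp
      next
        case False
        have "\<forall>\<^sub>F t in at_left (L w). \<not> hit J r' c' s' t w"
          using r(1,2) c s False by (intro eventually_not_hit[OF elim J, of r r' c' c s s']) auto
        from tendsto_average_0[OF elim this] False show ?thesis by (simp add: lim_imp_Limsup)
      qed
    qed
  qed
  finally show ?thesis .
qed

section \<open>Regularity of the potential density and removal of the perturbation\<close>

lemma U_eq_powr: "0 < x \<Longrightarrow> U x = ennreal ((x / b) powr (\<alpha> - 1)) * U b"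
  using U_scaled[of "x / b" b] b by simp

lemma U_finite: "U x < \<top>"
proof (cases "0 < x")
  case True
  then show ?thesis using U_b by (simp add: U_eq_powr ennreal_mult_less_top less_top)
qed (simp add: U_nonpos)

lemma tendsto_U:
  assumes "(v \<longlongrightarrow> x) net" "0 < x" shows "((\<lambda>n. U (v n)) \<longlongrightarrow> U x) net"
proof -
  have "((\<lambda>n. U b * ennreal ((v n / b) powr (\<alpha> - 1))) \<longlongrightarrow> U b * ennreal ((x / b) powr (\<alpha> - 1))) net"
    using assms b U_b by (intro ennreal_tendsto_cmult tendsto_ennrealI tendsto_intros) (auto simp: less_top)
  moreover have "\<forall>\<^sub>F n in net. U b * ennreal ((v n / b) powr (\<alpha> - 1)) = U (v n)"
    using order_tendstoD(1)[OF assms] by eventually_elim (simp add: U_eq_powr mult.commute)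
  ultimately have "((\<lambda>n. U (v n)) \<longlongrightarrow> U b * ennreal ((x / b) powr (\<alpha> - 1))) net"
    by (rule Lim_transform_eventually)
  with assms(2) show ?thesis by (simp add: U_eq_powr mult.commute)
qed

text \<open>All times are shifted to the right, so right continuity of X makes the strict
  constraints hold for large n and carries the potential density along; Fatou's lemma integrates
  this bound.\<close>

lemma R_le_liminf:
  assumes J: "finite J" and r: "\<And>j. j \<in> J \<Longrightarrow> 0 \<le> r j" "\<And>j. j \<in> J \<Longrightarrow> r j \<le> s" and s: "0 \<le> s"
  shows "R J r c s \<le> liminf (\<lambda>n. R J (\<lambda>j. r j + recip n)
    (\<lambda>j. c j - recip n) (s + recip n))"
proof -
  define e where "e n = recip n" for n
  have e: "0 < e n" for n by (simp add: e_def)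
  have e0: "e \<longlonglongrightarrow> 0" using LIMSEQ_inverse_real_of_nat by (simp add: e_def[abs_def])
  have X_lim: "(\<lambda>n. X (r + e n) w) \<longlonglongrightarrow> X r w" if "good w" "0 \<le> r" for r w
  proof (rule filterlim_compose[OF good_right_continuous[OF that]])
    show "filterlim (\<lambda>n. r + e n) (at_right r) sequentially"
      unfolding filterlim_at
      using e tendsto_add[OF tendsto_const e0, of r] by (auto intro!: always_eventually simp: less_imp_neq[symmetric])
  qed
  define u where "u n w = (if \<forall>j\<in>J. X (r j + e n) w < c j - e n then U (b - X (s + e n) w) else 0)" for n w
  have "R J r c s \<le> (\<integral>\<^sup>+w. liminf (\<lambda>n. u n w) \<partial>M)"
    unfolding R_def
  proof (rule nn_integral_mono_AE)
    show "AE w in M. weight J r c s w \<le> liminf (\<lambda>n. u n w)"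
      using AE_good
    proof eventually_elim
      case (elim w)
      show ?case
      proof (cases "(\<forall>j\<in>J. X (r j) w < c j) \<and> X s w < b")
        case True
        have "\<forall>\<^sub>F n in sequentially. \<forall>j\<in>J. X (r j + e n) w < c j - e n"
        proof (intro eventually_ball_finite[OF J] ballI)
          fix j assume j: "j \<in> J"
          have "(\<lambda>n. X (r j + e n) w + e n) \<longlonglongrightarrow> X (r j) w + 0"
            using X_lim[OF elim r(1)[OF j]] e0 by (rule tendsto_add)
          then have "\<forall>\<^sub>F n in sequentially. X (r j + e n) w + e n < c j"
            by (rule order_tendstoD(2)) (use True j in auto)
          then show "\<forall>\<^sub>F n in sequentially. X (r j + e n) w < c j - e n"
            by eventually_elim simp
        qed
        then have "\<forall>\<^sub>F n in sequentially. U (b - X (s + e n) w) = u n w"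
          by eventually_elim (simp add: u_def)
        moreover have "(\<lambda>n. U (b - X (s + e n) w)) \<longlonglongrightarrow> U (b - X s w)"
          using True by (intro tendsto_U tendsto_intros X_lim elim s) auto
        ultimately have "(\<lambda>n. u n w) \<longlonglongrightarrow> U (b - X s w)" by (rule Lim_transform_eventually[rotated])
        then have "liminf (\<lambda>n. u n w) = U (b - X s w)" by (rule lim_imp_Liminf[OF sequentially_bot])
        with True show ?thesis by simp
      next
        case False
        \<comment> \<open>If X_s is at least b, the potential density is evaluated at a nonpositive
          point, where it vanishes; there is nothing to bound.\<close>
        then have "weight J r c s w = 0"
          using U_nonpos[of "b - X s w"] by auto
        then show ?thesis by simp
      qed
    qed
  qed
  also have "\<dots> \<le> liminf (\<lambda>n. \<integral>\<^sup>+w. u n w \<partial>M)"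
  proof (rule nn_integral_liminf)
    fix n
    have [measurable]: "X (s + e n) \<in> borel_measurable M" using s e[of n] by (intro measurable_X) simp
    have "Measurable.pred M (\<lambda>w. \<forall>j\<in>J. X (r j + e n) w < c j - e n)"
      using r e[of n] by (intro pred_intros_finite J borel_measurable_pred_less measurable_X measurable_const)
        (auto intro: add_nonneg_nonneg less_imp_le)
    then show "u n \<in> borel_measurable M" unfolding u_def by measurable
  qed
  finally show ?thesis by (simp only: u_def R_def e_def[symmetric])
qed

text \<open>The upper bound holds for the exact data. The lower bound holds for perturbed data, and
  the perturbation 1 / (n + 1) disappears by lower semicontinuity of \<open>R\<close> along
  it.\<close>

lemma nn_integral_target:
  assumes J: "finite J" and r: "\<And>j. j \<in> J \<Longrightarrow> 0 \<le> r j" "\<And>j. j \<in> J \<Longrightarrow> r j \<le> s" and s: "0 \<le> s"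
  shows "(\<integral>\<^sup>+w. (if target J r c s w then 1 else 0) \<partial>M) = R J r c s / U b"
proof (rule antisym[OF target_le_R[OF J r s]])
  let ?T = "\<integral>\<^sup>+w. (if target J r c s w then 1 else 0) \<partial>M"
  have "R J r c s \<le> liminf (\<lambda>n. R J (\<lambda>j. r j + recip n)
    (\<lambda>j. c j - recip n) (s + recip n))"
    by (rule R_le_liminf[OF J r s])
  also have "\<dots> \<le> ?T * U b"
  proof -
    have "R J (\<lambda>j. r j + recip n) (\<lambda>j. c j - recip n) (s + recip n) \<le> ?T * U b" for n
    proof -
      let ?R = "R J (\<lambda>j. r j + recip n) (\<lambda>j. c j - recip n) (s + recip n)"
      have "?R / U b \<le> ?T" by (rule R_le_target) (use J r s in auto)
      then have "?R / U b * U b \<le> ?T * U b" by (rule mult_right_mono) simp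
      then show ?thesis using U_b by (simp add: ennreal_divide_times less_top)
    qed
    then have "liminf (\<lambda>n. R J (\<lambda>j. r j + recip n)
      (\<lambda>j. c j - recip n) (s + recip n)) \<le> liminf (\<lambda>n::nat. ?T * U b)"
      by (intro Liminf_mono always_eventually allI)
    also have "\<dots> = ?T * U b" by (rule lim_imp_Liminf) auto
    finally show ?thesis .
  qed
  finally have "R J r c s / U b \<le> ?T * U b / U b" by (rule divide_right_mono_ennreal)
  then show "R J r c s / U b \<le> ?T" using U_b by (simp add: mult_divide_eq_ennreal)
qed

end

section \<open>Identification with the conditioned law\<close>

text \<open>Rational times suffice: right continuity transfers absorption, and a value at time \<open>t\<close> is at most
  any later value, hence strictly below \<open>b\<close>, not merely a limit of such values.\<close>

lemma increasing_killed_path: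
  assumes w: "w \<in> space skorohod"
    and rat: "\<And>p q. p \<in> \<rat> \<Longrightarrow> q \<in> \<rat> \<Longrightarrow> 0 \<le> p \<Longrightarrow> p < q \<Longrightarrow> emb (w q) < b \<and>
      (0 \<le> emb (w q) \<longrightarrow> 0 \<le> emb (w p) \<and> emb (w p) \<le> emb (w q))"
    and dies: "\<exists>q\<in>\<rat>. 0 \<le> q \<and> emb (w q) < 0"
  shows "(\<forall>t\<ge>0. w t \<in> insert None (Some ` {0..<b})) \<and> (\<exists>t\<ge>0. w t = None) \<and>
    (\<forall>s t. 0 \<le> s \<and> s \<le> t \<and> w s = None \<longrightarrow> w t = None)"
proof -
  have st: "w u \<in> states" if "0 \<le> u" for u using w that by (auto simp: space_skorohod)
  have alive: "0 \<le> emb (w u)" if "0 \<le> u" "-1 < emb (w u)" for u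
    using st[OF that(1)] that(2) by (cases "w u") auto
  have later: "\<exists>q\<in>\<rat>. t < q \<and> 0 \<le> emb (w q)" if t: "0 \<le> t" "w t \<noteq> None" for t
  proof -
    have "- 1 < emb (w t)" using t st[of t] by (cases "w t") auto
    then have "\<forall>\<^sub>F u in at_right t. - 1 < emb (w u)"
      by (rule order_tendstoD(1)[OF tendsto_at_right_coordinate[OF w t(1)]])
    then obtain v where v: "t < v" "\<And>u. t < u \<Longrightarrow> u < v \<Longrightarrow> - 1 < emb (w u)"
      by (auto simp: eventually_at_right_field)
    obtain q where q: "q \<in> \<rat>" "t < q" "q < v" using Rats_dense_in_real[OF v(1)] by auto
    then show ?thesis using alive[of q] v(2)[of q] t by auto
  qed
  have value_less: "emb (w t) < b" if t: "0 \<le> t" "w t \<noteq> None" for t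
  proof -
    obtain q where q: "q \<in> \<rat>" "t < q" "0 \<le> emb (w q)" using later[OF t] by auto
    \<comment> \<open>The bound by b is available only for the later element of a pair of rationals;
      \<open>r\<close> supplies the earlier one.\<close>
    obtain r where r: "r \<in> \<rat>" "t < r" "r < q" using Rats_dense_in_real[OF q(2)] by auto
    have "emb (w t) \<le> emb (w q)"
    proof (rule ccontr)
      assume "\<not> emb (w t) \<le> emb (w q)"
      then have "\<forall>\<^sub>F u in at_right t. emb (w q) < emb (w u)"
        by (intro order_tendstoD(1)[OF tendsto_at_right_coordinate[OF w t(1)]]) simp
      then obtain v where v: "t < v" "\<And>u. t < u \<Longrightarrow> u < v \<Longrightarrow> emb (w q) < emb (w u)"
        by (auto simp: eventually_at_right_field)
      obtain p where p: "p \<in> \<rat>" "t < p" "p < min q v" using Rats_dense_in_real[of t "min q v"] q v by auto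
      then show False using rat[OF p(1) q(1)] q(3) v(2)[of p] t by auto
    qed
    also have "\<dots> < b" using rat[OF r(1) q(1)] t r by auto
    finally show ?thesis .
  qed
  have absorbed: "w t = None" if s: "0 \<le> s" "s \<le> t" "w s = None" for s t
  proof (rule ccontr)
    assume t: "w t \<noteq> None"
    then have "s < t" using s by (cases "s = t") auto
    have "\<forall>\<^sub>F u in at_right s. emb (w u) < 0"
      by (rule order_tendstoD(2)[OF tendsto_at_right_coordinate[OF w s(1)]]) (simp add: s)
    then obtain v where v: "s < v" "\<And>u. s < u \<Longrightarrow> u < v \<Longrightarrow> emb (w u) < 0"
      by (auto simp: eventually_at_right_field)
    obtain p where p: "p \<in> \<rat>" "s < p" "p < min t v" using Rats_dense_in_real[of s "min t v"] \<open>s < t\<close> v by auto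
    obtain q where q: "q \<in> \<rat>" "t < q" "0 \<le> emb (w q)" using later[of t] t s by auto
    show False using rat[OF p(1) q(1)] q p s v(2)[of p] by auto
  qed
  show ?thesis
  proof (intro conjI allI impI)
    fix t :: real assume t: "0 \<le> t"
    show "w t \<in> insert None (Some ` {0..<b})"
      using value_less[OF t] st[OF t] by (cases "w t") auto
  next
    obtain q where "0 \<le> q" "emb (w q) < 0" using dies by auto
    then show "\<exists>t\<ge>0. w t = None" using st[of q] by (auto simp: emb_neg_iff intro!: exI[of _ q])
  qed (use absorbed in blast)
qed

context subordinator
begin

abbreviation conditioned :: "path measure" where
  "conditioned \<equiv> distr M skorohod (rescaled_path \<alpha> b)"

lemma measurable_rescaled_path_M [measurable]: "rescaled_path \<alpha> b \<in> M \<rightarrow>\<^sub>M skorohod"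
  using measurable_rescaled_path[OF b] sets_M by (simp cong: measurable_cong_sets)

lemma AE_conditionedI:
  assumes "Measurable.pred skorohod Q" "AE w in M. Q (rescaled_path \<alpha> b w)"
  shows "AE w in conditioned. Q w"
proof -
  have "{w \<in> space skorohod. Q w} \<in> sets skorohod" using assms(1) by measurable
  from AE_distr_iff[OF measurable_rescaled_path_M this] assms(2) show ?thesis by (simp only:)
qed

text \<open>The transfer along the rescaling map asks for measurable properties. Only countably many
  of them are transferred, at pairs of rationals and at the integers, and
  \<open>increasing_killed_path\<close> recovers all times.\<close>

lemma AE_conditioned_regular:
  "AE w in conditioned. (\<forall>t\<ge>0. w t \<in> insert None (Some ` {0..<b})) \<and> (\<exists>t\<ge>0. w t = None) \<and>
    (\<forall>s t. 0 \<le> s \<and> s \<le> t \<and> w s = None \<longrightarrow> w t = None)"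
proof -
  have e: "(\<lambda>w. emb (w q)) \<in> borel_measurable skorohod" if "0 \<le> q" for q
    using that by (rule measurable_compose[OF measurable_coordinate measurable_emb])
  have Y: "emb (rescaled_path \<alpha> b w q) = (if q * clock (g w) < L w then rescaled (g w) q w else -1)"
    if "good w" "0 \<le> q" for w q
    using good_rescaled_path[OF that] by simp
  have pairs: "AE w in conditioned. emb (w q) < b \<and>
      (0 \<le> emb (w q) \<longrightarrow> 0 \<le> emb (w p) \<and> emb (w p) \<le> emb (w q))" if pq: "0 \<le> p" "p < q" for p q
  proof -
    have q: "0 \<le> q" using pq by simp
    have "AE w in M. emb (rescaled_path \<alpha> b w q) < b \<and>
      (0 \<le> emb (rescaled_path \<alpha> b w q) \<longrightarrow> 0 \<le> emb (rescaled_path \<alpha> b w p) \<and>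
        emb (rescaled_path \<alpha> b w p) \<le> emb (rescaled_path \<alpha> b w q))"
      using AE_good
    proof eventually_elim
      case (elim w)
      show ?case
      proof (cases "q * clock (g w) < L w")
        case True
        have G: "0 < g w" by (rule g_pos[OF elim])
        have le: "p * clock (g w) \<le> q * clock (g w)" using pq by (intro mult_right_mono) auto
        have "X (q * clock (g w)) w < g w"
          using q True by (intro X_less_g[OF elim]) auto
        then have "rescaled (g w) q w < b" using G b by (simp add: rescaled_def field_simps)
        moreover have "X (p * clock (g w)) w \<le> X (q * clock (g w)) w"
          using pq le by (intro good_mono[OF elim]) auto
        then have "rescaled (g w) p w \<le> rescaled (g w) q w"
          unfolding rescaled_def using G b by (intro mult_left_mono) auto
        moreover have "0 \<le> rescaled (g w) p w"
          unfolding rescaled_def using G b pq good_nonneg[OF elim, of "p * clock (g w)"] by simp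
        ultimately show ?thesis using True le Y[OF elim pq(1)] Y[OF elim q] by auto
      next
        case False
        then show ?thesis using Y[OF elim q] b by simp
      qed
    qed
    moreover have "Measurable.pred skorohod (\<lambda>w. emb (w q) < b \<and>
        (0 \<le> emb (w q) \<longrightarrow> 0 \<le> emb (w p) \<and> emb (w p) \<le> emb (w q)))"
    proof -
      have "Measurable.pred skorohod (\<lambda>w. v w < b \<and> (0 \<le> v w \<longrightarrow> 0 \<le> u w \<and> u w \<le> v w))"
        if [measurable]: "u \<in> borel_measurable skorohod" "v \<in> borel_measurable skorohod"
        for u v :: "path \<Rightarrow> real"
      proof -
        have "Measurable.pred skorohod (\<lambda>w. v w < b \<and> (\<not> v w < 0 \<longrightarrow> \<not> u w < 0 \<and> \<not> v w < u w))"
          by measurable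
        then show ?thesis by (simp only: not_less)
      qed
      from this[OF e[OF pq(1)] e[OF q]] show ?thesis .
    qed
    ultimately show ?thesis by (rule AE_conditionedI[rotated])
  qed
  have "AE w in conditioned. \<forall>p\<in>{p\<in>\<rat>. 0 \<le> p}. \<forall>q\<in>{q\<in>\<rat>. p < q}. emb (w q) < b \<and>
      (0 \<le> emb (w q) \<longrightarrow> 0 \<le> emb (w p) \<and> emb (w p) \<le> emb (w q))"
    by (rule AE_ball_countable', rule AE_ball_countable', rule pairs)
       (auto intro: countable_subset[OF _ countable_rat])
  moreover have "AE w in conditioned. \<exists>n::nat. emb (w (real n)) < 0"
  proof -
    have [measurable]: "(\<lambda>w. emb (w (real n))) \<in> borel_measurable skorohod" for n :: nat by (rule e) simp
    have "AE w in M. \<exists>n::nat. emb (rescaled_path \<alpha> b w (real n)) < 0"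
      using AE_good
    proof eventually_elim
      case (elim w)
      \<comment> \<open>Y dies at time L / \<open>clock (g w)\<close>, so it is dead at any later
        integer.\<close>
      obtain n :: nat where "L w / clock (g w) \<le> real n" using real_arch_simple by blast
      then have "\<not> real n * clock (g w) < L w"
        using clock_pos[OF g_pos[OF elim]] by (simp add: field_simps)
      then show ?case using Y[OF elim, of "real n"] by (intro exI[of _ n]) simp
    qed
    moreover have "Measurable.pred skorohod (\<lambda>w. \<exists>n::nat. emb (w (real n)) < 0)"
      by measurable
    ultimately show ?thesis by (rule AE_conditionedI[rotated])
  qed
  ultimately show ?thesis
    using AE_space
  proof eventually_elim
    case (elim w)
    from elim(2) obtain n :: nat where n: "emb (w (real n)) < 0" by blast
    show ?case
    proof (rule increasing_killed_path)
      show "\<exists>q\<in>\<rat>. 0 \<le> q \<and> emb (w q) < 0" using n by (intro bexI[of _ "real n"]) auto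
    qed (use elim in auto)
  qed
qed

lemma rescaled_path_alive_cylinder_iff:
  assumes w: "good w" and J: "J \<subseteq> {0..s}" and s: "0 \<le> s"
  shows "rescaled_path \<alpha> b w \<in> cylinder J c \<inter> alive_until s \<longleftrightarrow> target J (\<lambda>j. j) c s w"
proof -
  have space: "rescaled_path \<alpha> b w \<in> space skorohod"
    using w b by (intro rescaled_path_in_space) (auto simp: good_def)
  have cg: "0 < clock (g w)" by (rule clock_pos[OF g_pos[OF w]])
  note Y = good_rescaled_path[OF w]
  show ?thesis
  proof (cases "s * clock (g w) < L w")
    case True
    have le: "u * clock (g w) < L w" if "u \<le> s" for u
    proof -
      have "u * clock (g w) \<le> s * clock (g w)" using that cg by (intro mult_right_mono) auto
      with True show ?thesis by simp
    qed
    have "rescaled_path \<alpha> b w \<in> alive_until s"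
      using space s Y le by (intro alive_untilI) auto
    moreover have "rescaled_path \<alpha> b w j \<in> below (c j) \<longleftrightarrow> rescaled (g w) j w < c j" if "j \<in> J" for j
    proof -
      have j: "0 \<le> j" "j \<le> s" using that J by auto
      have "0 \<le> rescaled (g w) j w"
        unfolding rescaled_def using b g_pos[OF w] good_nonneg[OF w, of "j * clock (g w)"] j cg by simp
      then show ?thesis using Y[OF j(1)] le[OF j(2)] by (auto simp: in_below_iff)
    qed
    ultimately show ?thesis using space True by (auto simp: cylinder_def target_def)
  next
    case False
    then have "rescaled_path \<alpha> b w s = None" using Y[OF s] by simp
    then have "death_time (rescaled_path \<alpha> b w) \<le> ereal s"
      unfolding death_time_def using s by (intro INF_lower) auto
    with False show ?thesis by (auto simp: alive_until_def target_def)
  qed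
qed

lemma emeasure_conditioned_cylinder:
  assumes J: "finite J" "J \<subseteq> {0..s}" and s: "0 \<le> s"
  shows "emeasure conditioned (cylinder J c \<inter> alive_until s) = R J (\<lambda>j. j) c s / U b"
proof -
  have "cylinder J c \<in> sets skorohod"
    unfolding sets_skorohod by (rule cylinder_sets[OF J(1)]) (use J in auto)
  then have A [measurable]: "cylinder J c \<inter> alive_until s \<in> sets skorohod" by measurable
  have "emeasure conditioned (cylinder J c \<inter> alive_until s)
    = (\<integral>\<^sup>+w. indicator (cylinder J c \<inter> alive_until s) w \<partial>conditioned)"
    by (rule nn_integral_indicator[symmetric]) simp
  also have "\<dots> = (\<integral>\<^sup>+w. indicator (cylinder J c \<inter> alive_until s) (rescaled_path \<alpha> b w) \<partial>M)"
    by (rule nn_integral_distr) measurable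
  also have "\<dots> = (\<integral>\<^sup>+w. (if target J (\<lambda>j. j) c s w then 1 else 0) \<partial>M)"
  proof (rule nn_integral_cong_AE)
    show "AE w in M. indicator (cylinder J c \<inter> alive_until s) (rescaled_path \<alpha> b w)
      = (if target J (\<lambda>j. j) c s w then 1 else (0::ennreal))"
      using AE_good
      by eventually_elim (simp only: indicator_def rescaled_path_alive_cylinder_iff[OF _ J(2) s] of_bool_def)
  qed
  also have "\<dots> = R J (\<lambda>j. j) c s / U b"
    by (rule nn_integral_target[OF J(1)]) (use J s in auto)
  finally show ?thesis .
qed

text \<open>For x > b both sides vanish, since \<open>U\<close> is 0 at negative arguments;
  elsewhere finiteness of \<open>U\<close> guarantees that the integral defining h
  converges.\<close>

lemma ennreal_h_fun: "ennreal (h_fun f b x) = U (b - x)"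
  using potential_density_eq[of "b - x"] U_finite[of "b - x"] U_nonpos[of "b - x"] by (simp add: h_fun_def)

lemma h_fun_nonneg: "0 \<le> h_fun f b x"
proof -
  have "0 \<le> potential_density f a" for a
    unfolding potential_density_def set_lebesgue_integral_def
    by (rule Bochner_Integration.integral_nonneg) (simp add: indicator_def f_nonneg)
  then show ?thesis by (simp add: h_fun_def)
qed

text \<open>The value is the potential density at b, so the quotient by h 0 in the h-transform is a
  division by a positive number.\<close>

lemma h_fun_zero_pos: "0 < h_fun f b 0"
  using ennreal_h_fun[of 0] U_b h_fun_nonneg[of 0] by (cases "h_fun f b 0 = 0") auto

definition h_weight :: "real \<Rightarrow> path \<Rightarrow> ennreal" where
  "h_weight s w = ennreal ((case w s of None \<Rightarrow> 0 | Some x \<Rightarrow> h_fun f b x) / h_fun f b 0)"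

lemma measurable_h_weight:
  assumes s: "0 \<le> s" shows "h_weight s \<in> borel_measurable M"
proof -
  have h: "h_fun f b x = enn2real (U (b - x))" for x
    using ennreal_h_fun[of x] h_fun_nonneg[of x] by (metis enn2real_ennreal)
  have [measurable]: "h_fun f b \<in> borel_measurable borel"
    unfolding h[abs_def] by measurable
  have w [measurable]: "(\<lambda>w. w s) \<in> M \<rightarrow>\<^sub>M state_borel"
    using measurable_coordinate[OF s] sets_M by (simp cong: measurable_cong_sets)
  have "(\<lambda>w. ennreal ((if emb (w s) < 0 then 0 else h_fun f b (emb (w s))) / h_fun f b 0)) \<in> borel_measurable M"
    by measurable
  also have "?this \<longleftrightarrow> ?thesis"
  proof (rule measurable_cong)
    fix w assume "w \<in> space M"
    then have "w s \<in> states" using s by (auto simp: space_M space_skorohod)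
    then show "ennreal ((if emb (w s) < 0 then 0 else h_fun f b (emb (w s))) / h_fun f b 0) = h_weight s w"
      by (cases "w s") (auto simp: h_weight_def)
  qed
  finally show ?thesis .
qed

lemma h_weight_eq:
  assumes "w s \<noteq> None" shows "h_weight s w = U (b - X s w) / U b"
proof -
  have "h_weight s w = ennreal (h_fun f b (X s w) / h_fun f b 0)"
    using assms by (auto simp: h_weight_def X_def)
  also have "\<dots> = ennreal (h_fun f b (X s w)) / ennreal (h_fun f b 0)"
    by (rule divide_ennreal[OF h_fun_nonneg h_fun_zero_pos, symmetric])
  finally show ?thesis by (simp only: ennreal_h_fun diff_zero)
qed

lemma emeasure_h_transform_cylinder:
  assumes J: "finite J" "J \<subseteq> {0..s}" and s: "0 \<le> s"
  shows "emeasure (density M (h_weight s)) (cylinder J c) = R J (\<lambda>j. j) c s / U b"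
proof -
  have cyl: "cylinder J c \<in> sets M"
    unfolding sets_M sets_skorohod by (rule cylinder_sets[OF J(1)]) (use J in auto)
  have "emeasure (density M (h_weight s)) (cylinder J c) = (\<integral>\<^sup>+w. h_weight s w * indicator (cylinder J c) w \<partial>M)"
    by (rule emeasure_density[OF measurable_h_weight[OF s] cyl])
  also have "\<dots> = (\<integral>\<^sup>+w. (if \<forall>j\<in>J. X j w < c j then U (b - X s w) else 0) / U b \<partial>M)"
  proof (rule nn_integral_cong_AE)
    show "AE w in M. h_weight s w * indicator (cylinder J c) w
      = (if \<forall>j\<in>J. X j w < c j then U (b - X s w) else 0) / U b"
      using alive AE_space
    proof eventually_elim
      case (elim w)
      have "w j \<in> below (c j) \<longleftrightarrow> X j w < c j" if "j \<in> J" for j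
      proof -
        have "0 \<le> j" using that J by auto
        then have "w j \<in> states" "w j \<noteq> None" using elim by (auto simp: space_M space_skorohod)
        then show ?thesis by (cases "w j") (auto simp: in_below_iff X_def)
      qed
      then have "w \<in> cylinder J c \<longleftrightarrow> (\<forall>j\<in>J. X j w < c j)"
        using elim by (auto simp: cylinder_def space_M)
      moreover have "h_weight s w = U (b - X s w) / U b" using elim s by (intro h_weight_eq) auto
      ultimately show ?case by (auto simp: indicator_def)
    qed
  qed
  also have "\<dots> = R J (\<lambda>j. j) c s / U b"
    unfolding R_def
  proof (rule nn_integral_divide)
    note [measurable] = measurable_X[OF s]
    have "Measurable.pred M (\<lambda>w. \<forall>j\<in>J. X j w < c j)"
      using J by (intro pred_intros_finite borel_measurable_pred_less measurable_X measurable_const) auto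
    then show "(\<lambda>w. if \<forall>j\<in>J. X j w < c j then U (b - X s w) else 0) \<in> borel_measurable M"
      by measurable
  qed
  finally show ?thesis .
qed

text \<open>Both sides of the defining identity are finite measures in A: the law of Y restricted to
  survival at s, and the law of X weighted by h. They agree on the cylinders with times up to s,
  with common value \<open>R\<close> divided by \<open>U b\<close>, hence on the whole past.\<close>

lemma is_conditioned_law_conditioned: "is_conditioned_law (h_fun f b) b 0 M conditioned"
  unfolding is_conditioned_law_def
proof (intro conjI allI impI ballI)
  show "sets conditioned = sets skorohod" by simp
  show "prob_space conditioned" by (rule prob_space_distr) measurable
  show "AE w in conditioned. (\<forall>t\<ge>0. w t \<in> insert None (Some ` {0..<b})) \<and> (\<exists>t\<ge>0. w t = None) \<and>
    (\<forall>s t. 0 \<le> s \<and> s \<le> t \<and> w s = None \<longrightarrow> w t = None)"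
    by (rule AE_conditioned_regular)
  fix s :: real and A assume s: "0 \<le> s" and A: "A \<in> sets (past s)"
  have A': "A \<in> sets skorohod" using A sets_past_subset by auto
  let ?N = "density conditioned (indicator (alive_until s))"
  have N: "emeasure ?N B = emeasure conditioned (B \<inter> alive_until s)" if "B \<in> sets skorohod" for B
  proof -
    have "emeasure ?N B = (\<integral>\<^sup>+w. indicator (alive_until s) w * indicator B w \<partial>conditioned)"
      using that by (intro emeasure_density) auto
    also have "\<dots> = (\<integral>\<^sup>+w. indicator (B \<inter> alive_until s) w \<partial>conditioned)"
      by (intro nn_integral_cong) (auto simp: indicator_def)
    finally show ?thesis using that by simp
  qed
  have "emeasure ?N A = emeasure (density M (h_weight s)) A"
  proof (rule coords_emeasure_eqI[of "{0..s}"])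
    show "sets ?N = sets skorohod" "sets (density M (h_weight s)) = sets skorohod"
      using sets_M by auto
    interpret C: prob_space conditioned by (rule prob_space_distr) measurable
    have "emeasure conditioned (space skorohod \<inter> alive_until s) \<le> 1" by (rule C.emeasure_le_1)
    then show "emeasure ?N (space skorohod) \<noteq> \<infinity>" by (subst N) (auto simp: top_unique)
    fix J c assume J: "finite J" "J \<subseteq> {0..s}"
    have "cylinder J c \<in> sets skorohod"
      unfolding sets_skorohod by (rule cylinder_sets[OF J(1)]) (use J in auto)
    then show "emeasure ?N (cylinder J c) = emeasure (density M (h_weight s)) (cylinder J c)"
      by (simp only: N emeasure_conditioned_cylinder[OF J s] emeasure_h_transform_cylinder[OF J s])
  qed (use A in \<open>auto simp: past_eq_coords\<close>)
  also have "\<dots> = (\<integral>\<^sup>+w. h_weight s w * indicator A w \<partial>M)"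
    using A' by (intro emeasure_density measurable_h_weight s) (simp add: sets_M)
  finally show "emeasure conditioned (A \<inter> {w \<in> space skorohod. ereal s < death_time w}) =
    (\<integral>\<^sup>+w. ennreal ((case w s of None \<Rightarrow> 0 | Some x \<Rightarrow> h_fun f b x) / h_fun f b 0) * indicator A w \<partial>M)"
    by (simp only: N[OF A', unfolded alive_until_def] alive_until_def h_weight_def)
qed

end

theorem theorem4:
  fixes \<alpha> C b :: real
    and P :: "real \<Rightarrow> path measure"
    and f :: "real \<Rightarrow> real \<Rightarrow> real"
  assumes "0 < \<alpha>" and "\<alpha> < 1" and "0 < C" and "0 < b"
    and "\<And>x. 0 \<le> x \<Longrightarrow> stable_subordinator_law \<alpha> C x (P x)"
    and "continuous_densities (P 0) f"
  shows "(AE w in P 0. well_defined_at b w) \<and>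
    rescaled_path \<alpha> b \<in> P 0 \<rightarrow>\<^sub>M skorohod \<and>
    distr (P 0) skorohod (rescaled_path \<alpha> b) = conditioned_law P (h_fun f b) b 0"
proof (intro conjI)
  interpret subordinator \<alpha> C b "P 0" f
    by (rule subordinator.intro) (use assms in auto)
  show "AE w in P 0. well_defined_at b w"
    using AE_good by eventually_elim (rule good_well_defined)
  show "rescaled_path \<alpha> b \<in> P 0 \<rightarrow>\<^sub>M skorohod" by (rule measurable_rescaled_path_M)
  have "conditioned_law P (h_fun f b) b 0 = distr (P 0) skorohod (rescaled_path \<alpha> b)"
    unfolding conditioned_law_def
    using is_conditioned_law_conditioned conditioned_law_unique[OF _ is_conditioned_law_conditioned]
    by (rule the_equality)
  then show "distr (P 0) skorohod (rescaled_path \<alpha> b) = conditioned_law P (h_fun f b) b 0" ..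
qed

end
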